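(* Let $f_0,\dots,f_m\colon\{-1,1\}^n\to\mathbb R$ and $g_0,\dots,g_n\colon\{-1,1\}^m\to\mathbb R$ form a multilinear generalized polymorphism, i.e. for all $z\in\{-1,1\}^{[n]\times[m]}$, $f_0(g_1(z_{1\cdot}),\dots,g_n(z_{n\cdot}))=g_0(f_1(z_{\cdot1}),\dots,f_m(z_{\cdot m}))$ with $z_{i\cdot}=(z_{i1},\dots,z_{im})$, $z_{\cdot j}=(z_{1j},\dots,z_{nj})$. Suppose $f_0,g_0$ depend on all their inputs and $f_1,\dots,f_m,g_1,\dots,g_n$ are Boolean-like and non-constant. Then there exist: (i) a set $Z_0\subseteq[n]\times[m]$; (ii) a partition $Z_0=Z_1\sqcup\dots\sqcup Z_k$ into parts pairwise disjoint in rows and in columns, such that for every $(i,j)\in Z_\ell$ we have $\mathrm{Dep}(g_i)\subseteq\mathrm{cols}(Z_\ell)$, $\mathrm{Dep}(f_j)\subseteq\mathrm{rows}(Z_\ell)$, and for all $i'\in\mathrm{rows}(Z_\ell)$, $j'\in\mathrm{cols}(Z_\ell)$, $j'\in\mathrm{Dep}(g_{i'})$ iff $i'\in\mathrm{Dep}(f_{j'})$; (iii) a multilinear polynomial $h\colon\mathbb R^k\to\mathbb R$ depending on all its coordinates; (iv) functions $\gamma_i\colon\{-1,1\}^{\mathrm{Dep}_{=1}(g_i)}\to\mathbb R$ ($i\in\mathrm{rows}(Z_0)$) and $\phi_j\colon\{-1,1\}^{\mathrm{Dep}_{=1}(f_j)}\to\mathbb R$ ($j\in\mathrm{cols}(Z_0)$);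 (v) real constants $D_i$ ($i\in[n]$), $B_j$ ($j\in[m]$), $\kappa_{ij}$ ($(i,j)\in Z_0$), with $D_i=0$ whenever $\deg g_i=1$, $B_j=0$ whenever $\deg f_j=1$, and $\kappa_{ij}=0$ whenever $\deg g_i=1$ or $\deg f_j=1$; such that $f_j(x)=\Big(\prod_{i\in\mathrm{Dep}_{\ge2}(f_j)}(x_i+\kappa_{ij})\Big)\phi_j(x|_{\mathrm{Dep}_{=1}(f_j)})+B_j$, $g_i(y)=\Big(\prod_{j\in\mathrm{Dep}_{\ge2}(g_i)}(y_j+\kappa_{ij})\Big)\gamma_i(y|_{\mathrm{Dep}_{=1}(g_i)})+D_i$, $f_0=h(f_0^{(1)},\dots,f_0^{(k)})$, $g_0=h(g_0^{(1)},\dots,g_0^{(k)})$, where $f_0^{(\ell)}(x)=\Big(\prod_{i\in\mathrm{rows}_{\ge2}(Z_\ell)}(x_i-D_i)\Big)\prod_{j\in\mathrm{cols}_{\ge2}(Z_\ell)}\phi_j(x^{\mathrm{sgn}})$ if $|Z_\ell|>1$ and $f_0^{(\ell)}(x)=\mathrm{sgn}(f_j)x_i$ if $Z_\ell=\{(i,j)\}$; $g_0^{(\ell)}(y)=\Big(\prod_{j\in\mathrm{cols}_{\ge2}(Z_\ell)}(y_j-B_j)\Big)\prod_{i\in\mathrm{rows}_{\ge2}(Z_\ell)}\gamma_i(y^{\mathrm{sgn}})$ if $|Z_\ell|>1$ and $g_0^{(\ell)}(y)=\mathrm{sgn}(g_i)y_j$ if $Z_\ell=\{(i,j)\}$. Conversely,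 if functions $f_0,\dots,f_m,g_0,\dots,g_n$ (with $f_1,\dots,f_m,g_1,\dots,g_n$ Boolean-like and non-constant) admit data (i)–(v) satisfying these formulas, then they form a multilinear generalized polymorphism.
   Context: Every $f\colon\{-1,1\}^n\to\mathbb R$ is identified with its unique multilinear expansion $f(x)=\sum_{S\subseteq[n]}\hat f(S)\prod_{i\in S}x_i$; $\mathrm{supp}(\hat f)=\{S:\hat f(S)\ne0\}$; $\deg f$ is its degree; $\mathrm{Dep}(f)$ is the set of coordinates $f$ depends on (equivalently the union of $\mathrm{supp}(\hat f)$). A dictator is a non-constant function depending on exactly one coordinate. $f$ is 2-valued-like if (a) $\deg f=1$ iff $f$ is a dictator, and (b) if $f$ is not a dictator then for every $w\in\mathrm{Dep}(f)$ some $S\in\mathrm{supp}(\hat f)$ with $|S|\ge2$ contains $w$. $f$ is Boolean-like if it is 2-valued-like and $\deg f=1$ iff $f=s\,x_i$ for some coordinate $i$ and $s\in\{-1,1\}$; then $\mathrm{sgn}(f)=s$. For $W\subseteq[n]\times[m]$, $\mathrm{rows}(W),\mathrm{cols}(W)$ are its projections. $\mathrm{rows}_{\ge2}(Z_\ell)=\{i\in\mathrm{rows}(Z_\ell):\deg g_i\ge2\}$, $\mathrm{cols}_{\ge2}(Z_\ell)=\{j\in\mathrm{cols}(Z_\ell):\deg f_j\ge2\}$. $\mathrm{Dep}_{=1}(g_i)=\{j\in\mathrm{Dep}(g_i):\deg f_j=1\}$, $\mathrm{Dep}_{\ge2}(g_i)=\{j\in\mathrm{Dep}(g_i):\deg f_j\ge2\}$,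 $\mathrm{Dep}_{=1}(f_j)=\{i\in\mathrm{Dep}(f_j):\deg g_i=1\}$, $\mathrm{Dep}_{\ge2}(f_j)=\{i\in\mathrm{Dep}(f_j):\deg g_i\ge2\}$. $x^{\mathrm{sgn}}$ is $x$ with $x_i$ replaced by $\mathrm{sgn}(g_i)x_i$ whenever $\deg g_i=1$; $y^{\mathrm{sgn}}$ is $y$ with $y_j$ replaced by $\mathrm{sgn}(f_j)y_j$ whenever $\deg f_j=1$; $\phi_j(x^{\mathrm{sgn}})$ means $\phi_j$ applied to the coordinates of $x^{\mathrm{sgn}}$ indexed by $\mathrm{Dep}_{=1}(f_j)$, and $\gamma_i(y^{\mathrm{sgn}})$ similarly with $\mathrm{Dep}_{=1}(g_i)$. *)

theory Defs
  imports "HOL-Analysis.Analysis"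
begin

section \<open>Functions on the cube and their multilinear expansions\<close>

text \<open>
  A function $\{-1,1\}^I \to \mathbb{R}$ is a HOL function on \<open>'a \<Rightarrow> real\<close> of which only the
  values on the (extensional) set \<open>cube I\<close> are ever used.
\<close>

definition cube :: "'a set \<Rightarrow> ('a \<Rightarrow> real) set" where
  "cube I = I \<rightarrow>\<^sub>E {-1, 1}"

definition fourier :: "'a set \<Rightarrow> (('a \<Rightarrow> real) \<Rightarrow> real) \<Rightarrow> 'a set \<Rightarrow> real" where
  "fourier I f S = (\<Sum>x\<in>cube I. f x * (\<Prod>i\<in>S. x i)) / 2 ^ card I"

definition mlx :: "'a set \<Rightarrow> (('a \<Rightarrow> real) \<Rightarrow> real) \<Rightarrow> ('a \<Rightarrow> real) \<Rightarrow> real" where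
  "mlx I f x = (\<Sum>S\<in>Pow I. fourier I f S * (\<Prod>i\<in>S. x i))"

definition fsupp :: "'a set \<Rightarrow> (('a \<Rightarrow> real) \<Rightarrow> real) \<Rightarrow> 'a set set" where
  "fsupp I f = {S. S \<subseteq> I \<and> fourier I f S \<noteq> 0}"

text \<open>The zero function gets degree 0.\<close>

definition fdeg :: "'a set \<Rightarrow> (('a \<Rightarrow> real) \<Rightarrow> real) \<Rightarrow> nat" where
  "fdeg I f = Max (insert 0 (card ` fsupp I f))"

definition Dep :: "'a set \<Rightarrow> (('a \<Rightarrow> real) \<Rightarrow> real) \<Rightarrow> 'a set" where
  "Dep I f = {i \<in> I. \<exists>x\<in>cube I. f (x(i := - x i)) \<noteq> f x}"

definition dictator :: "'a set \<Rightarrow> (('a \<Rightarrow> real) \<Rightarrow> real) \<Rightarrow> bool" where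
  "dictator I f \<longleftrightarrow> \<not> f constant_on cube I \<and> (\<exists>i. Dep I f = {i})"

definition two_valued_like :: "'a set \<Rightarrow> (('a \<Rightarrow> real) \<Rightarrow> real) \<Rightarrow> bool" where
  "two_valued_like I f \<longleftrightarrow>
     (fdeg I f = 1 \<longleftrightarrow> dictator I f) \<and>
     (\<not> dictator I f \<longrightarrow> (\<forall>w\<in>Dep I f. \<exists>S\<in>fsupp I f. 2 \<le> card S \<and> w \<in> S))"

definition boolean_like :: "'a set \<Rightarrow> (('a \<Rightarrow> real) \<Rightarrow> real) \<Rightarrow> bool" where
  "boolean_like I f \<longleftrightarrow>
     two_valued_like I f \<and>
     (fdeg I f = 1 \<longleftrightarrow> (\<exists>i\<in>I. \<exists>s\<in>{-1, 1}. \<forall>x\<in>cube I. f x = s * x i))"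

text \<open>Meaningful only for Boolean-like functions of degree 1; there the sign is unique.\<close>

definition fsgn :: "'a set \<Rightarrow> (('a \<Rightarrow> real) \<Rightarrow> real) \<Rightarrow> real" where
  "fsgn I f = (THE s. s \<in> {-1, 1} \<and> (\<exists>i\<in>I. \<forall>x\<in>cube I. f x = s * x i))"

text \<open>
  Multilinear polynomials $\mathbb{R}^K \to \mathbb{R}$ that depend on every coordinate in \<open>K\<close>;
  the coordinates of the argument outside \<open>K\<close> are irrelevant.
\<close>

definition multilinear_poly :: "'a set \<Rightarrow> (('a \<Rightarrow> real) \<Rightarrow> real) \<Rightarrow> bool" where
  "multilinear_poly K h \<longleftrightarrow> (\<exists>c. \<forall>t. h t = (\<Sum>S\<in>Pow K. c S * (\<Prod>l\<in>S. t l)))"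

definition depends_on_all :: "'a set \<Rightarrow> (('a \<Rightarrow> real) \<Rightarrow> real) \<Rightarrow> bool" where
  "depends_on_all K h \<longleftrightarrow> (\<forall>l\<in>K. \<exists>t r. h (t(l := r)) \<noteq> h t)"


section \<open>Multilinear generalized polymorphisms\<close>

text \<open>
  Throughout, \<open>f 0, \<dots>, f m\<close> are functions on \<open>cube {1..n}\<close> and \<open>g 0, \<dots>, g n\<close> are functions on
  \<open>cube {1..m}\<close>.
\<close>

definition multilinear_gen_polymorphism ::
  "nat \<Rightarrow> nat \<Rightarrow> (nat \<Rightarrow> (nat \<Rightarrow> real) \<Rightarrow> real) \<Rightarrow> (nat \<Rightarrow> (nat \<Rightarrow> real) \<Rightarrow> real) \<Rightarrow> bool" where
  "multilinear_gen_polymorphism n m f g \<longleftrightarrow>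
     (\<forall>z\<in>cube ({1..n} \<times> {1..m}).
        mlx {1..n} (f 0) (\<lambda>i. g i (\<lambda>j\<in>{1..m}. z (i, j))) =
        mlx {1..m} (g 0) (\<lambda>j. f j (\<lambda>i\<in>{1..n}. z (i, j))))"

text \<open>
  The next four definitions are stated for one function \<open>p\<close> on \<open>cube I\<close> and a family \<open>q\<close> of
  functions on \<open>cube J\<close> indexed by \<open>I\<close>.  They are used both with \<open>p = f j\<close>, \<open>q = g\<close> and with
  \<open>p = g i\<close>, \<open>q = f\<close>.
\<close>

definition Dep_eq1 ::
  "'a set \<Rightarrow> 'b set \<Rightarrow> ('a \<Rightarrow> ('b \<Rightarrow> real) \<Rightarrow> real) \<Rightarrow> (('a \<Rightarrow> real) \<Rightarrow> real) \<Rightarrow> 'a set" where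
  "Dep_eq1 I J q p = {i \<in> Dep I p. fdeg J (q i) = 1}"

definition Dep_ge2 ::
  "'a set \<Rightarrow> 'b set \<Rightarrow> ('a \<Rightarrow> ('b \<Rightarrow> real) \<Rightarrow> real) \<Rightarrow> (('a \<Rightarrow> real) \<Rightarrow> real) \<Rightarrow> 'a set" where
  "Dep_ge2 I J q p = {i \<in> Dep I p. 2 \<le> fdeg J (q i)}"

definition deg_ge2 :: "'b set \<Rightarrow> ('a \<Rightarrow> ('b \<Rightarrow> real) \<Rightarrow> real) \<Rightarrow> 'a set \<Rightarrow> 'a set" where
  "deg_ge2 J q A = {i \<in> A. 2 \<le> fdeg J (q i)}"

definition sgn_twist ::
  "'b set \<Rightarrow> ('a \<Rightarrow> ('b \<Rightarrow> real) \<Rightarrow> real) \<Rightarrow> ('a \<Rightarrow> real) \<Rightarrow> 'a \<Rightarrow> real" where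
  "sgn_twist J q x = (\<lambda>i. if fdeg J (q i) = 1 then fsgn J (q i) * x i else x i)"

abbreviation rows :: "('a \<times> 'b) set \<Rightarrow> 'a set" where "rows W \<equiv> fst ` W"
abbreviation cols :: "('a \<times> 'b) set \<Rightarrow> 'b set" where "cols W \<equiv> snd ` W"

text \<open>\<open>Z 0\<close> is the whole set and \<open>Z 1, \<dots>, Z k\<close> are the parts.\<close>

definition block_partition ::
  "nat \<Rightarrow> nat \<Rightarrow> (nat \<Rightarrow> (nat \<Rightarrow> real) \<Rightarrow> real) \<Rightarrow> (nat \<Rightarrow> (nat \<Rightarrow> real) \<Rightarrow> real) \<Rightarrow>
   nat \<Rightarrow> (nat \<Rightarrow> (nat \<times> nat) set) \<Rightarrow> bool" where
  "block_partition n m f g k Z \<longleftrightarrow>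
     Z 0 \<subseteq> {1..n} \<times> {1..m} \<and>
     Z 0 = (\<Union>l\<in>{1..k}. Z l) \<and>
     (\<forall>l\<in>{1..k}. Z l \<noteq> {}) \<and>
     disjoint_family_on (\<lambda>l. rows (Z l)) {1..k} \<and>
     disjoint_family_on (\<lambda>l. cols (Z l)) {1..k} \<and>
     (\<forall>l\<in>{1..k}. \<forall>(i, j)\<in>Z l.
        Dep {1..m} (g i) \<subseteq> cols (Z l) \<and>
        Dep {1..n} (f j) \<subseteq> rows (Z l) \<and>
        (\<forall>i'\<in>rows (Z l). \<forall>j'\<in>cols (Z l).
           j' \<in> Dep {1..m} (g i') \<longleftrightarrow> i' \<in> Dep {1..n} (f j')))"

definition constants_ok ::
  "nat \<Rightarrow> nat \<Rightarrow> (nat \<Rightarrow> (nat \<Rightarrow> real) \<Rightarrow> real) \<Rightarrow> (nat \<Rightarrow> (nat \<Rightarrow> real) \<Rightarrow> real) \<Rightarrow>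
   (nat \<times> nat) set \<Rightarrow> (nat \<Rightarrow> real) \<Rightarrow> (nat \<Rightarrow> real) \<Rightarrow> (nat \<Rightarrow> nat \<Rightarrow> real) \<Rightarrow> bool" where
  "constants_ok n m f g Z0 D B \<kappa> \<longleftrightarrow>
     (\<forall>i\<in>{1..n}. fdeg {1..m} (g i) = 1 \<longrightarrow> D i = 0) \<and>
     (\<forall>j\<in>{1..m}. fdeg {1..n} (f j) = 1 \<longrightarrow> B j = 0) \<and>
     (\<forall>(i, j)\<in>Z0. fdeg {1..m} (g i) = 1 \<or> fdeg {1..n} (f j) = 1 \<longrightarrow> \<kappa> i j = 0)"

text \<open>
  The block functions $f_0^{(\ell)}$ and $g_0^{(\ell)}$ of a nonempty block \<open>W\<close>.
\<close>

definition f0_block ::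
  "nat \<Rightarrow> nat \<Rightarrow> (nat \<Rightarrow> (nat \<Rightarrow> real) \<Rightarrow> real) \<Rightarrow> (nat \<Rightarrow> (nat \<Rightarrow> real) \<Rightarrow> real) \<Rightarrow>
   (nat \<Rightarrow> (nat \<Rightarrow> real) \<Rightarrow> real) \<Rightarrow> (nat \<Rightarrow> real) \<Rightarrow> (nat \<times> nat) set \<Rightarrow> (nat \<Rightarrow> real) \<Rightarrow> real" where
  "f0_block n m f g \<phi> D W x =
     (if card W > 1
      then (\<Prod>i\<in>deg_ge2 {1..m} g (rows W). x i - D i) *
           (\<Prod>j\<in>deg_ge2 {1..n} f (cols W).
              \<phi> j (restrict (sgn_twist {1..m} g x) (Dep_eq1 {1..n} {1..m} g (f j))))
      else (case the_elem W of (i, j) \<Rightarrow> fsgn {1..n} (f j) * x i))"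

definition g0_block ::
  "nat \<Rightarrow> nat \<Rightarrow> (nat \<Rightarrow> (nat \<Rightarrow> real) \<Rightarrow> real) \<Rightarrow> (nat \<Rightarrow> (nat \<Rightarrow> real) \<Rightarrow> real) \<Rightarrow>
   (nat \<Rightarrow> (nat \<Rightarrow> real) \<Rightarrow> real) \<Rightarrow> (nat \<Rightarrow> real) \<Rightarrow> (nat \<times> nat) set \<Rightarrow> (nat \<Rightarrow> real) \<Rightarrow> real" where
  "g0_block n m f g \<gamma> B W y =
     (if card W > 1
      then (\<Prod>j\<in>deg_ge2 {1..n} f (cols W). y j - B j) *
           (\<Prod>i\<in>deg_ge2 {1..m} g (rows W).
              \<gamma> i (restrict (sgn_twist {1..n} f y) (Dep_eq1 {1..m} {1..n} f (g i))))
      else (case the_elem W of (i, j) \<Rightarrow> fsgn {1..m} (g i) * y j))"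

definition decomposition_formulas ::
  "nat \<Rightarrow> nat \<Rightarrow> (nat \<Rightarrow> (nat \<Rightarrow> real) \<Rightarrow> real) \<Rightarrow> (nat \<Rightarrow> (nat \<Rightarrow> real) \<Rightarrow> real) \<Rightarrow>
   (nat \<Rightarrow> (nat \<times> nat) set) \<Rightarrow> ((nat \<Rightarrow> real) \<Rightarrow> real) \<Rightarrow>
   (nat \<Rightarrow> (nat \<Rightarrow> real) \<Rightarrow> real) \<Rightarrow> (nat \<Rightarrow> (nat \<Rightarrow> real) \<Rightarrow> real) \<Rightarrow>
   (nat \<Rightarrow> real) \<Rightarrow> (nat \<Rightarrow> real) \<Rightarrow> (nat \<Rightarrow> nat \<Rightarrow> real) \<Rightarrow> bool" where
  "decomposition_formulas n m f g Z h \<gamma> \<phi> D B \<kappa> \<longleftrightarrow>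
     (\<forall>j\<in>cols (Z 0). \<forall>x\<in>cube {1..n}.
        f j x = (\<Prod>i\<in>Dep_ge2 {1..n} {1..m} g (f j). x i + \<kappa> i j) *
                \<phi> j (restrict x (Dep_eq1 {1..n} {1..m} g (f j))) + B j) \<and>
     (\<forall>i\<in>rows (Z 0). \<forall>y\<in>cube {1..m}.
        g i y = (\<Prod>j\<in>Dep_ge2 {1..m} {1..n} f (g i). y j + \<kappa> i j) *
                \<gamma> i (restrict y (Dep_eq1 {1..m} {1..n} f (g i))) + D i) \<and>
     (\<forall>x\<in>cube {1..n}. f 0 x = h (\<lambda>l. f0_block n m f g \<phi> D (Z l) x)) \<and>
     (\<forall>y\<in>cube {1..m}. g 0 y = h (\<lambda>l. g0_block n m f g \<gamma> B (Z l) y))"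

definition polymorphism_data ::
  "nat \<Rightarrow> nat \<Rightarrow> (nat \<Rightarrow> (nat \<Rightarrow> real) \<Rightarrow> real) \<Rightarrow> (nat \<Rightarrow> (nat \<Rightarrow> real) \<Rightarrow> real) \<Rightarrow>
   nat \<Rightarrow> (nat \<Rightarrow> (nat \<times> nat) set) \<Rightarrow> ((nat \<Rightarrow> real) \<Rightarrow> real) \<Rightarrow>
   (nat \<Rightarrow> (nat \<Rightarrow> real) \<Rightarrow> real) \<Rightarrow> (nat \<Rightarrow> (nat \<Rightarrow> real) \<Rightarrow> real) \<Rightarrow>
   (nat \<Rightarrow> real) \<Rightarrow> (nat \<Rightarrow> real) \<Rightarrow> (nat \<Rightarrow> nat \<Rightarrow> real) \<Rightarrow> bool" where
  "polymorphism_data n m f g k Z h \<gamma> \<phi> D B \<kappa> \<longleftrightarrow>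
     block_partition n m f g k Z \<and>
     multilinear_poly {1..k} h \<and> depends_on_all {1..k} h \<and>
     constants_ok n m f g (Z 0) D B \<kappa> \<and>
     decomposition_formulas n m f g Z h \<gamma> \<phi> D B \<kappa>"

text \<open>
  The constants \<open>\<kappa> i j\<close> are meant to exist only for \<open>(i, j) \<in> Z 0\<close>, whereas \<open>\<kappa>\<close> is a total HOL
  function.  The following says that the formulas refer to no \<open>\<kappa> i j\<close> outside that range.
\<close>

definition kappa_within ::
  "nat \<Rightarrow> nat \<Rightarrow> (nat \<Rightarrow> (nat \<Rightarrow> real) \<Rightarrow> real) \<Rightarrow> (nat \<Rightarrow> (nat \<Rightarrow> real) \<Rightarrow> real) \<Rightarrow>
   (nat \<times> nat) set \<Rightarrow> bool" where
  "kappa_within n m f g Z0 \<longleftrightarrow>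
     (\<forall>j\<in>cols Z0. \<forall>i\<in>Dep_ge2 {1..n} {1..m} g (f j). (i, j) \<in> Z0) \<and>
     (\<forall>i\<in>rows Z0. \<forall>j\<in>Dep_ge2 {1..m} {1..n} f (g i). (i, j) \<in> Z0)"


section \<open>Basic facts about the expansion\<close>

lemma finite_cube: "finite I \<Longrightarrow> finite (cube I)"
  by (simp add: cube_def finite_PiE)

lemma cube_eqI:
  assumes "x \<in> cube I" "y \<in> cube I" "\<And>i. i \<in> I \<Longrightarrow> x i = y i"
  shows "x = y"
  using assms unfolding cube_def by (meson PiE_ext)

lemma cube_vals: "x \<in> cube I \<Longrightarrow> i \<in> I \<Longrightarrow> x i = -1 \<or> x i = 1"
  by (auto simp: cube_def PiE_iff)

lemma cube_flip: "x \<in> cube I \<Longrightarrow> i \<in> I \<Longrightarrow> x(i := - x i) \<in> cube I"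
  using cube_vals[of x I i] by (auto simp: cube_def PiE_iff extensional_def)

lemma mlx_cube:
  assumes I: "finite I" and x: "x \<in> cube I"
  shows "mlx I f x = f x"
proof -
  have kernel: "(\<Sum>S\<in>Pow I. (\<Prod>i\<in>S. y i) * (\<Prod>i\<in>S. x i)) = (if y = x then 2 ^ card I else 0)"
    if y: "y \<in> cube I" for y
  proof -
    have "(\<Sum>S\<in>Pow I. (\<Prod>i\<in>S. y i) * (\<Prod>i\<in>S. x i)) = (\<Prod>i\<in>I. y i * x i + 1)"
      using I by (simp add: prod_add prod.distrib)
    also have "\<dots> = (if y = x then 2 ^ card I else 0)"
    proof (cases "y = x")
      case True
      have "(\<Prod>i\<in>I. y i * x i + 1) = (\<Prod>i\<in>I. 2)"
        using cube_vals[OF x] True by (intro prod.cong) force+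
      then show ?thesis using True by simp
    next
      case False
      then obtain i where i: "i \<in> I" "y i \<noteq> x i" using cube_eqI[OF y x] by blast
      then have "y i * x i + 1 = 0" using cube_vals[OF x i(1)] cube_vals[OF y i(1)] by auto
      then have "(\<Prod>i\<in>I. y i * x i + 1) = 0" using I i(1) by (meson prod_zero)
      then show ?thesis using False by simp
    qed
    finally show ?thesis .
  qed
  have "mlx I f x = (\<Sum>S\<in>Pow I. \<Sum>y\<in>cube I. f y * ((\<Prod>i\<in>S. y i) * (\<Prod>i\<in>S. x i)) / 2 ^ card I)"
    unfolding mlx_def fourier_def
    by (simp add: sum_distrib_right sum_divide_distrib mult.assoc)
  also have "\<dots> = (\<Sum>y\<in>cube I. \<Sum>S\<in>Pow I. f y * ((\<Prod>i\<in>S. y i) * (\<Prod>i\<in>S. x i)) / 2 ^ card I)"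
    by (rule sum.swap)
  also have "\<dots> = (\<Sum>y\<in>cube I. f y * (if y = x then 2 ^ card I else 0) / 2 ^ card I)"
    by (intro sum.cong refl) (simp add: kernel[symmetric] sum_distrib_left sum_divide_distrib)
  also have "\<dots> = (\<Sum>y\<in>cube I. if y = x then f y else 0)"
    by (intro sum.cong) auto
  also have "\<dots> = f x" using x finite_cube[OF I] by simp
  finally show ?thesis .
qed

lemma fourier_unique:
  assumes I: "finite I" and T: "T \<subseteq> I"
    and f: "\<And>x. x \<in> cube I \<Longrightarrow> f x = (\<Sum>S\<in>Pow I. c S * (\<Prod>i\<in>S. x i))"
  shows "fourier I f T = c T"
proof -
  have orth: "(\<Sum>x\<in>cube I. (\<Prod>i\<in>S. x i) * (\<Prod>i\<in>T. x i)) = (if S = T then 2 ^ card I else 0)"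
    if S: "S \<subseteq> I" for S
  proof -
    let ?a = "\<lambda>i v::real. (if i \<in> S then v else 1) * (if i \<in> T then v else 1)"
    have "(\<Prod>i\<in>S. x i) * (\<Prod>i\<in>T. x i) = (\<Prod>i\<in>I. ?a i (x i))" for x
      using I S T by (simp add: prod.distrib prod.If_cases Int_absorb1)
    then have "(\<Sum>x\<in>cube I. (\<Prod>i\<in>S. x i) * (\<Prod>i\<in>T. x i)) = (\<Prod>i\<in>I. \<Sum>v\<in>{-1, 1}. ?a i v)"
      unfolding cube_def using I by (simp only: prod_sum_PiE finite.intros)
    also have "\<dots> = (\<Prod>i\<in>I. if i \<in> S \<longleftrightarrow> i \<in> T then 2 else 0)"
      by (intro prod.cong) auto
    also have "\<dots> = (if S = T then 2 ^ card I else 0)"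
    proof (cases "S = T")
      case False
      then obtain i where "i \<in> I" "\<not> (i \<in> S \<longleftrightarrow> i \<in> T)" using S T by blast
      then have "(\<Prod>i\<in>I. if i \<in> S \<longleftrightarrow> i \<in> T then 2 else 0) = (0::real)"
        using I by (intro prod_zero) auto
      then show ?thesis using False by simp
    qed simp
    finally show ?thesis .
  qed
  have "(\<Sum>x\<in>cube I. f x * (\<Prod>i\<in>T. x i))
      = (\<Sum>x\<in>cube I. \<Sum>S\<in>Pow I. c S * ((\<Prod>i\<in>S. x i) * (\<Prod>i\<in>T. x i)))"
    by (intro sum.cong refl) (simp add: f sum_distrib_right mult.assoc)
  also have "\<dots> = (\<Sum>S\<in>Pow I. \<Sum>x\<in>cube I. c S * ((\<Prod>i\<in>S. x i) * (\<Prod>i\<in>T. x i)))"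
    by (rule sum.swap)
  also have "\<dots> = (\<Sum>S\<in>Pow I. if S = T then c S * 2 ^ card I else 0)"
    by (intro sum.cong refl) (auto simp: orth sum_distrib_left[symmetric])
  also have "\<dots> = c T * 2 ^ card I" using I T by simp
  finally show ?thesis by (simp add: fourier_def)
qed

lemma Dep_eq_Union_fsupp:
  assumes I: "finite I"
  shows "Dep I f = \<Union> (fsupp I f)"
proof (intro equalityI subsetI)
  fix i assume "i \<in> Dep I f"
  then obtain x where x: "i \<in> I" "x \<in> cube I" "f (x(i := - x i)) \<noteq> f x" by (auto simp: Dep_def)
  show "i \<in> \<Union> (fsupp I f)"
  proof (rule ccontr)
    assume *: "i \<notin> \<Union> (fsupp I f)"
    have "fourier I f S * (\<Prod>j\<in>S. (x(i := - x i)) j) = fourier I f S * (\<Prod>j\<in>S. x j)"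
      if "S \<in> Pow I" for S
    proof (cases "i \<in> S")
      case True
      then have "fourier I f S = 0" using * that by (auto simp: fsupp_def)
      then show ?thesis by simp
    next
      case False
      then have "(\<Prod>j\<in>S. (x(i := - x i)) j) = (\<Prod>j\<in>S. x j)" by (intro prod.cong) auto
      then show ?thesis by simp
    qed
    then have "mlx I f (x(i := - x i)) = mlx I f x" unfolding mlx_def by (rule sum.cong[OF refl])
    then show False using x mlx_cube[OF I] cube_flip by metis
  qed
next
  fix i assume "i \<in> \<Union> (fsupp I f)"
  then obtain S where S: "i \<in> S" "S \<subseteq> I" "fourier I f S \<noteq> 0" by (auto simp: fsupp_def)
  show "i \<in> Dep I f"
  proof (rule ccontr)
    assume "i \<notin> Dep I f"
    then have inv: "f (x(i := - x i)) = f x" if "x \<in> cube I" for x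
      using that S by (auto simp: Dep_def)
    have fin: "finite S" using I S finite_subset by blast
    have flip: "(\<Prod>j\<in>S. (x(i := - x i)) j) = - (\<Prod>j\<in>S. x j)" for x :: "'a \<Rightarrow> real"
    proof -
      have "(\<Prod>j\<in>S - {i}. (x(i := - x i)) j) = (\<Prod>j\<in>S - {i}. x j)" by (intro prod.cong) auto
      then show ?thesis using prod.remove[OF fin S(1), of "x(i := - x i)"] prod.remove[OF fin S(1), of x]
        by simp
    qed
    have "(\<Sum>x\<in>cube I. f x * (\<Prod>j\<in>S. x j))
        = (\<Sum>x\<in>cube I. f (x(i := - x i)) * (\<Prod>j\<in>S. (x(i := - x i)) j))"
      by (rule sum.reindex_bij_witness[where i = "\<lambda>x. x(i := - x i)" and j = "\<lambda>x. x(i := - x i)"])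
         (use S(1) S(2) in \<open>auto intro!: cube_flip\<close>)
    also have "\<dots> = - (\<Sum>x\<in>cube I. f x * (\<Prod>j\<in>S. x j))"
      unfolding flip by (simp add: inv sum_negf)
    finally show False using S(3) by (simp add: fourier_def)
  qed
qed

end

theory Submission
  imports Defs
begin

text \<open>
  Extend all functions multilinearly to real arguments, so that non-constant ones become surjective
  and $f_0(g_1(z_{1\cdot}),\dots) = g_0(f_1(z_{\cdot 1}),\dots)$ holds for every real matrix \<open>z\<close>.
  Differentiating in $z_{ij}$ gives
  $(\partial_i f_0)(g)\,\partial_j g_i = (\partial_j g_0)(f)\,\partial_i f_j$; since the factors
  depend on different entries of \<open>z\<close>, a coordinate \<open>j\<close> is relevant for $g_i$ iff \<open>i\<close> is relevant for
  $f_j$, and if both $g_i$ and $f_j$ have degree at least 2 then $g_i - D_i$ is divisible by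
  $y_j + \kappa_{ij}$ and $f_j - B_j$ by $x_i + \kappa_{ij}$, with the same $\kappa_{ij}$.
  Setting $z_{ij} = -\kappa_{ij}$ freezes both row \<open>i\<close> and column \<open>j\<close>; hence $f_0$ restricted to
  $x_i = D_i$ does not depend on the rows sharing a column with \<open>i\<close>, nor, by following paths, on any
  row of the connected component of \<open>i\<close>. So on each component $f_0$ is a constant plus a multiple of
  the product $f_0^{(\ell)}$, and these affine dependencies on the components are glued to \<open>h\<close>.
\<close>

section \<open>Multiaffine functions\<close>

text \<open>Boolean-likeness enters through a dichotomy for the extensions: a function is plus or
  minus one coordinate, or its derivative in every relevant coordinate is nonconstant. Rows of the
  first kind meet a single column, so they are leaves: paths can bypass them, no divisibility is
  available in their variables, and these are absorbed into \<open>\<phi> j\<close>; columns of the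
  first kind are absorbed into \<open>\<gamma> i\<close>. The sign being -1 or 1, multiplying by it
  again recovers a leaf entry from the value of its row.

  The formula for \<open>g 0\<close> is not obtained by running the argument on the transposed data,
  which might produce another \<open>h\<close>. Evaluated at the row values and the column values of
  one matrix, the two block functions are the same product (\<open>block_functions_agree\<close>); a
  matrix with prescribed column values therefore carries \<open>h\<close> over. The same identity
  drives the converse. Its obstacle is that \<open>\<phi> j\<close> and \<open>\<gamma> i\<close>
  are constrained on the cube only, so the formulas for \<open>f 0\<close> and \<open>g 0\<close>
  extend to real values just in the coordinates of degree at least 2; the others do take the values
  -1 and 1.\<close>

definition pd :: "'a \<Rightarrow> (('a \<Rightarrow> real) \<Rightarrow> real) \<Rightarrow> ('a \<Rightarrow> real) \<Rightarrow> real" where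
  "pd i p x = p (x(i := 1)) - p (x(i := 0))"

text \<open>Affinity in each variable replaces a coefficient description, so derivatives and
  row-wise compositions stay in the class without sums over subsets. The first clause lets total
  functions serve as arguments.\<close>

definition multiaffine :: "'a set \<Rightarrow> (('a \<Rightarrow> real) \<Rightarrow> real) \<Rightarrow> bool" where
  "multiaffine I p \<longleftrightarrow>
     (\<forall>x y. (\<forall>i\<in>I. x i = y i) \<longrightarrow> p x = p y) \<and>
     (\<forall>i\<in>I. \<forall>x t. p (x(i := t)) = p (x(i := 0)) + t * pd i p x)"

definition infl :: "'a set \<Rightarrow> (('a \<Rightarrow> real) \<Rightarrow> real) \<Rightarrow> 'a set" where
  "infl I p = {i \<in> I. \<exists>x. pd i p x \<noteq> 0}"

definition signed_coord :: "'a set \<Rightarrow> (('a \<Rightarrow> real) \<Rightarrow> real) \<Rightarrow> bool" where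
  "signed_coord I p \<longleftrightarrow> (\<exists>i\<in>I. \<exists>s\<in>{-1, 1}. \<forall>x. p x = s * x i)"

text \<open>A nonconstant derivative means that the coordinate occurs in a monomial of size at least
  2.\<close>

definition nonlinear_in_all :: "'a set \<Rightarrow> (('a \<Rightarrow> real) \<Rightarrow> real) \<Rightarrow> bool" where
  "nonlinear_in_all I p \<longleftrightarrow>
     infl I p \<noteq> {} \<and> (\<forall>i\<in>infl I p. \<exists>x y. pd i p x \<noteq> pd i p y)"

lemma multiaffine_cong:
  "multiaffine I p \<Longrightarrow> (\<And>i. i \<in> I \<Longrightarrow> x i = y i) \<Longrightarrow> p x = p y"
  unfolding multiaffine_def by blast

lemma multiaffine_upd:
  "multiaffine I p \<Longrightarrow> i \<in> I \<Longrightarrow> p (x(i := t)) = p (x(i := 0)) + t * pd i p x"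
  unfolding multiaffine_def by blast

lemma pd_upd [simp]: "pd i p (x(i := t)) = pd i p x"
  by (simp add: pd_def)

lemma pd_swap: "pd i (pd k p) x = pd k (pd i p) x"
proof (cases "i = k")
  case False
  show ?thesis unfolding pd_def fun_upd_twist[OF False, of x] by linarith
qed simp

lemma multiaffine_diff:
  "multiaffine I p \<Longrightarrow> i \<in> I \<Longrightarrow> p (x(i := s)) - p (x(i := t)) = (s - t) * pd i p x"
  using multiaffine_upd[of I p i x s] multiaffine_upd[of I p i x t] by (simp add: left_diff_distrib)

lemma multiaffine_expand:
  "multiaffine I p \<Longrightarrow> i \<in> I \<Longrightarrow> p x = p (x(i := t)) + (x i - t) * pd i p x"
  using multiaffine_diff[of I p i x "x i" t] by simp

lemma pd_cong:
  assumes "multiaffine I p" "\<And>k. k \<in> I \<Longrightarrow> k \<noteq> i \<Longrightarrow> x k = y k"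
  shows "pd i p x = pd i p y"
proof -
  have "p (x(i := t)) = p (y(i := t))" for t
    by (rule multiaffine_cong[OF assms(1)]) (use assms(2) in auto)
  then show ?thesis by (simp add: pd_def)
qed

lemma multiaffine_pd:
  assumes "multiaffine I p"
  shows "multiaffine I (pd i p)"
  unfolding multiaffine_def
proof (intro conjI allI ballI impI)
  fix x y :: "'a \<Rightarrow> real" assume "\<forall>k\<in>I. x k = y k"
  then show "pd i p x = pd i p y" by (intro pd_cong[OF assms]) auto
next
  fix k x t assume k: "k \<in> I"
  show "pd i p (x(k := t)) = pd i p (x(k := 0)) + t * pd k (pd i p) x"
  proof (cases "k = i")
    case True
    have "pd i (pd i p) x = 0" by (simp add: pd_def)
    with True show ?thesis by simp
  next
    case False
    have "p (x(k := t, i := s)) = p (x(k := 0, i := s)) + t * pd k p (x(i := s))" for s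
      using multiaffine_upd[OF assms k, of "x(i := s)" t] fun_upd_twist[OF False, of x] by simp
    then have "pd i p (x(k := t)) = pd i p (x(k := 0)) + t * pd i (pd k p) x"
      by (simp add: pd_def[of i] algebra_simps)
    then show ?thesis by (simp add: pd_swap[of k])
  qed
qed

lemma finite_indep_override:
  assumes "finite C" "\<And>i x t. i \<in> C \<Longrightarrow> p (x(i := t)) = p x"
  shows "p (override_on x y C) = p x"
  using assms
proof (induction C rule: finite_induct)
  case (insert i C)
  have "override_on x y (insert i C) = (override_on x y C)(i := y i)"
    by (auto simp: override_on_def fun_eq_iff)
  then show ?case using insert by simp
qed simp

lemma finite_indep_cong:
  assumes "finite C" "\<And>i x t. i \<in> C \<Longrightarrow> p (x(i := t)) = p x"
    and "\<And>k. k \<notin> C \<Longrightarrow> x k = y k"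
  shows "p x = p y"
proof -
  have "override_on x y C = y" using assms(3) by (auto simp: override_on_def fun_eq_iff)
  then show ?thesis using finite_indep_override[OF assms(1,2), of x y] by simp
qed

text \<open>A coordinate whose derivative vanishes identically can be overwritten without changing
  \<open>p\<close>, and finitely many such coordinates can be overwritten in turn.\<close>

lemma multiaffine_infl:
  assumes I: "finite I" and p: "multiaffine I p"
  shows "multiaffine (infl I p) p"
  unfolding multiaffine_def
proof (intro conjI allI ballI impI)
  fix x y :: "'a \<Rightarrow> real" assume eq: "\<forall>i\<in>infl I p. x i = y i"
  have "p (override_on x y (I - infl I p)) = p x"
  proof (rule finite_indep_override)
    fix i x t assume i: "i \<in> I - infl I p"
    then have "pd i p x = 0" by (auto simp: infl_def)
    then show "p (x(i := t)) = p x"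
      using multiaffine_expand[OF p, of i x t] i by simp
  qed (use I in auto)
  moreover have "p (override_on x y (I - infl I p)) = p y"
    by (rule multiaffine_cong[OF p]) (use eq in \<open>auto simp: override_on_def\<close>)
  ultimately show "p x = p y" by simp
next
  fix i x t assume "i \<in> infl I p"
  then show "p (x(i := t)) = p (x(i := 0)) + t * pd i p x"
    using multiaffine_upd[OF p, of i x t] by (auto simp: infl_def)
qed

lemma multiaffine_nonconst_infl:
  assumes "finite I" "multiaffine I p" "p x \<noteq> p y"
  obtains i z where "i \<in> I" "pd i p z \<noteq> 0"
proof -
  have "infl I p \<noteq> {}"
    using multiaffine_cong[OF multiaffine_infl[OF assms(1,2)], of x y] assms(3) by auto
  then show thesis using that by (auto simp: infl_def)
qed

lemma multiaffine_surj:
  assumes p: "multiaffine I p" and i: "i \<in> I" "pd i p x \<noteq> 0"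
  shows "\<exists>t. p (x(i := t)) = r"
proof -
  have "p (x(i := (r - p (x(i := 0))) / pd i p x)) = r"
    unfolding multiaffine_upd[OF p i(1), of x "(r - p (x(i := 0))) / pd i p x"] using i(2) by simp
  then show ?thesis by blast
qed

lemma multiaffine_nonconst_surj:
  assumes "finite I" "multiaffine I p" "p x \<noteq> p y"
  shows "\<exists>z. p z = r"
proof -
  obtain i w where "i \<in> I" "pd i p w \<noteq> 0" by (rule multiaffine_nonconst_infl[OF assms(1,2), OF assms(3)])
  then show ?thesis using multiaffine_surj[OF assms(2), of i w r] by blast
qed

lemma multiaffine_zero_at:
  assumes "multiaffine I p" "i \<in> I" "\<And>x. p (x(i := r)) = b"
  shows "p x = b + (x i - r) * pd i p x"
  using multiaffine_expand[OF assms(1,2), of x r] assms(3) by simp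

text \<open>An affine function of one variable is determined by its values at -1 and 1; this is used
  one coordinate at a time. Only the coordinates in \<open>A\<close> leave the cube, the others stay
  at \<open>x0\<close>: in the converse, \<open>\<phi> j\<close> need not be affine in its
  arguments.\<close>

lemma affine_eq_on_cube_like:
  assumes "finite A"
    and "\<And>i x t. i \<in> A \<Longrightarrow> p (x(i := t)) = p (x(i := 0)) + t * pd i p x"
    and "\<And>i x t. i \<in> A \<Longrightarrow> q (x(i := t)) = q (x(i := 0)) + t * pd i q x"
    and "\<And>x. (\<And>i. i \<in> A \<Longrightarrow> x i = -1 \<or> x i = 1) \<Longrightarrow> (\<And>i. i \<notin> A \<Longrightarrow> x i = x0 i) \<Longrightarrow> p x = q x"
    and "\<And>i. i \<notin> A \<Longrightarrow> x i = x0 i"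
  shows "p x = q x"
  using assms
proof (induction A arbitrary: x0 x rule: finite_induct)
  case empty
  then show ?case by blast
next
  case (insert i A)
  have *: "p (x(i := s)) = q (x(i := s))" if s: "s = -1 \<or> s = 1" for s
  proof (rule insert.IH[where ?x0.0 = "x0(i := s)", OF insert.prems(1,2)])
    fix y assume y: "\<And>k. k \<in> A \<Longrightarrow> y k = -1 \<or> y k = 1" "\<And>k. k \<notin> A \<Longrightarrow> y k = (x0(i := s)) k"
    have "y i = s" using y(2)[of i] insert.hyps by simp
    then show "p y = q y" using y s by (intro insert.prems(3)) (auto split: if_splits)
  qed (use insert.prems(4) in auto)
  have "p (x(i := 1)) = p (x(i := 0)) + pd i p x" "p (x(i := -1)) = p (x(i := 0)) - pd i p x"
    "q (x(i := 1)) = q (x(i := 0)) + pd i q x" "q (x(i := -1)) = q (x(i := 0)) - pd i q x"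
    using insert.prems(1)[OF insertI1, of x 1] insert.prems(1)[OF insertI1, of x "-1"]
      insert.prems(2)[OF insertI1, of x 1] insert.prems(2)[OF insertI1, of x "-1"] by linarith+
  then have "pd i p x = pd i q x" "p (x(i := 0)) = q (x(i := 0))" using *[of 1] *[of "-1"] by auto
  moreover have "p x = p (x(i := 0)) + x i * pd i p x" "q x = q (x(i := 0)) + x i * pd i q x"
    using insert.prems(1)[OF insertI1, of x "x i"] insert.prems(2)[OF insertI1, of x "x i"]
    unfolding fun_upd_triv by blast+
  ultimately show ?case by simp
qed

lemma multiaffine_eqI:
  fixes I :: "'a set"
  assumes "finite I" "multiaffine I p" "multiaffine I q" "\<And>x. x \<in> cube I \<Longrightarrow> p x = q x"
  shows "p x = q x"
proof (rule affine_eq_on_cube_like[OF assms(1), where p = p and q = q and x = x and ?x0.0 = x])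
  fix y :: "'a \<Rightarrow> real" assume y: "\<And>i. i \<in> I \<Longrightarrow> y i = -1 \<or> y i = 1"
  have "restrict y I \<in> cube I" using y by (auto simp: cube_def)
  then have "p (restrict y I) = q (restrict y I)" by (rule assms(4))
  moreover have "p (restrict y I) = p y" "q (restrict y I) = q y"
    by (auto intro: multiaffine_cong[OF assms(2)] multiaffine_cong[OF assms(3)])
  ultimately show "p y = q y" by simp
qed (fact multiaffine_upd[OF assms(2)] multiaffine_upd[OF assms(3)] | rule refl)+

section \<open>Multilinear expansions and compositions\<close>

lemma multiaffine_sum:
  fixes I :: "'a set"
  assumes "\<And>s. s \<in> A \<Longrightarrow> multiaffine I (p s)"
  shows "multiaffine I (\<lambda>x. \<Sum>s\<in>A. c s * p s x)"
  unfolding multiaffine_def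
proof (intro conjI allI ballI impI)
  fix x y :: "'a \<Rightarrow> real" assume "\<forall>i\<in>I. x i = y i"
  then have "p s x = p s y" if "s \<in> A" for s
    using multiaffine_cong[OF assms[OF that], of x y] by blast
  then show "(\<Sum>s\<in>A. c s * p s x) = (\<Sum>s\<in>A. c s * p s y)" by simp
next
  fix i x t assume i: "i \<in> I"
  have "(\<Sum>s\<in>A. c s * p s (x(i := t))) = (\<Sum>s\<in>A. c s * p s (x(i := 0)) + t * (c s * pd i (p s) x))"
    by (intro sum.cong refl) (simp add: multiaffine_upd[OF assms i, of _ x t] algebra_simps)
  then show "(\<Sum>s\<in>A. c s * p s (x(i := t))) = (\<Sum>s\<in>A. c s * p s (x(i := 0)))
      + t * pd i (\<lambda>x. \<Sum>s\<in>A. c s * p s x) x"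
    by (simp add: pd_def sum.distrib sum_distrib_left sum_subtractf algebra_simps)
qed

lemma multiaffine_monomial:
  assumes "finite S" "S \<subseteq> I"
  shows "multiaffine I (\<lambda>x. \<Prod>i\<in>S. x i)"
  unfolding multiaffine_def
proof (intro conjI allI ballI impI)
  fix x y :: "'a \<Rightarrow> real" assume "\<forall>i\<in>I. x i = y i"
  then show "(\<Prod>i\<in>S. x i) = (\<Prod>i\<in>S. y i)" using assms by (intro prod.cong) auto
next
  fix i t and x :: "'a \<Rightarrow> real" assume i: "i \<in> I"
  have "(\<Prod>k\<in>S. (x(i := s)) k) = (if i \<in> S then s * (\<Prod>k\<in>S - {i}. x k) else (\<Prod>k\<in>S. x k))" for s
  proof (cases "i \<in> S")
    case True
    have "(\<Prod>k\<in>S - {i}. (x(i := s)) k) = (\<Prod>k\<in>S - {i}. x k)" by (intro prod.cong) auto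
    then show ?thesis using prod.remove[OF assms(1) True, of "x(i := s)"] True by simp
  next
    case False
    then show ?thesis by (auto intro!: prod.cong)
  qed
  then show "(\<Prod>k\<in>S. (x(i := t)) k) = (\<Prod>k\<in>S. (x(i := 0)) k) + t * pd i (\<lambda>x. \<Prod>k\<in>S. x k) x"
    by (simp add: pd_def)
qed

lemma multiaffine_mlx: "finite I \<Longrightarrow> multiaffine I (mlx I p)"
  unfolding mlx_def
  by (intro multiaffine_sum multiaffine_monomial) (auto intro: finite_subset)

lemma multiaffine_eq_mlx:
  assumes "finite I" "multiaffine I p"
  shows "mlx I p x = p x"
  by (rule multiaffine_eqI[OF assms(1) multiaffine_mlx[OF assms(1)] assms(2) mlx_cube[OF assms(1)]])

lemma multiaffine_imp_multilinear_poly: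
  assumes "finite I" "multiaffine I p"
  shows "multilinear_poly I p"
  unfolding multilinear_poly_def
  by (rule exI[of _ "fourier I p"]) (use multiaffine_eq_mlx[OF assms] in \<open>simp add: mlx_def\<close>)

text \<open>A matrix entry occurs in one row only, so in that entry the composite is an affine
  function of an affine function.\<close>

lemma multiaffine_comp:
  assumes F: "multiaffine I F" and g: "\<And>i. i \<in> I \<Longrightarrow> multiaffine J (g i)"
  shows "multiaffine (I \<times> J) (\<lambda>z. F (\<lambda>i. g i (\<lambda>j. z (i, j))))"
  unfolding multiaffine_def
proof (intro conjI allI ballI impI)
  fix x y :: "'a \<times> 'b \<Rightarrow> real" assume "\<forall>p\<in>I \<times> J. x p = y p"
  then show "F (\<lambda>i. g i (\<lambda>j. x (i, j))) = F (\<lambda>i. g i (\<lambda>j. y (i, j)))"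
    by (intro multiaffine_cong[OF F] multiaffine_cong[OF g]) auto
next
  fix p t and z :: "'a \<times> 'b \<Rightarrow> real" assume "p \<in> I \<times> J"
  then obtain a b where p: "p = (a, b)" "a \<in> I" "b \<in> J" by auto
  let ?x = "\<lambda>i. g i (\<lambda>j. z (i, j))"
  let ?\<Phi> = "\<lambda>z. F (\<lambda>i. g i (\<lambda>j. z (i, j)))"
  have row: "(\<lambda>i. g i (\<lambda>j. (z(p := s)) (i, j))) = ?x(a := g a ((\<lambda>j. z (a, j))(b := s)))" for s
    by (auto simp: p fun_eq_iff intro!: arg_cong[where f = "g _"])
  have val: "?\<Phi> (z(p := s)) = F (?x(a := 0)) + g a ((\<lambda>j. z (a, j))(b := s)) * pd a F ?x" for s
    unfolding row using multiaffine_upd[OF F p(2)] by blast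
  have *: "g a ((\<lambda>j. z (a, j))(b := t)) = g a ((\<lambda>j. z (a, j))(b := 0))
      + t * (g a ((\<lambda>j. z (a, j))(b := 1)) - g a ((\<lambda>j. z (a, j))(b := 0)))"
    using multiaffine_upd[OF g[OF p(2)] p(3)] unfolding pd_def .
  show "?\<Phi> (z(p := t)) = ?\<Phi> (z(p := 0)) + t * pd p ?\<Phi> z"
    unfolding pd_def[of p] val * by (simp add: algebra_simps)
qed

lemma multiaffine_swap:
  assumes "multiaffine (J \<times> I) H"
  shows "multiaffine (I \<times> J) (\<lambda>z. H (\<lambda>(j, i). z (i, j)))"
  unfolding multiaffine_def
proof (intro conjI allI ballI impI)
  fix x y :: "'b \<times> 'a \<Rightarrow> real" assume "\<forall>p\<in>I \<times> J. x p = y p"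
  then show "H (\<lambda>(j, i). x (i, j)) = H (\<lambda>(j, i). y (i, j))"
    by (intro multiaffine_cong[OF assms]) auto
next
  fix p t and z :: "'b \<times> 'a \<Rightarrow> real" assume "p \<in> I \<times> J"
  then obtain a b where p: "p = (a, b)" "a \<in> I" "b \<in> J" by auto
  have upd: "(\<lambda>(j, i). (z(p := s)) (i, j)) = (\<lambda>(j, i). z (i, j))((b, a) := s)" for s
    by (auto simp: p fun_eq_iff)
  show "H (\<lambda>(j, i). (z(p := t)) (i, j)) = H (\<lambda>(j, i). (z(p := 0)) (i, j))
      + t * pd p (\<lambda>z. H (\<lambda>(j, i). z (i, j))) z"
    unfolding pd_def upd using p
    by (intro multiaffine_upd[OF assms, of "(b, a)", unfolded pd_def]) simp
qed

section \<open>Signed coordinates and nonlinear functions\<close>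

lemma signed_coord_infl:
  assumes "signed_coord I p" "i \<in> infl I p"
  shows "p x = p (\<lambda>_. 1) * x i" "p (\<lambda>_. 1) \<in> {-1, 1}"
proof -
  obtain k s where k: "s \<in> {-1, 1}" "\<And>x. p x = s * x k"
    using assms(1) unfolding signed_coord_def by blast
  have "i = k" using assms(2) by (auto simp: infl_def pd_def k split: if_splits)
  then show "p x = p (\<lambda>_. 1) * x i" "p (\<lambda>_. 1) \<in> {-1, 1}" using k by auto
qed

lemma signed_coord_infl_unique:
  assumes "signed_coord I p" "i \<in> infl I p" "k \<in> infl I p"
  shows "i = k"
  using assms by (auto simp: signed_coord_def infl_def pd_def split: if_splits)

lemma signed_coord_infl_nonempty: "signed_coord I p \<Longrightarrow> infl I p \<noteq> {}"
  by (auto simp: signed_coord_def infl_def pd_def)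

lemma nonlinear_in_all_not_signed: "nonlinear_in_all I p \<Longrightarrow> \<not> signed_coord I p"
proof
  assume "nonlinear_in_all I p" "signed_coord I p"
  then obtain i k s where i: "i \<in> infl I p" "\<exists>x y. pd i p x \<noteq> pd i p y" and p: "\<And>x. p x = s * x k"
    unfolding nonlinear_in_all_def signed_coord_def by blast
  then show False unfolding pd_def p by (auto split: if_splits)
qed

text \<open>The derivative in \<open>i\<close> does not involve coordinate \<open>i\<close>; being
  nonconstant it has a nonzero derivative in some other \<open>k\<close>, and mixed derivatives are
  symmetric.\<close>

lemma nonlinear_in_all_second:
  assumes "finite I" "multiaffine I p" "nonlinear_in_all I p" "i \<in> infl I p"
  obtains k where "k \<in> infl I p" "k \<noteq> i"
proof -
  obtain x y where "pd i p x \<noteq> pd i p y" using assms(3,4) unfolding nonlinear_in_all_def by blast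
  then obtain k z where k: "k \<in> I" "pd k (pd i p) z \<noteq> 0"
    by (rule multiaffine_nonconst_infl[OF assms(1) multiaffine_pd[OF assms(2)]])
  have "k \<noteq> i" using k(2) by (auto simp: pd_def)
  moreover have "\<exists>x. pd k p x \<noteq> 0"
  proof (rule ccontr)
    assume "\<not> (\<exists>x. pd k p x \<noteq> 0)"
    then have "pd i (pd k p) z = 0" by (simp add: pd_def[of i])
    then show False using k(2) by (simp add: pd_swap)
  qed
  ultimately show thesis using that k(1) by (auto simp: infl_def)
qed

text \<open>
  The last hypothesis says that \<open>H\<close> is proportional to \<open>a s\<close> in the variables \<open>V s\<close>, cross-multiplied
  because \<open>a s\<close> may have zeros.
\<close>

lemma product_factor:
  assumes "finite A" "disjoint_family_on V A"
    and "\<And>s x y. s \<in> A \<Longrightarrow> (\<And>k. k \<in> V s \<Longrightarrow> x k = y k) \<Longrightarrow> a s x = a s y"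
    and "\<And>s x y. s \<in> A \<Longrightarrow> (\<And>k. k \<notin> V s \<Longrightarrow> x k = y k) \<Longrightarrow> H x * a s y = H y * (a s x :: real)"
  shows "H x * (\<Prod>s\<in>A. a s x0) = H (override_on x x0 (\<Union>s\<in>A. V s)) * (\<Prod>s\<in>A. a s x)"
  using assms
proof (induction A rule: finite_induct)
  case (insert t A)
  let ?x = "override_on x x0 (\<Union>s\<in>A. V s)" and ?y = "override_on x x0 (\<Union>s\<in>insert t A. V s)"
  have IH: "H x * (\<Prod>s\<in>A. a s x0) = H ?x * (\<Prod>s\<in>A. a s x)"
  proof (rule insert.IH)
    show "disjoint_family_on V A" using insert.prems(1) by (auto simp: disjoint_family_on_def)
  qed (use insert.prems(2,3) in blast)+
  have "V t \<inter> (\<Union>s\<in>A. V s) = {}"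
    using insert.prems(1) insert.hyps(2) by (fastforce simp: disjoint_family_on_def)
  \<comment> \<open>By disjointness, \<open>a t\<close> does not notice the variables already
    replaced.\<close>
  then have 1: "a t ?x = a t x" by (intro insert.prems(2)) (auto simp: override_on_def)
  have 2: "a t ?y = a t x0" by (intro insert.prems(2)) (auto simp: override_on_def)
  have "H ?x * a t ?y = H ?y * a t ?x" by (intro insert.prems(3)) (auto simp: override_on_def)
  then have 3: "H ?x * a t x0 = H ?y * a t x" by (simp only: 1 2)
  have "H x * (\<Prod>s\<in>insert t A. a s x0) = (H x * (\<Prod>s\<in>A. a s x0)) * a t x0"
    using insert.hyps by simp
  also have "\<dots> = (H ?x * a t x0) * (\<Prod>s\<in>A. a s x)" unfolding IH by simp
  also have "\<dots> = H ?y * (\<Prod>s\<in>insert t A. a s x)" unfolding 3 using insert.hyps by simp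
  finally show ?case .
qed simp

text \<open>Vanishing of \<open>p - b\<close> at \<open>x i = - c i\<close> makes it
  \<open>x i + c i\<close> times a derivative free of \<open>x i\<close>. Collecting these
  proportionalities with \<open>product_factor\<close> leaves as \<open>\<phi>\<close> the function
  \<open>p - b\<close> with the coordinates in \<open>A\<close> fixed, where only \<open>L\<close>
  can still matter.\<close>

lemma multiaffine_linear_factors:
  assumes I: "finite I" and p: "multiaffine I p" and A: "A \<subseteq> I" and L: "infl I p \<subseteq> A \<union> L"
    and zero: "\<And>i x. i \<in> A \<Longrightarrow> p (x(i := - c i)) = b"
  shows "\<exists>\<phi>. \<forall>x. p x = (\<Prod>i\<in>A. x i + c i) * \<phi> (restrict x L) + b"
proof -
  define H where "H x = p x - b" for x
  \<comment> \<open>Chosen so that each factor \<open>x0 i + c i\<close> equals 1.\<close>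
  define x0 where "x0 i = 1 - c i" for i
  have H: "H x = (x i + c i) * pd i p x" if "i \<in> A" for i x
    using multiaffine_zero_at[OF p, of i "- c i" b x] zero[OF that] that A by (auto simp: H_def)
  have 0: "H x * (\<Prod>i\<in>A. x0 i + c i) = H (override_on x x0 (\<Union>i\<in>A. {i})) * (\<Prod>i\<in>A. x i + c i)" for x
  proof (rule product_factor[where H = H and a = "\<lambda>i x. x i + c i" and V = "\<lambda>i. {i}"])
    fix i and x y :: "'a \<Rightarrow> real"
    assume i: "i \<in> A" and eq: "\<And>k. k \<notin> {i} \<Longrightarrow> x k = y k"
    have "pd i p x = pd i p y" by (rule pd_cong[OF p]) (use eq in auto)
    then show "H x * (y i + c i) = H y * (x i + c i)" using i by (simp add: H)
  qed (use finite_subset[OF A I] in \<open>auto simp: disjoint_family_on_def\<close>)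
  have 1: "H x = H (override_on x x0 A) * (\<Prod>i\<in>A. x i + c i)" for x
    using 0[of x] by (simp add: x0_def)
  have 2: "H (override_on (restrict x L) x0 A) = H (override_on x x0 A)" for x
    unfolding H_def using L
    by (auto simp: override_on_def restrict_def intro!: multiaffine_cong[OF multiaffine_infl[OF I p]])
  have "p x = (\<Prod>i\<in>A. x i + c i) * H (override_on (restrict x L) x0 A) + b" for x
    using 1[of x] unfolding 2 by (simp add: H_def diff_eq_eq mult.commute)
  then show ?thesis by (intro exI[of _ "\<lambda>w. H (override_on w x0 A)"]) simp
qed

section \<open>Polymorphisms of multiaffine functions\<close>

text \<open>The assumptions are symmetric in rows and columns, so \<open>dual\<close> turns each row
  statement into a column statement. The last two carry the consequence of Boolean-likeness.\<close>

locale affine_polymorphism =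
  fixes I :: "'a set" and J :: "'b set"
    and F :: "('a \<Rightarrow> real) \<Rightarrow> real" and G :: "('b \<Rightarrow> real) \<Rightarrow> real"
    and g :: "'a \<Rightarrow> ('b \<Rightarrow> real) \<Rightarrow> real" and f :: "'b \<Rightarrow> ('a \<Rightarrow> real) \<Rightarrow> real"
  assumes finI: "finite I" and finJ: "finite J"
    and maF: "multiaffine I F" and maG: "multiaffine J G"
    and mag: "\<And>i. i \<in> I \<Longrightarrow> multiaffine J (g i)" and maf: "\<And>j. j \<in> J \<Longrightarrow> multiaffine I (f j)"
    and commute: "\<And>z. F (\<lambda>i. g i (z i)) = G (\<lambda>j. f j (\<lambda>i. z i j))"
    and inflF: "infl I F = I" and inflG: "infl J G = J"
    and row_cases: "\<And>i. i \<in> I \<Longrightarrow> signed_coord J (g i) \<or> nonlinear_in_all J (g i)"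
    and col_cases: "\<And>j. j \<in> J \<Longrightarrow> signed_coord I (f j) \<or> nonlinear_in_all I (f j)"
begin

lemma dual: "affine_polymorphism J I G F f g"
proof
  fix z :: "'b \<Rightarrow> 'a \<Rightarrow> real"
  show "G (\<lambda>j. f j (z j)) = F (\<lambda>i. g i (\<lambda>j. z j i))"
    using commute[of "\<lambda>i j. z j i"] by simp
qed (fact finI finJ maF maG mag maf inflF inflG row_cases col_cases)+

section \<open>Prescribing row values and comparing derivatives\<close>

lemma infl_g_nonempty: "i \<in> I \<Longrightarrow> infl J (g i) \<noteq> {}"
  using row_cases signed_coord_infl_nonempty unfolding nonlinear_in_all_def by blast

lemma realize_row:
  assumes "i \<in> I"
  shows "\<exists>y. g i y = r"
proof -
  obtain j y where "j \<in> J" "pd j (g i) y \<noteq> 0" using infl_g_nonempty[OF assms] by (auto simp: infl_def)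
  then show ?thesis using multiaffine_surj[OF mag[OF assms]] by blast
qed

text \<open>Distinct rows use disjoint sets of entries, so their values can be prescribed
  independently; this makes every real argument of \<open>F\<close> reachable.\<close>

lemma realize: "\<exists>z. \<forall>i\<in>I. g i (z i) = x i"
  using realize_row by (intro bchoice) blast

text \<open>For multiaffine functions an increment in one variable is exactly step times derivative,
  so this chain rule is a finite difference of \<open>commute\<close> in the entry at
  \<open>i\<close>, \<open>j\<close>.\<close>

lemma edge_identity:
  assumes i: "i \<in> I" and j: "j \<in> J"
  shows "pd i F (\<lambda>i. g i (z i)) * pd j (g i) (z i) =
         pd j G (\<lambda>j. f j (\<lambda>i. z i j)) * pd i (f j) (\<lambda>i. z i j)"
proof -
  let ?x = "\<lambda>i. g i (z i)" and ?y = "\<lambda>j. f j (\<lambda>i. z i j)"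
  have upd: "F (?x(i := g i ((z i)(j := t)))) = G (?y(j := f j ((\<lambda>i. z i j)(i := t))))" for t
  proof -
    let ?z = "z(i := (z i)(j := t))"
    have "?x(i := g i ((z i)(j := t))) = (\<lambda>i. g i (?z i))" by auto
    moreover have "?y(j := f j ((\<lambda>i. z i j)(i := t))) = (\<lambda>j. f j (\<lambda>i. ?z i j))"
      by (auto simp: fun_eq_iff intro!: arg_cong[where f = "f _"])
    ultimately show ?thesis using commute[of ?z] by simp
  qed
  have "pd i F ?x * pd j (g i) (z i)
      = F (?x(i := g i ((z i)(j := 1)))) - F (?x(i := g i ((z i)(j := 0))))"
    unfolding multiaffine_diff[OF maF i] by (simp add: pd_def[of j])
  also have "\<dots> = G (?y(j := f j ((\<lambda>i. z i j)(i := 1)))) - G (?y(j := f j ((\<lambda>i. z i j)(i := 0))))"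
    unfolding upd ..
  also have "\<dots> = pd j G ?y * pd i (f j) (\<lambda>i. z i j)"
    unfolding multiaffine_diff[OF maG j] by (simp add: pd_def[of i])
  finally show ?thesis .
qed

text \<open>\<open>pd i F\<close> ignores coordinate \<open>i\<close>, so row \<open>i\<close> can
  be chosen to make its own derivative nonzero while the other rows make \<open>pd i F\<close>
  nonzero. The left side of \<open>edge_identity\<close> is then nonzero.\<close>

lemma infl_f_if_infl_g:
  assumes i: "i \<in> I" and j: "j \<in> infl J (g i)"
  shows "i \<in> infl I (f j)"
proof -
  obtain y where y: "pd j (g i) y \<noteq> 0" and jJ: "j \<in> J" using j by (auto simp: infl_def)
  obtain x where x: "pd i F x \<noteq> 0" using i inflF by (auto simp: infl_def)
  obtain z where z: "\<forall>i\<in>I. g i (z i) = x i" using realize by blast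
  have "pd i F (\<lambda>k. g k ((z(i := y)) k)) = pd i F x"
    by (rule pd_cong[OF maF]) (use z in auto)
  then have "pd i (f j) (\<lambda>k. (z(i := y)) k j) \<noteq> 0"
    using edge_identity[OF i jJ, of "z(i := y)"] x y by auto
  then show ?thesis using i by (auto simp: infl_def)
qed

lemma edge_sym:
  assumes "i \<in> I" "j \<in> J"
  shows "j \<in> infl J (g i) \<longleftrightarrow> i \<in> infl I (f j)"
  using infl_f_if_infl_g affine_polymorphism.infl_f_if_infl_g[OF dual] assms by blast

text \<open>In \<open>edge_identity\<close> the factor \<open>pd i F\<close> does not see row
  \<open>i\<close>, so the other factors must vary with row \<open>i\<close> proportionally.
  Cross-multiplication avoids dividing by derivatives that may vanish.\<close>

lemma pd_G_proportional:
  assumes i: "i \<in> I" and j: "j \<in> infl J (g i)"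
  shows "pd j G (\<lambda>k. f k (\<lambda>l. (z(i := r)) l k)) * pd j (g i) r' =
         pd j G (\<lambda>k. f k (\<lambda>l. (z(i := r')) l k)) * pd j (g i) r"
proof -
  have jJ: "j \<in> J" using j by (auto simp: infl_def)
  obtain x where x: "pd i (f j) x \<noteq> 0" using infl_f_if_infl_g[OF i j] by (auto simp: infl_def)
  \<comment> \<open>Overwriting column \<open>j\<close> by \<open>x\<close> makes the derivative of
    \<open>f j\<close> nonzero and affects neither \<open>pd j G\<close> nor
    \<open>pd j (g i)\<close>, which ignore coordinate \<open>j\<close>.\<close>
  define zz where "zz s = (\<lambda>l. ((z(i := s)) l)(j := x l))" for s
  have id: "pd i F (\<lambda>l. g l (zz s l)) * pd j (g i) s =
        pd j G (\<lambda>k. f k (\<lambda>l. (z(i := s)) l k)) * pd i (f j) x" for s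
  proof -
    have "pd j G (\<lambda>k. f k (\<lambda>l. zz s l k)) = pd j G (\<lambda>k. f k (\<lambda>l. (z(i := s)) l k))"
      by (rule pd_cong[OF maG]) (simp add: zz_def)
    moreover have "(\<lambda>l. zz s l j) = x" by (simp add: zz_def)
    moreover have "pd j (g i) (zz s i) = pd j (g i) s" by (simp add: zz_def)
    ultimately show ?thesis using edge_identity[OF i jJ, of "zz s"] by simp
  qed
  have P: "pd i F (\<lambda>l. g l (zz r l)) = pd i F (\<lambda>l. g l (zz r' l))"
    by (rule pd_cong[OF maF]) (simp add: zz_def)
  have "pd j G (\<lambda>k. f k (\<lambda>l. (z(i := r)) l k)) * pd j (g i) r' * pd i (f j) x
      = pd i F (\<lambda>l. g l (zz r l)) * pd j (g i) r * pd j (g i) r'"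
    unfolding id by (simp add: mult_ac)
  also have "\<dots> = (pd i F (\<lambda>l. g l (zz r' l)) * pd j (g i) r') * pd j (g i) r"
    unfolding P by (simp add: mult_ac)
  also have "\<dots> = pd j G (\<lambda>k. f k (\<lambda>l. (z(i := r')) l k)) * pd j (g i) r * pd i (f j) x"
    unfolding id by (simp add: mult_ac)
  finally show ?thesis using x by simp
qed

section \<open>The constants attached to edges\<close>

text \<open>The edge identity at \<open>k\<close>, \<open>j\<close> is read as a function of row
  \<open>i\<close> alone. Its left side is affine in \<open>g i r\<close>; its right side is, by
  \<open>pd_G_proportional\<close>, a multiple of \<open>pd j (g i) r\<close> times an affine
  function of \<open>r j\<close>. Comparing coefficients in \<open>r j\<close> forces
  \<open>y j + \<kappa>\<close> to divide \<open>g i - D\<close>. The last two conclusions make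
  \<open>- \<kappa>\<close> the only zero of \<open>pd k (f j)\<close> on a line in direction
  \<open>i\<close>, so that the column side can recognise the same constant.\<close>

lemma row_normal_form:
  assumes i: "i \<in> I" and k: "k \<in> I" "k \<noteq> i"
    and ji: "j \<in> infl J (g i)" and jk: "j \<in> infl J (g k)"
    and v: "pd j (g i) y1 \<noteq> pd j (g i) y2"
  obtains \<kappa> D x where "\<And>y. g i (y(j := - \<kappa>)) = D"
    and "pd k (f j) (x(i := - \<kappa>)) = 0" and "pd i (pd k (f j)) x \<noteq> 0"
proof -
  have jJ: "j \<in> J" using ji by (auto simp: infl_def)
  obtain x where x: "pd k (f j) x \<noteq> 0" using infl_f_if_infl_g[OF k(1) jk] by (auto simp: infl_def)
  obtain y where y: "pd j G y \<noteq> 0" using jJ inflG by (auto simp: infl_def)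
  obtain z' where z': "\<forall>j\<in>J. f j (z' j) = y j"
    using affine_polymorphism.realize[OF dual] by blast
  \<comment> \<open>Column \<open>j\<close> is \<open>x\<close>, and the other columns realise
    \<open>y\<close>; since \<open>pd j G\<close> ignores coordinate \<open>j\<close>, its value
    stays nonzero.\<close>
  define z where "z l = (\<lambda>j'. if j' = j then x l else z' j' l)" for l
  let ?v = "pd j (g i)"
  let ?Q = "\<lambda>r. pd j G (\<lambda>j'. f j' (\<lambda>l. (z(i := r)) l j'))"
  have "pd j G (\<lambda>j'. f j' (\<lambda>l. z l j')) = pd j G y"
    by (rule pd_cong[OF maG]) (use z' in \<open>auto simp: z_def\<close>)
  then have Q0: "?Q (z i) \<noteq> 0" using y by simp
  have colz: "(\<lambda>l. z l j) = x" by (simp add: z_def)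
  have a: "pd j (g k) (z k) \<noteq> 0"
    using edge_identity[OF k(1) jJ, of z] Q0 x colz by auto
  have v0: "?v (z i) \<noteq> 0"
  proof
    assume "?v (z i) = 0"
    then have "?Q (z i) * ?v r = 0" for r using pd_G_proportional[OF i ji, of z "z i" r] by simp
    then show False using Q0 v by simp
  qed
  define A0 where "A0 = pd k F ((\<lambda>l. g l (z l))(i := 0))"
  define B0 where "B0 = pd i (pd k F) (\<lambda>l. g l (z l))"
  \<comment> \<open>The proportionality factor that replaces \<open>?Q r\<close> by
    \<open>?v r\<close> in the edge identity.\<close>
  define c where "c = pd j (g k) (z k) * ?v (z i) / ?Q (z i)"
  have c0: "c \<noteq> 0" using a v0 Q0 by (simp add: c_def)
  define \<alpha> where "\<alpha> = pd k (f j) (x(i := 0))"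
  define \<beta> where "\<beta> = pd i (pd k (f j)) x"
  have b: "pd k (f j) (x(i := t)) = \<alpha> + \<beta> * t" for t
    using multiaffine_upd[OF multiaffine_pd[OF maf[OF jJ]] i, of k x t] by (simp add: \<alpha>_def \<beta>_def)
  have main: "(A0 + B0 * g i r) * c = ?v r * (\<alpha> + \<beta> * r j)" for r
  proof -
    let ?z = "z(i := r)"
    have "(\<lambda>l. g l (?z l)) = (\<lambda>l. g l (z l))(i := g i r)" by auto
    then have P: "pd k F (\<lambda>l. g l (?z l)) = A0 + B0 * g i r"
      using multiaffine_upd[OF multiaffine_pd[OF maF] i, of k "\<lambda>l. g l (z l)" "g i r"]
      by (simp add: A0_def B0_def)
    have "(\<lambda>l. ?z l j) = x(i := r j)" by (auto simp: colz[symmetric])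
    then have id: "(A0 + B0 * g i r) * pd j (g k) (z k) = ?Q r * (\<alpha> + \<beta> * r j)"
      using edge_identity[OF k(1) jJ, of ?z] k(2) by (simp only: P b) simp
    have qv: "?Q r * ?v (z i) = ?Q (z i) * ?v r" by (rule pd_G_proportional[OF i ji])
    have "(A0 + B0 * g i r) * c * ?Q (z i) = (A0 + B0 * g i r) * pd j (g k) (z k) * ?v (z i)"
      using Q0 by (simp add: c_def)
    also have "\<dots> = ?Q r * ?v (z i) * (\<alpha> + \<beta> * r j)" unfolding id by simp
    also have "\<dots> = ?v r * (\<alpha> + \<beta> * r j) * ?Q (z i)" unfolding qv by simp
    finally show ?thesis using Q0 by simp
  qed
  define A1 where "A1 = A0 * c"
  define u where "u r = g i (r(j := 0))" for r
  have g: "g i (r(j := t)) = u r + t * ?v r" for r t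
    unfolding u_def by (rule multiaffine_upd[OF mag[OF i] jJ])
  have main': "A1 + B0 * c * (u r + t * ?v r) = ?v r * (\<alpha> + \<beta> * t)" for r t
    using main[of "r(j := t)"] unfolding g by (simp add: A1_def algebra_simps)
  have "A1 + B0 * c * (u (z i) + 1 * ?v (z i)) - (A1 + B0 * c * (u (z i) + 0 * ?v (z i)))
      = ?v (z i) * (\<alpha> + \<beta> * 1) - ?v (z i) * (\<alpha> + \<beta> * 0)"
    unfolding main' ..
  then have "B0 * c * ?v (z i) = \<beta> * ?v (z i)" by (simp add: algebra_simps)
  then have \<beta>: "B0 * c = \<beta>" using v0 by simp
  have uv: "A1 + \<beta> * u r = \<alpha> * ?v r" for r using main'[of r 0] by (simp add: \<beta> mult.commute)
  \<comment> \<open>Subtracting \<open>uv\<close> at \<open>y1\<close> and \<open>y2\<close> shows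
    that this quotient plays the role of \<open>\<alpha> / \<beta>\<close>; the denominator is
    nonzero because the derivative differs at the two points.\<close>
  define \<kappa> where "\<kappa> = (u y1 - u y2) / (?v y1 - ?v y2)"
  have "\<beta> * (u y1 - u y2) = \<alpha> * (?v y1 - ?v y2)"
    using uv[of y1] uv[of y2] by (simp add: right_diff_distrib)
  then have \<alpha>: "\<alpha> = \<beta> * \<kappa>" using v by (simp add: \<kappa>_def field_simps)
  have \<beta>0: "\<beta> \<noteq> 0"
  proof
    assume "\<beta> = 0"
    then have "pd k (f j) (x(i := x i)) = 0" unfolding b \<alpha> by simp
    then show False using x by simp
  qed
  have "g i (r(j := - \<kappa>)) = - A1 / \<beta>" for r
  proof -
    have "\<beta> * (u r - \<kappa> * ?v r) = - A1" using uv[of r] \<alpha> by (simp add: algebra_simps)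
    then show ?thesis using \<beta>0 by (simp add: g field_simps)
  qed
  moreover have "pd k (f j) (x(i := - \<kappa>)) = 0" unfolding b \<alpha> by simp
  ultimately show thesis using that \<beta>0 unfolding \<beta>_def by blast
qed

text \<open>Nonlinearity supplies a second row in column \<open>j\<close> and a second column in row
  \<open>i\<close>, as required by \<open>row_normal_form\<close> for the edge and for its
  transpose. Constancy of \<open>f j\<close> at \<open>x i = - \<kappa>'\<close> makes
  \<open>pd k (f j)\<close> vanish there, while its only zero on the line is
  \<open>- \<kappa>\<close>; hence the two constants coincide.\<close>

lemma core_edge:
  assumes i: "i \<in> I" "nonlinear_in_all J (g i)" and j: "j \<in> J" "nonlinear_in_all I (f j)"
    and e: "j \<in> infl J (g i)"
  shows "\<exists>\<kappa> D B. (\<forall>y. g i (y(j := - \<kappa>)) = D) \<and> (\<forall>x. f j (x(i := - \<kappa>)) = B)"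
proof -
  have e': "i \<in> infl I (f j)" by (rule infl_f_if_infl_g[OF i(1) e])
  obtain k where k: "k \<in> infl I (f j)" "k \<noteq> i"
    by (rule nonlinear_in_all_second[OF finI maf[OF j(1)] j(2) e'])
  have kI: "k \<in> I" using k by (auto simp: infl_def)
  have jk: "j \<in> infl J (g k)" using edge_sym[OF kI j(1)] k by blast
  obtain l where l: "l \<in> infl J (g i)" "l \<noteq> j"
    by (rule nonlinear_in_all_second[OF finJ mag[OF i(1)] i(2) e])
  have lJ: "l \<in> J" using l by (auto simp: infl_def)
  have il: "i \<in> infl I (f l)" using edge_sym[OF i(1) lJ] l by blast
  obtain y1 y2 where y: "pd j (g i) y1 \<noteq> pd j (g i) y2"
    using i(2) e unfolding nonlinear_in_all_def by blast
  obtain x1 x2 where x: "pd i (f j) x1 \<noteq> pd i (f j) x2"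
    using j(2) e' unfolding nonlinear_in_all_def by blast
  obtain \<kappa> D x0 where 1: "\<And>y. g i (y(j := - \<kappa>)) = D"
      "pd k (f j) (x0(i := - \<kappa>)) = 0" "pd i (pd k (f j)) x0 \<noteq> 0"
    using row_normal_form[OF i(1) kI k(2) e jk y] by metis
  obtain \<kappa>' B where 2: "\<And>x. f j (x(i := - \<kappa>')) = B"
    using affine_polymorphism.row_normal_form[OF dual j(1) lJ l(2) e' il x] by metis
  have "x0(i := - \<kappa>', k := t) = x0(k := t, i := - \<kappa>')" for t
    using k(2) by (simp add: fun_upd_twist)
  then have "pd k (f j) (x0(i := - \<kappa>')) = 0" by (simp only: pd_def 2)
  then have "(- \<kappa> - - \<kappa>') * pd i (pd k (f j)) x0 = 0"
    unfolding multiaffine_diff[OF multiaffine_pd[OF maf[OF j(1)]] i(1), symmetric] using 1(2) by simp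
  then have "\<kappa> = \<kappa>'" using 1(3) by simp
  then show ?thesis using 1(1) 2 by blast
qed

text \<open>Edges with two nonlinear ends are covered by \<open>core_edge\<close>. If one end is a
  signed coordinate, that function vanishes when its variable is 0, so the constants 0 work.\<close>

lemma constants_exist:
  "\<exists>\<kappa> D B. (\<forall>i\<in>I. signed_coord J (g i) \<longrightarrow> D i = 0) \<and> (\<forall>j\<in>J. signed_coord I (f j) \<longrightarrow> B j = 0) \<and>
     (\<forall>i j. signed_coord J (g i) \<or> signed_coord I (f j) \<longrightarrow> \<kappa> i j = 0) \<and>
     (\<forall>i\<in>I. \<forall>j\<in>infl J (g i). nonlinear_in_all J (g i) \<longrightarrow> (\<forall>x. f j (x(i := - \<kappa> i j)) = B j)) \<and>
     (\<forall>i\<in>I. \<forall>j\<in>infl J (g i). nonlinear_in_all I (f j) \<longrightarrow> (\<forall>y. g i (y(j := - \<kappa> i j)) = D i))"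
proof -
  define core where "core i j \<longleftrightarrow> i \<in> I \<and> j \<in> infl J (g i) \<and>
    nonlinear_in_all J (g i) \<and> nonlinear_in_all I (f j)" for i j
  have "\<exists>\<kappa>. core i j \<longrightarrow> (\<exists>D B. (\<forall>y. g i (y(j := - \<kappa>)) = D) \<and> (\<forall>x. f j (x(i := - \<kappa>)) = B))" for i j
    using core_edge[of i j] unfolding core_def infl_def by blast
  then obtain k where k: "\<And>i j. core i j \<Longrightarrow>
      \<exists>D B. (\<forall>y. g i (y(j := - k i j)) = D) \<and> (\<forall>x. f j (x(i := - k i j)) = B)"
    by metis
  define D where "D i = (if \<exists>j. core i j then g i (\<lambda>j. - k i j) else 0)" for i
  define B where "B j = (if \<exists>i. core i j then f j (\<lambda>i. - k i j) else 0)" for j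
  define \<kappa> where "\<kappa> i j = (if core i j then k i j else 0)" for i j
  have coreD: "g i (y(j := - \<kappa> i j)) = D i" if c: "core i j" for i j y
  proof -
    have "g i (y(j := - k i j)) = g i ((\<lambda>j. - k i j)(j := - k i j))" using k[OF c] by metis
    then show ?thesis using c by (auto simp: D_def \<kappa>_def fun_upd_idem)
  qed
  have coreB: "f j (x(i := - \<kappa> i j)) = B j" if c: "core i j" for i j x
  proof -
    have "f j (x(i := - k i j)) = f j ((\<lambda>i. - k i j)(i := - k i j))" using k[OF c] by metis
    then show ?thesis using c by (auto simp: B_def \<kappa>_def fun_upd_idem)
  qed
  have D0: "D i = 0" if "signed_coord J (g i)" for i
    using that nonlinear_in_all_not_signed unfolding D_def core_def by metis
  have B0: "B j = 0" if "signed_coord I (f j)" for j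
    using that nonlinear_in_all_not_signed unfolding B_def core_def by metis
  have \<kappa>0: "\<kappa> i j = 0" if "signed_coord J (g i) \<or> signed_coord I (f j)" for i j
    using that nonlinear_in_all_not_signed unfolding \<kappa>_def core_def by metis
  have f: "f j (x(i := - \<kappa> i j)) = B j"
    if ij: "i \<in> I" "j \<in> infl J (g i)" "nonlinear_in_all J (g i)" for i j x
  proof (cases "nonlinear_in_all I (f j)")
    case True
    then show ?thesis using coreB ij unfolding core_def by blast
  next
    case False
    have "j \<in> J" using ij(2) by (auto simp: infl_def)
    then have s: "signed_coord I (f j)" using False col_cases by blast
    have "f j (x(i := - \<kappa> i j)) = f j (\<lambda>_. 1) * (x(i := - \<kappa> i j)) i"
      by (rule signed_coord_infl(1)[OF s infl_f_if_infl_g[OF ij(1,2)]])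
    then show ?thesis using s by (simp add: B0 \<kappa>0)
  qed
  have g: "g i (y(j := - \<kappa> i j)) = D i"
    if ij: "i \<in> I" "j \<in> infl J (g i)" "nonlinear_in_all I (f j)" for i j y
  proof (cases "nonlinear_in_all J (g i)")
    case True
    then show ?thesis using coreD ij unfolding core_def by blast
  next
    case False
    then have s: "signed_coord J (g i)" using ij(1) row_cases by blast
    have "g i (y(j := - \<kappa> i j)) = g i (\<lambda>_. 1) * (y(j := - \<kappa> i j)) j"
      by (rule signed_coord_infl(1)[OF s ij(2)])
    then show ?thesis using s by (simp add: D0 \<kappa>0)
  qed
  show ?thesis
    by (rule exI[of _ \<kappa>], rule exI[of _ D], rule exI[of _ B]) (use D0 B0 \<kappa>0 f g in blast)
qed

section \<open>Core rows, leaf rows and paths\<close>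

definition core_rows :: "'b \<Rightarrow> 'a set" where
  "core_rows j = {i \<in> infl I (f j). nonlinear_in_all J (g i)}"

definition leaf_rows :: "'b \<Rightarrow> 'a set" where
  "leaf_rows j = {i \<in> infl I (f j). signed_coord J (g i)}"

text \<open>The value of a signed coordinate at the all-ones point is its sign; on \<open>I\<close>
  this becomes \<open>sgn_twist\<close>.\<close>

definition twist :: "('a \<Rightarrow> real) \<Rightarrow> 'a \<Rightarrow> real" where
  "twist x = (\<lambda>i. if signed_coord J (g i) then g i (\<lambda>_. 1) * x i else x i)"

text \<open>Two-step adjacency in the bipartite row-column graph; its closure describes the row
  sides of the connected components.\<close>

definition adj :: "('a \<times> 'a) set" where
  "adj = {(i, k). i \<in> I \<and> k \<in> I \<and> infl J (g i) \<inter> infl J (g k) \<noteq> {}}"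

lemma factor_exists:
  assumes j: "j \<in> J" and zero: "\<And>i x. i \<in> core_rows j \<Longrightarrow> f j (x(i := - \<kappa> i j)) = b"
  shows "\<exists>\<phi>. \<forall>x. f j x = (\<Prod>i\<in>core_rows j. x i + \<kappa> i j) * \<phi> (restrict x (leaf_rows j)) + b"
proof (rule multiaffine_linear_factors[OF finI maf[OF j], where c = "\<lambda>i. \<kappa> i j"])
  show "core_rows j \<subseteq> I" by (auto simp: core_rows_def infl_def)
  show "infl I (f j) \<subseteq> core_rows j \<union> leaf_rows j"
    using row_cases by (auto simp: core_rows_def leaf_rows_def infl_def)
qed (fact zero)

text \<open>Each row of such a column meets no other column, so a path starting in the column cannot
  leave it.\<close>

lemma leaf_column_closed:
  assumes "\<And>k. k \<in> infl I (f j) \<Longrightarrow> signed_coord J (g k)"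
    and "(i, k) \<in> adj\<^sup>*" "j \<in> infl J (g i)"
  shows "j \<in> infl J (g k)"
  using assms(2,3)
proof (induction rule: rtrancl_induct)
  case (step k l)
  then have k: "k \<in> I" "l \<in> I" "j \<in> infl J (g k)" by (auto simp: adj_def)
  then have "signed_coord J (g k)" using assms(1) infl_f_if_infl_g by blast
  moreover obtain j' where "j' \<in> infl J (g k)" "j' \<in> infl J (g l)" using step.hyps by (auto simp: adj_def)
  ultimately show ?case using signed_coord_infl_unique k(3) by metis
qed

text \<open>A signed row meets one column, hence its two neighbours on a path share that column and
  the row can be skipped. The extra starting row \<open>h\<close> leaves room for this skip in the
  induction.\<close>

lemma path_through_core:
  assumes "(i, k) \<in> adj\<^sup>*" "(h, i) \<in> adj" "nonlinear_in_all J (g k)"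
  shows "(h, k) \<in> (adj \<inter> {(a, b). nonlinear_in_all J (g b)})\<^sup>*"
  using assms
proof (induction arbitrary: h rule: converse_rtrancl_induct)
  case base
  then show ?case by auto
next
  case (step i l)
  have I: "h \<in> I" "i \<in> I" "l \<in> I" using step by (auto simp: adj_def)
  show ?case
  proof (cases "nonlinear_in_all J (g i)")
    case True
    have "(i, k) \<in> (adj \<inter> {(a, b). nonlinear_in_all J (g b)})\<^sup>*"
      using step.IH[OF step.hyps(1) step.prems(2)] .
    moreover have "(h, i) \<in> adj \<inter> {(a, b). nonlinear_in_all J (g b)}" using True step.prems(1) by simp
    ultimately show ?thesis by (rule converse_rtrancl_into_rtrancl[rotated])
  next
    case False
    then have s: "signed_coord J (g i)" using row_cases I by blast
    obtain j j' where "j \<in> infl J (g h)" "j \<in> infl J (g i)" "j' \<in> infl J (g i)" "j' \<in> infl J (g l)"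
      using step.hyps(1) step.prems(1) by (auto simp: adj_def)
    moreover have "j = j'" using signed_coord_infl_unique[OF s] calculation by blast
    ultimately have "(h, l) \<in> adj" using I by (auto simp: adj_def)
    then show ?thesis using step.IH step.prems(2) by blast
  qed
qed

end

section \<open>The dependence on one connected component\<close>

text \<open>On an edge with two nonlinear ends, \<open>f_zero\<close> and \<open>g_zero\<close> act
  together: one entry set to \<open>- \<kappa> i j\<close> freezes row \<open>i\<close> at
  \<open>D i\<close> and column \<open>j\<close> at \<open>B j\<close>.\<close>

locale normalized_polymorphism = affine_polymorphism I J F G g f
  for I :: "'a set" and J :: "'b set" and F G g f +
  fixes \<kappa> :: "'a \<Rightarrow> 'b \<Rightarrow> real" and D :: "'a \<Rightarrow> real" and B :: "'b \<Rightarrow> real"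
    and \<phi> :: "'b \<Rightarrow> ('a \<Rightarrow> real) \<Rightarrow> real"
  assumes f_zero: "\<And>i j x. i \<in> I \<Longrightarrow> j \<in> infl J (g i) \<Longrightarrow> nonlinear_in_all J (g i) \<Longrightarrow>
      f j (x(i := - \<kappa> i j)) = B j"
    and g_zero: "\<And>i j y. i \<in> I \<Longrightarrow> j \<in> infl J (g i) \<Longrightarrow> nonlinear_in_all I (f j) \<Longrightarrow>
      g i (y(j := - \<kappa> i j)) = D i"
    and f_factor: "\<And>j x. j \<in> J \<Longrightarrow>
      f j x = (\<Prod>i\<in>core_rows j. x i + \<kappa> i j) * \<phi> j (restrict x (leaf_rows j)) + B j"
begin

lemma column_form:
  assumes j: "j \<in> J" "nonlinear_in_all I (f j)"
  shows "\<exists>K c. (\<forall>x. F x = K x + c x * \<phi> j (restrict (twist x) (leaf_rows j))) \<and>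
    (\<forall>x y. (\<forall>k. k \<notin> leaf_rows j \<longrightarrow> x k = y k) \<longrightarrow> K x = K y \<and> c x = c y) \<and>
    (\<forall>i\<in>core_rows j. \<forall>x. F (x(i := D i)) = K x)"
proof -
  \<comment> \<open>With the entry in column \<open>j\<close> equal to
    \<open>1 - \<kappa> i j\<close>, divisibility reduces \<open>g i\<close> to \<open>D i\<close>
    plus its derivative in \<open>j\<close>; this derivative is nonconstant, hence onto, so every
    row value remains reachable.\<close>
  have "\<exists>y. g i y = r \<and> (i \<in> core_rows j \<longrightarrow> y j = 1 - \<kappa> i j)" if i: "i \<in> I" for i r
  proof (cases "i \<in> core_rows j")
    case True
    then have e: "j \<in> infl J (g i)" and n: "nonlinear_in_all J (g i)"
      using edge_sym[OF i j(1)] by (auto simp: core_rows_def)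
    obtain y1 y2 where "pd j (g i) y1 \<noteq> pd j (g i) y2"
      using n e unfolding nonlinear_in_all_def by blast
    then obtain y where y: "pd j (g i) y = r - D i"
      using multiaffine_nonconst_surj[OF finJ multiaffine_pd[OF mag[OF i]], of j y1 y2] by blast
    have "g i (y(j := 1 - \<kappa> i j)) = r"
      using multiaffine_zero_at[OF mag[OF i] j(1), of "- \<kappa> i j" "D i" "y(j := 1 - \<kappa> i j)"]
        g_zero[OF i e j(2)] y by simp
    then show ?thesis by (intro exI[of _ "y(j := 1 - \<kappa> i j)"]) simp
  next
    case False
    then show ?thesis using realize_row[OF i] by blast
  qed
  then obtain sec where sec: "\<And>i r. i \<in> I \<Longrightarrow> g i (sec i r) = r"
      "\<And>i r. i \<in> I \<Longrightarrow> i \<in> core_rows j \<Longrightarrow> sec i r j = 1 - \<kappa> i j"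
    by metis
  \<comment> \<open>A matrix with row values \<open>x\<close> in which the coordinates from \<open>leaf_rows j\<close> affect only column \<open>j\<close>,
    and the linear factors of \<open>f j\<close> equal 1.\<close>
  define Z where "Z x i = (if i \<in> leaf_rows j then (\<lambda>k. if k = j then twist x i else 0)
    else sec i (x i))" for x i
  define Y where "Y x k = f k (\<lambda>i. Z x i k)" for x k
  have gZ: "g i (Z x i) = x i" if i: "i \<in> I" for i x
  proof (cases "i \<in> leaf_rows j")
    case True
    then have e: "j \<in> infl J (g i)" and s: "signed_coord J (g i)"
      using edge_sym[OF i j(1)] by (auto simp: leaf_rows_def)
    have "g i (Z x i) = g i (\<lambda>_. 1) * Z x i j" by (rule signed_coord_infl(1)[OF s e])
    also have "\<dots> = x i" using signed_coord_infl(2)[OF s e] True s by (auto simp: Z_def twist_def)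
    finally show ?thesis .
  next
    case False
    then show ?thesis using sec(1)[OF i] by (simp add: Z_def)
  qed
  have FG: "F x = G (Y x)" for x
  proof -
    have "F x = F (\<lambda>i. g i (Z x i))" by (rule multiaffine_cong[OF maF]) (simp add: gZ)
    then show ?thesis unfolding Y_def commute .
  qed
  have core: "i \<in> I" "i \<notin> leaf_rows j" if "i \<in> core_rows j" for i
    using that nonlinear_in_all_not_signed unfolding core_rows_def leaf_rows_def infl_def by blast+
  have Yj: "Y x j - B j = \<phi> j (restrict (twist x) (leaf_rows j))" for x
  proof -
    have "(\<Prod>i\<in>core_rows j. Z x i j + \<kappa> i j) = 1"
      using core by (intro prod.neutral) (auto simp: Z_def sec)
    moreover have "restrict (\<lambda>i. Z x i j) (leaf_rows j) = restrict (twist x) (leaf_rows j)"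
      by (auto simp: Z_def restrict_def)
    ultimately show ?thesis unfolding Y_def f_factor[OF j(1)] by simp
  qed
  define K where "K x = G ((Y x)(j := B j))" for x
  define c where "c x = pd j G (Y x)" for x
  have 1: "F x = K x + c x * \<phi> j (restrict (twist x) (leaf_rows j))" for x
      using multiaffine_expand[OF maG j(1), of "Y x" "B j"] by (simp add: FG Yj K_def c_def)
  have 2: "K x = K y \<and> c x = c y" if eq: "\<forall>k. k \<notin> leaf_rows j \<longrightarrow> x k = y k" for x y
  proof -
    have "Z x i k = Z y i k" if "k \<noteq> j" for i k using that eq by (simp add: Z_def)
    then have Y: "Y x k = Y y k" if "k \<noteq> j" for k using that by (simp add: Y_def)
    then have "(Y x)(j := B j) = (Y y)(j := B j)" by auto
    moreover have "c x = c y" unfolding c_def by (rule pd_cong[OF maG]) (use Y in auto)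
    ultimately show ?thesis by (simp add: K_def)
  qed
  \<comment> \<open>A single entry of \<open>Z x\<close> is changed: it freezes row \<open>i\<close>
    at \<open>D i\<close> and column \<open>j\<close> at \<open>B j\<close>, and touches no other
    row or column.\<close>
  have 3: "F (x(i := D i)) = K x" if i: "i \<in> core_rows j" for i x
  proof -
    have e: "j \<in> infl J (g i)" and n: "nonlinear_in_all J (g i)"
      using edge_sym[OF core(1)[OF i] j(1)] i by (auto simp: core_rows_def)
    define z where "z = (Z x)(i := (Z x i)(j := - \<kappa> i j))"
    have "F (x(i := D i)) = F (\<lambda>l. g l (z l))"
      by (rule multiaffine_cong[OF maF])
        (use gZ g_zero[OF core(1)[OF i] e j(2)] in \<open>auto simp: z_def\<close>)
    also have "\<dots> = G (\<lambda>k. f k (\<lambda>l. z l k))" by (rule commute)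
    also have "(\<lambda>k. f k (\<lambda>l. z l k)) = (Y x)(j := B j)"
    proof
      fix k
      have "(\<lambda>l. z l j) = (\<lambda>l. Z x l j)(i := - \<kappa> i j)" by (auto simp: z_def)
      moreover have "(\<lambda>l. z l k) = (\<lambda>l. Z x l k)" if "k \<noteq> j" using that by (auto simp: z_def)
      ultimately show "f k (\<lambda>l. z l k) = ((Y x)(j := B j)) k"
        using f_zero[OF core(1)[OF i] e n] by (auto simp: Y_def)
    qed
    finally show ?thesis unfolding K_def .
  qed
  show ?thesis
    by (rule exI[of _ K], rule exI[of _ c]) (use 1 2 3 in blast)
qed

text \<open>The entry of row \<open>k\<close> in column \<open>j\<close> is set to
  \<open>- \<kappa> k j\<close>. This gives row \<open>k\<close> the value \<open>D k\<close> and
  makes \<open>f j\<close> constant, so the right side of \<open>edge_identity\<close> at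
  \<open>i\<close>, \<open>j\<close> vanishes while the derivative of row \<open>i\<close> can be
  kept nonzero.\<close>

lemma indep_at_D_adjacent:
  assumes i: "i \<in> I" and k: "k \<in> I" "i \<noteq> k" "nonlinear_in_all J (g k)"
    and ji: "j \<in> infl J (g i)" and jk: "j \<in> infl J (g k)"
  shows "F (x(k := D k, i := t)) = F (x(k := D k))"
proof -
  have jJ: "j \<in> J" using ji by (auto simp: infl_def)
  have e: "i \<in> infl I (f j)" "k \<in> infl I (f j)" using infl_f_if_infl_g i k(1) ji jk by blast+
  then have n: "nonlinear_in_all I (f j)"
    using col_cases[OF jJ] signed_coord_infl_unique k(2) by metis
  obtain y where y: "pd j (g i) y \<noteq> 0" using ji by (auto simp: infl_def)
  obtain z where z: "\<forall>i\<in>I. g i (z i) = x i" using realize by blast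
  define z' where "z' = z(i := y, k := (z k)(j := - \<kappa> k j))"
  have "pd i F (\<lambda>l. g l (z' l)) = pd i F (x(k := D k))"
    by (rule pd_cong[OF maF]) (use z g_zero[OF k(1) jk n] in \<open>auto simp: z'_def\<close>)
  moreover have "pd i (f j) (\<lambda>l. z' l j) = 0"
  proof -
    have "(\<lambda>l. z' l j)(i := s) = ((\<lambda>l. z' l j)(i := s))(k := - \<kappa> k j)" for s
      using k(2) by (auto simp: z'_def)
    then have "f j ((\<lambda>l. z' l j)(i := s)) = B j" for s using f_zero[OF k(1) jk k(3)] by metis
    then show ?thesis by (simp add: pd_def)
  qed
  moreover have "z' i = y" using k(2) by (simp add: z'_def)
  ultimately have "pd i F (x(k := D k)) = 0" using edge_identity[OF i jJ, of z'] y by simp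
  then show ?thesis
    using multiaffine_diff[OF maF i, of "x(k := D k)" t "(x(k := D k)) i"] unfolding fun_upd_triv by simp
qed

text \<open>The path is first rerouted through nonlinear rows, because the adjacent case freezes
  columns only through such rows.\<close>

lemma indep_at_D:
  assumes "(i, k) \<in> adj\<^sup>*" "i \<in> I" "i \<noteq> k" "nonlinear_in_all J (g k)"
  shows "F (x(k := D k, i := t)) = F (x(k := D k))"
proof -
  \<comment> \<open>Reflexivity lets \<open>i\<close> serve as its own predecessor in
    \<open>path_through_core\<close>.\<close>
  have "(i, i) \<in> adj" using assms(2) infl_g_nonempty by (auto simp: adj_def)
  then have "(i, k) \<in> (adj \<inter> {(a, b). nonlinear_in_all J (g b)})\<^sup>*"
    using path_through_core assms by blast
  then show ?thesis using assms(3)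
  proof (induction arbitrary: x t rule: converse_rtrancl_induct)
    case (step i l)
    obtain j where j: "j \<in> infl J (g i)" "j \<in> infl J (g l)" and I: "i \<in> I" "l \<in> I"
      and n: "nonlinear_in_all J (g l)"
      using step.hyps(1) by (auto simp: adj_def)
    consider "l = k" | "l = i" | "l \<noteq> k" "l \<noteq> i" by blast
    then show ?case
    proof cases
      case 1
      then show ?thesis using indep_at_D_adjacent[OF I(1,2) _ n j, of x t] step.prems by metis
    next
      case 2
      then show ?thesis using step.IH step.prems by blast
    next
      case 3
      \<comment> \<open>Once \<open>x k = D k\<close>, the coordinate \<open>l\<close> is irrelevant, so it may be set to \<open>D l\<close>,
        which makes the coordinate \<open>i\<close> irrelevant.\<close>
      have tw: "x(k := D k, i := s, l := D l) = (x(k := D k))(l := D l, i := s)" for s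
        by (rule fun_upd_twist) (use 3 in auto)
      have "F (x(k := D k, i := s)) = F (x(k := D k, l := D l))" for s
      proof -
        have "x(k := D k, i := s) = (x(i := s))(k := D k)"
          by (rule fun_upd_twist) (use step.prems in auto)
        then have "F (x(k := D k, i := s)) = F (x(k := D k, i := s, l := D l))"
          using step.IH[OF 3(1), of "x(i := s)" "D l"] by metis
        then show ?thesis
          unfolding tw using indep_at_D_adjacent[OF I(1,2) _ n j, of "x(k := D k)" s] 3 by metis
      qed
      from this[of t] this[of "(x(k := D k)) i"] show ?thesis unfolding fun_upd_triv by metis
    qed
  qed simp
qed

section \<open>The product belonging to a component\<close>

definition block_cols :: "'a set \<Rightarrow> 'b set" where
  "block_cols C = {j \<in> (\<Union>i\<in>C. infl J (g i)). nonlinear_in_all I (f j)}"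

definition block_fun :: "'a set \<Rightarrow> ('a \<Rightarrow> real) \<Rightarrow> real" where
  "block_fun C x = (\<Prod>i\<in>{i \<in> C. nonlinear_in_all J (g i)}. x i - D i) *
     (\<Prod>j\<in>block_cols C. \<phi> j (restrict (twist x) (leaf_rows j)))"

text \<open>Otherwise \<open>f j\<close> would be constant. This later supplies a base point where
  the product of a component does not vanish.\<close>

lemma \<phi>_nonzero:
  assumes "j \<in> J"
  shows "\<exists>x. \<phi> j (restrict x (leaf_rows j)) \<noteq> 0"
proof (rule ccontr)
  assume "\<not> ?thesis"
  then have "f j x = B j" for x using f_factor[OF assms] by simp
  then have "infl I (f j) = {}" by (simp add: infl_def pd_def)
  then show False using affine_polymorphism.infl_g_nonempty[OF dual assms] by simp
qed

text \<open>\<open>F\<close> minus its frozen part is proportional to each linear factor in its row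
  variable and to each \<open>\<phi> j\<close> in the leaves of \<open>j\<close>; these variable
  sets partition \<open>C\<close>. The hypothesis \<open>leaf\<close> excludes a component that is
  one edge with two signed ends, for which \<open>block_fun\<close> would be an empty
  product.\<close>

lemma block_form:
  assumes CI: "C \<subseteq> I" "C \<noteq> {}"
    and connected: "\<And>i k. i \<in> C \<Longrightarrow> k \<in> C \<Longrightarrow> (i, k) \<in> adj\<^sup>*"
    and closed: "\<And>i k. i \<in> C \<Longrightarrow> (i, k) \<in> adj \<Longrightarrow> k \<in> C"
    and leaf: "\<And>i j. i \<in> C \<Longrightarrow> j \<in> infl J (g i) \<Longrightarrow> signed_coord J (g i) \<Longrightarrow> nonlinear_in_all I (f j)"
  shows "\<exists>K c. (\<forall>x. F x = K x + c x * block_fun C x) \<and>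
    (\<forall>x y. (\<forall>k. k \<notin> C \<longrightarrow> x k = y k) \<longrightarrow> K x = K y \<and> c x = c y)"
proof -
  have finC: "finite C" using CI finI finite_subset by blast
  have col: "k \<in> C" "j \<in> infl J (g k)" if "i \<in> C" "j \<in> infl J (g i)" "k \<in> infl I (f j)" for i j k
  proof -
    have "k \<in> I" "j \<in> J" using that by (auto simp: infl_def)
    then show "j \<in> infl J (g k)" using edge_sym that(3) by blast
    then have "(i, k) \<in> adj" using that CI \<open>k \<in> I\<close> by (auto simp: adj_def)
    then show "k \<in> C" using closed that(1) by blast
  qed
  show ?thesis
  proof (cases "\<exists>i\<in>C. nonlinear_in_all J (g i)")
    \<comment> \<open>Without nonlinear rows the component is a single column with leaves only, and
      \<open>column_form\<close> is already the claim.\<close>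
    case False
    then have s: "signed_coord J (g i)" if "i \<in> C" for i using that row_cases CI by blast
    obtain i j where i: "i \<in> C" and j: "j \<in> infl J (g i)" using CI infl_g_nonempty by blast
    have jJ: "j \<in> J" using j by (auto simp: infl_def)
    have jn: "nonlinear_in_all I (f j)" using leaf[OF i j s[OF i]] .
    have all: "j \<in> infl J (g k)" if "k \<in> C" for k
    proof (rule leaf_column_closed[OF _ connected[OF i that] j])
      show "signed_coord J (g k)" if "k \<in> infl I (f j)" for k using s col(1)[OF i j that] .
    qed
    have "infl J (g k) = {j}" if "k \<in> C" for k
      using all[OF that] signed_coord_infl_unique[OF s[OF that]] by blast
    then have cols: "block_cols C = {j}" using jn CI(2) by (auto simp: block_cols_def)
    have leafC: "leaf_rows j = C"
      using col(1)[OF i j] all infl_f_if_infl_g s CI(1) by (auto simp: leaf_rows_def)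
    have empty: "{i \<in> C. nonlinear_in_all J (g i)} = {}" using False by blast
    have p: "block_fun C x = \<phi> j (restrict (twist x) (leaf_rows j))" for x
      unfolding block_fun_def empty cols by simp
    show ?thesis using column_form[OF jJ jn] unfolding p leafC by blast
  next
    case True
    then obtain i0 where i0: "i0 \<in> C" "nonlinear_in_all J (g i0)" by blast
    \<comment> \<open>Setting \<open>x i0 = D i0\<close> makes all of \<open>C\<close> irrelevant;
      \<open>K_at\<close> shows that every other nonlinear row of \<open>C\<close> gives the same
      \<open>K\<close>.\<close>
    define K where "K x = F (x(i0 := D i0))" for x
    define H where "H x = F x - K x" for x
    have K_upd: "K (x(i := t)) = K x" if i: "i \<in> C" for i x t
    proof (cases "i = i0")
      case True
      then show ?thesis by (simp add: K_def)
    next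
      case False
      have "x(i := t, i0 := D i0) = x(i0 := D i0, i := t)" by (rule fun_upd_twist) (use False in auto)
      then show ?thesis
        unfolding K_def using indep_at_D[OF connected[OF i i0(1)] _ False i0(2), of x t] i CI by auto
    qed
    have K_cong: "K x = K y" if "\<And>k. k \<notin> C \<Longrightarrow> x k = y k" for x y
      by (rule finite_indep_cong[OF finC, where p = K]) (use K_upd that in auto)
    have K_at: "F (x(k := D k)) = K x" if k: "k \<in> C" "nonlinear_in_all J (g k)" for k x
    proof (cases "k = i0")
      case False
      have "F (x(k := D k)) = F (x(k := D k, i0 := D i0))"
        using indep_at_D[OF connected[OF i0(1) k(1)] _ _ k(2), of x "D i0"] False i0 CI by auto
      also have "\<dots> = K (x(k := D k))" by (simp add: K_def)
      also have "\<dots> = K x" by (rule K_upd[OF k(1)])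
      finally show ?thesis .
    qed (simp add: K_def)
    define R where "R = {i \<in> C. nonlinear_in_all J (g i)}"
    have H_row: "H x = (x k - D k) * pd k F x" if "k \<in> R" for k x
      using multiaffine_expand[OF maF, of k x "D k"] K_at[of k x] that CI(1) by (auto simp: R_def H_def)
    have H_col: "H x * \<phi> j (restrict (twist y) (leaf_rows j)) = H y * \<phi> j (restrict (twist x) (leaf_rows j))"
      if j: "j \<in> block_cols C" and eq: "\<And>k. k \<notin> leaf_rows j \<Longrightarrow> x k = y k" for j x y
    proof -
      obtain i where i: "i \<in> C" "j \<in> infl J (g i)" and jn: "nonlinear_in_all I (f j)"
        using j by (auto simp: block_cols_def)
      have jJ: "j \<in> J" using i by (auto simp: infl_def)
      \<comment> \<open>A column with only leaf rows would be closed under paths and so contain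
        \<open>i0\<close>, which is not a leaf.\<close>
      have "\<exists>k. k \<in> infl I (f j) \<and> \<not> signed_coord J (g k)"
      proof (rule ccontr)
        assume *: "\<not> ?thesis"
        have "j \<in> infl J (g i0)"
          by (rule leaf_column_closed[OF _ connected[OF i(1) i0(1)] i(2)]) (use * in blast)
        then have "i0 \<in> infl I (f j)" using infl_f_if_infl_g i0 CI by blast
        then show False using * nonlinear_in_all_not_signed[OF i0(2)] by blast
      qed
      then obtain k where k: "k \<in> infl I (f j)" "\<not> signed_coord J (g k)" by blast
      have kC: "k \<in> C" by (rule col(1)[OF i k(1)])
      then have kn: "nonlinear_in_all J (g k)" using k(2) row_cases CI by blast
      obtain K' c' where 1: "\<And>x. F x = K' x + c' x * \<phi> j (restrict (twist x) (leaf_rows j))"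
        and 2: "\<And>x y. \<forall>k. k \<notin> leaf_rows j \<longrightarrow> x k = y k \<Longrightarrow> K' x = K' y \<and> c' x = c' y"
        and 3: "\<And>i x. i \<in> core_rows j \<Longrightarrow> F (x(i := D i)) = K' x"
        using column_form[OF jJ jn] by metis
      \<comment> \<open>Both are the value of \<open>F\<close> at \<open>x k = D k\<close>, so the
        decomposition by the column and the one by the component have the same frozen part.\<close>
      have "K x = K' x" for x using 3[of k x] K_at[OF kC kn, of x] k kn by (simp add: core_rows_def)
      then have "H x = c' x * \<phi> j (restrict (twist x) (leaf_rows j))" for x
        unfolding H_def 1[of x] by simp
      moreover have "c' x = c' y" using 2 eq by blast
      ultimately show ?thesis by simp
    qed
    have leafC: "leaf_rows j \<subseteq> C - R" if "j \<in> block_cols C" for j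
    proof
      fix k assume "k \<in> leaf_rows j"
      then have k: "k \<in> infl I (f j)" "signed_coord J (g k)" by (auto simp: leaf_rows_def)
      obtain i where "i \<in> C" "j \<in> infl J (g i)" using \<open>j \<in> block_cols C\<close> by (auto simp: block_cols_def)
      then show "k \<in> C - R"
        using col(1) k nonlinear_in_all_not_signed[of J "g k"] by (auto simp: R_def)
    qed
    have cover: "R \<union> (\<Union>j\<in>block_cols C. leaf_rows j) = C"
    proof
      show "R \<union> (\<Union>j\<in>block_cols C. leaf_rows j) \<subseteq> C" using leafC by (auto simp: R_def)
      show "C \<subseteq> R \<union> (\<Union>j\<in>block_cols C. leaf_rows j)"
      proof
        fix i assume i: "i \<in> C"
        show "i \<in> R \<union> (\<Union>j\<in>block_cols C. leaf_rows j)"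
        proof (cases "nonlinear_in_all J (g i)")
          case True
          then show ?thesis using i by (simp add: R_def)
        next
          case False
          then have s: "signed_coord J (g i)" using i row_cases CI by blast
          obtain j where j: "j \<in> infl J (g i)" using i infl_g_nonempty CI by blast
          then have "j \<in> block_cols C" using leaf i s by (auto simp: block_cols_def)
          moreover have "i \<in> leaf_rows j"
            using infl_f_if_infl_g j i CI s by (auto simp: leaf_rows_def)
          ultimately show ?thesis by blast
        qed
      qed
    qed
    have fin: "finite R" "finite (block_cols C)"
      using finC finJ by (auto simp: R_def block_cols_def infl_def)
    have leaf_cong: "\<phi> j (restrict (twist x) (leaf_rows j)) = \<phi> j (restrict (twist y) (leaf_rows j))"
      if "\<And>k. k \<in> leaf_rows j \<Longrightarrow> x k = y k" for j x y
    proof -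
      have "restrict (twist x) (leaf_rows j) = restrict (twist y) (leaf_rows j)"
        using that by (auto simp: restrict_def twist_def)
      then show ?thesis by simp
    qed
    have "\<exists>x. j \<in> J \<longrightarrow> \<phi> j (restrict x (leaf_rows j)) \<noteq> 0" for j using \<phi>_nonzero by blast
    then obtain X where X: "\<And>j. j \<in> J \<Longrightarrow> \<phi> j (restrict (X j) (leaf_rows j)) \<noteq> 0" by metis
    \<comment> \<open>On nonlinear rows the linear factor becomes 1. On a leaf, \<open>SOME\<close>
      picks its unique column, and the sign cancels against the one in \<open>twist\<close>, leaving
      the point where \<open>\<phi> j\<close> is nonzero.\<close>
    define x0 where "x0 i = (if signed_coord J (g i)
      then g i (\<lambda>_. 1) * X (SOME j. j \<in> infl J (g i)) i else D i + 1)" for i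
    have x0_leaf: "restrict (twist x0) (leaf_rows j) = restrict (X j) (leaf_rows j)" if "j \<in> J" for j
    proof (rule restrict_ext)
      fix i assume "i \<in> leaf_rows j"
      then have i: "i \<in> I" "j \<in> infl J (g i)" "signed_coord J (g i)"
        using edge_sym[OF _ \<open>j \<in> J\<close>] by (auto simp: leaf_rows_def infl_def)
      have "(SOME j. j \<in> infl J (g i)) = j"
        using i(2) signed_coord_infl_unique[OF i(3)] by (intro some_equality) blast+
      then show "twist x0 i = X j i"
        using i signed_coord_infl(2)[OF i(3,2)] by (auto simp: twist_def x0_def)
    qed
    have "(\<Prod>k\<in>R. x0 k - D k) = 1"
      using nonlinear_in_all_not_signed by (intro prod.neutral) (auto simp: x0_def R_def)
    moreover have "(\<Prod>j\<in>block_cols C. \<phi> j (restrict (twist x0) (leaf_rows j))) \<noteq> 0"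
      using fin X by (auto simp: x0_leaf block_cols_def infl_def)
    ultimately have p0: "block_fun C x0 \<noteq> 0" by (simp add: block_fun_def R_def)
    \<comment> \<open>\<open>product_factor\<close> is used twice: for the nonlinear rows, then for
      the leaves. Leaves avoid \<open>R\<close>, so the first replacement leaves the second product
      unchanged.\<close>
    have prod: "H x * block_fun C x0 = H (override_on x x0 C) * block_fun C x" for x
    proof -
      let ?\<psi> = "\<lambda>x. \<Prod>j\<in>block_cols C. \<phi> j (restrict (twist x) (leaf_rows j))"
      let ?L = "\<Union>j\<in>block_cols C. leaf_rows j"
      let ?x = "override_on x x0 R"
      have 1: "H x * (\<Prod>k\<in>R. x0 k - D k) = H (override_on x x0 (\<Union>k\<in>R. {k})) * (\<Prod>k\<in>R. x k - D k)"
      proof (rule product_factor[where H = H and a = "\<lambda>k x. x k - D k" and V = "\<lambda>k. {k}"])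
        fix k and x y :: "'a \<Rightarrow> real" assume k: "k \<in> R" and "\<And>l. l \<notin> {k} \<Longrightarrow> x l = y l"
        then have "pd k F x = pd k F y" by (intro pd_cong[OF maF]) auto
        then show "H x * (y k - D k) = H y * (x k - D k)" by (simp add: H_row[OF k])
      qed (use fin in \<open>auto simp: disjoint_family_on_def\<close>)
      have 2: "H ?x * ?\<psi> x0 = H (override_on ?x x0 ?L) * ?\<psi> ?x"
      proof (rule product_factor[where H = H and V = leaf_rows
            and a = "\<lambda>j x. \<phi> j (restrict (twist x) (leaf_rows j))"])
        show "disjoint_family_on leaf_rows (block_cols C)"
          unfolding disjoint_family_on_def
        proof (intro ballI impI)
          fix j j' assume jj: "j \<in> block_cols C" "j' \<in> block_cols C" "j \<noteq> j'"
          have "j = j'" if "i \<in> leaf_rows j" "i \<in> leaf_rows j'" for i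
          proof -
            have "j \<in> J" "j' \<in> J" "i \<in> I" using jj that by (auto simp: block_cols_def infl_def leaf_rows_def)
            then show ?thesis
              using that edge_sym signed_coord_infl_unique[of J "g i" j j'] by (auto simp: leaf_rows_def)
          qed
          then show "leaf_rows j \<inter> leaf_rows j' = {}" using jj by blast
        qed
      qed (use fin leaf_cong H_col in blast)+
      have 3: "?\<psi> ?x = ?\<psi> x"
        using leafC by (intro prod.cong refl leaf_cong) (auto simp: override_on_def)
      have "override_on ?x x0 ?L = override_on x x0 (R \<union> ?L)" by (auto simp: override_on_def)
      then have 4: "override_on ?x x0 ?L = override_on x x0 C" unfolding cover .
      have "H x * block_fun C x0 = (H x * (\<Prod>k\<in>R. x0 k - D k)) * ?\<psi> x0"
        by (simp add: block_fun_def R_def)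
      also have "\<dots> = (H ?x * ?\<psi> x0) * (\<Prod>k\<in>R. x k - D k)" unfolding 1 by simp
      also have "\<dots> = H (override_on x x0 C) * block_fun C x"
        unfolding 2 3 4 by (simp add: block_fun_def R_def)
      finally show ?thesis .
    qed
    \<comment> \<open>All coordinates of \<open>C\<close> are fixed at \<open>x0\<close>, so
      \<open>c\<close> cannot depend on them.\<close>
    define c where "c x = H (override_on x x0 C) / block_fun C x0" for x
    have "H x = c x * block_fun C x" for x using prod[of x] p0 by (simp add: c_def field_simps)
    then have 1: "F x = K x + c x * block_fun C x" for x by (metis H_def add_diff_cancel_left' add_diff_eq)
    have 2: "K x = K y \<and> c x = c y" if eq: "\<forall>k. k \<notin> C \<longrightarrow> x k = y k" for x y
    proof -
      have "override_on x x0 C = override_on y x0 C" using eq by (auto simp: override_on_def)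
      then show ?thesis using K_cong[of x y] eq by (simp add: c_def)
    qed
    show ?thesis by (rule exI[of _ K], rule exI[of _ c]) (use 1 2 in blast)
  qed
qed

end

section \<open>Gluing the components\<close>

text \<open>By \<open>form\<close>, \<open>F\<close> sees a block only through \<open>p l\<close>,
  so it factors through the tuple of these values. Each \<open>p l\<close> is onto, which lets
  \<open>h\<close> be defined as \<open>F\<close> at a chosen point with prescribed values.\<close>

lemma glue_blocks:
  fixes F :: "('a \<Rightarrow> real) \<Rightarrow> real" and C :: "'l \<Rightarrow> 'a set"
  assumes finI: "finite I" and F: "multiaffine I F" and inflF: "infl I F = I"
    and L: "finite L" "disjoint_family_on C L" "(\<Union>l\<in>L. C l) = I" "\<And>l. l \<in> L \<Longrightarrow> C l \<noteq> {}"
    and p_cong: "\<And>l x y. l \<in> L \<Longrightarrow> (\<And>k. k \<in> C l \<Longrightarrow> x k = y k) \<Longrightarrow> p l x = p l y"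
    and form: "\<And>l x. l \<in> L \<Longrightarrow> F x = K l x + c l x * p l x"
    and Kc_cong: "\<And>l x y. l \<in> L \<Longrightarrow> (\<And>k. k \<notin> C l \<Longrightarrow> x k = y k) \<Longrightarrow> K l x = K l y \<and> c l x = c l y"
  obtains h where "multiaffine L h" "\<And>x. F x = h (\<lambda>l. p l x)" "depends_on_all L h"
proof -
  have p_disj: "p l x = p l y" if "l \<in> L" "l' \<in> L" "l \<noteq> l'" "\<And>k. k \<notin> C l' \<Longrightarrow> x k = y k" for l l' x y
  proof (rule p_cong[OF that(1)])
    fix k assume "k \<in> C l"
    then have "k \<notin> C l'" using L(2) that(1-3) by (auto simp: disjoint_family_on_def)
    then show "x k = y k" by (rule that(4))
  qed
  \<comment> \<open>Some coordinate of \<open>C l\<close> influences \<open>F\<close>; along it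
    \<open>F\<close> is onto and equals \<open>K l x\<close> plus a nonzero multiple of
    \<open>p l\<close>, so \<open>p l\<close> is onto too.\<close>
  have "\<exists>x. p l x = r" if l: "l \<in> L" for l r
  proof -
    obtain i x where i: "i \<in> C l" "i \<in> I" "pd i F x \<noteq> 0"
      using L(3) L(4)[OF l] l inflF unfolding infl_def by blast
    have upd: "F (x(i := t)) = K l x + c l x * p l (x(i := t))" for t
      using form[OF l, of "x(i := t)"] Kc_cong[OF l, of "x(i := t)" x] i(1) by (metis fun_upd_other)
    have "c l x \<noteq> 0"
    proof
      assume "c l x = 0"
      then have "pd i F x = 0" unfolding pd_def upd by simp
      then show False using i by simp
    qed
    moreover obtain t where "F (x(i := t)) = K l x + c l x * r"
      using multiaffine_surj[OF F i(2,3)] by blast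
    ultimately have "p l (x(i := t)) = r" unfolding upd by simp
    then show ?thesis by blast
  qed
  then obtain \<sigma> where \<sigma>: "\<And>l r. l \<in> L \<Longrightarrow> p l (\<sigma> l r) = r" by metis
  have "\<exists>l. i \<in> I \<longrightarrow> l \<in> L \<and> i \<in> C l" for i using L(3) by blast
  then obtain b where b: "\<And>i. i \<in> I \<Longrightarrow> b i \<in> L \<and> i \<in> C (b i)" by metis
  have b_eq: "b i = l" if "l \<in> L" "i \<in> C l" for i l
  proof -
    have "i \<in> I" using that L(3) by blast
    then show ?thesis using b[of i] that L(2) by (auto simp: disjoint_family_on_def)
  qed
  \<comment> \<open>Glues the chosen preimages blockwise; the default 0 fills coordinates that
    \<open>F\<close> ignores.\<close>
  define pt where "pt t = (\<lambda>i. if i \<in> I then \<sigma> (b i) (t (b i)) i else 0)" for t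
  have p_pt: "p l (pt t) = t l" if "l \<in> L" for l t
  proof -
    have "p l (pt t) = p l (\<sigma> l (t l))"
      using L(3) that by (intro p_cong) (auto simp: pt_def b_eq)
    then show ?thesis using \<sigma>[OF that] by simp
  qed
  \<comment> \<open>The blocks of \<open>x\<close> are replaced by those of \<open>y\<close> one at
    a time.\<close>
  have F_cong: "F x = F y" if eq: "\<And>l. l \<in> L \<Longrightarrow> p l x = p l y" for x y
  proof -
    have "F (override_on x y (\<Union>l\<in>A. C l)) = F x" if "A \<subseteq> L" for A
      using finite_subset[OF that L(1)] that
    proof (induction A rule: finite_induct)
      case (insert l A)
      let ?x = "override_on x y (\<Union>l\<in>A. C l)" and ?y = "override_on x y (\<Union>l\<in>insert l A. C l)"
      have l: "l \<in> L" using insert.prems by simp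
      have "C l \<inter> (\<Union>l\<in>A. C l) = {}"
        using insert.hyps(2) insert.prems L(2) by (fastforce simp: disjoint_family_on_def)
      then have "p l ?x = p l x" by (intro p_cong[OF l]) (auto simp: override_on_def)
      moreover have "p l ?y = p l y" by (intro p_cong[OF l]) (auto simp: override_on_def)
      moreover have "K l ?y = K l ?x \<and> c l ?y = c l ?x"
        by (rule Kc_cong[OF l]) (auto simp: override_on_def)
      ultimately have "F ?y = F ?x" using form[OF l, of ?x] form[OF l, of ?y] eq[OF l] by simp
      then show ?case using insert by simp
    qed simp
    from this[of L] have "F (override_on x y I) = F x" using L(3) by simp
    moreover have "F (override_on x y I) = F y" by (rule multiaffine_cong[OF F]) simp
    ultimately show ?thesis by simp
  qed
  define h where "h t = F (pt t)" for t
  have h: "F x = h (\<lambda>l. p l x)" for x unfolding h_def by (rule F_cong) (simp add: p_pt)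
  show thesis
  proof (rule that)
    show "multiaffine L h" unfolding multiaffine_def
    proof (intro conjI allI ballI impI)
      fix s t :: "'l \<Rightarrow> real" assume "\<forall>l\<in>L. s l = t l"
      then have "pt s = pt t" using b by (auto simp: pt_def)
      then show "h s = h t" by (simp add: h_def)
    next
      fix l t r assume l: "l \<in> L"
      \<comment> \<open>Changing \<open>t l\<close> moves \<open>pt t\<close> only inside
        \<open>C l\<close>, where \<open>K l\<close> and \<open>c l\<close> are constant.\<close>
      have "h (t(l := r)) = K l (pt t) + c l (pt t) * r" for r
      proof -
        have "K l (pt (t(l := r))) = K l (pt t) \<and> c l (pt (t(l := r))) = c l (pt t)"
          using b by (intro Kc_cong[OF l]) (auto simp: pt_def)
        then show ?thesis using form[OF l, of "pt (t(l := r))"] p_pt[OF l] by (simp add: h_def)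
      qed
      then show "h (t(l := r)) = h (t(l := 0)) + r * pd l h t" by (simp add: pd_def)
    qed
    show "depends_on_all L h" unfolding depends_on_all_def
    proof
      fix l assume l: "l \<in> L"
      obtain i x where i: "i \<in> C l" "pd i F x \<noteq> 0"
        using L(3) L(4)[OF l] l inflF unfolding infl_def by blast
      let ?t = "\<lambda>l. p l (x(i := 0))"
      have other: "p l' (x(i := 0)) = p l' (x(i := 1))" if "l' \<in> L" "l' \<noteq> l" for l'
        by (rule p_disj[OF that(1) l that(2)]) (use i(1) in auto)
      have "h (?t(l := p l (x(i := 1)))) = F (x(i := 1))" unfolding h_def
      proof (rule F_cong)
        fix l' assume l': "l' \<in> L"
        show "p l' (pt (?t(l := p l (x(i := 1))))) = p l' (x(i := 1))"
          unfolding p_pt[OF l'] using other[OF l'] by (cases "l' = l") simp_all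
      qed
      moreover have "h ?t = F (x(i := 0))" by (rule h[symmetric])
      ultimately show "\<exists>t r. h (t(l := r)) \<noteq> h t" using i(2) unfolding pd_def by (metis diff_self)
    qed
  qed (fact h)
qed

section \<open>Boolean-like functions and their multilinear extensions\<close>

abbreviation (input) nonconst_boolean_like :: "'a set \<Rightarrow> (('a \<Rightarrow> real) \<Rightarrow> real) \<Rightarrow> bool" where
  "nonconst_boolean_like I p \<equiv> boolean_like I p \<and> \<not> p constant_on cube I"

text \<open>The derivative is multiaffine, so if it vanished on the cube it would vanish everywhere;
  a real witness thus yields a cube witness.\<close>

lemma Dep_eq_infl_mlx:
  fixes I :: "'a set"
  assumes I: "finite I"
  shows "Dep I p = infl I (mlx I p)"
proof (intro equalityI subsetI)
  fix i assume "i \<in> Dep I p"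
  then obtain x where x: "i \<in> I" "x \<in> cube I" "p (x(i := - x i)) \<noteq> p x" by (auto simp: Dep_def)
  then have "mlx I p (x(i := - x i)) \<noteq> mlx I p x" using mlx_cube[OF I] cube_flip by metis
  then have "pd i (mlx I p) x \<noteq> 0"
    using multiaffine_expand[OF multiaffine_mlx[OF I] x(1), of p x "- x i"] by auto
  then show "i \<in> infl I (mlx I p)" using x(1) by (auto simp: infl_def)
next
  fix i assume "i \<in> infl I (mlx I p)"
  then obtain w where i: "i \<in> I" "pd i (mlx I p) w \<noteq> 0" by (auto simp: infl_def)
  have "\<exists>x\<in>cube I. pd i (mlx I p) x \<noteq> 0"
  proof (rule ccontr)
    assume *: "\<not> ?thesis"
    have "multiaffine I (\<lambda>x :: 'a \<Rightarrow> real. 0)" by (simp add: multiaffine_def pd_def)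
    then have "pd i (mlx I p) w = 0"
      by (rule multiaffine_eqI[OF I multiaffine_pd[OF multiaffine_mlx[OF I]]]) (use * in blast)
    then show False using i by simp
  qed
  then obtain x where x: "x \<in> cube I" "pd i (mlx I p) x \<noteq> 0" by blast
  have "mlx I p x = mlx I p (x(i := - x i)) + 2 * x i * pd i (mlx I p) x"
    using multiaffine_expand[OF multiaffine_mlx[OF I] i(1), of p x "- x i"] by simp
  moreover have "x i \<noteq> 0" using cube_vals[OF x(1) i(1)] by auto
  ultimately have "mlx I p x \<noteq> mlx I p (x(i := - x i))" using x(2) by simp
  then have "p x \<noteq> p (x(i := - x i))" using mlx_cube[OF I] x(1) cube_flip[OF x(1) i(1)] by metis
  then show "i \<in> Dep I p" using i(1) x(1) unfolding Dep_def by force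
qed

lemma infl_mlx_nonempty:
  assumes I: "finite I" and p: "\<not> p constant_on cube I"
  shows "infl I (mlx I p) \<noteq> {}"
proof
  assume "infl I (mlx I p) = {}"
  then have "mlx I p x = mlx I p y" for x y
    using multiaffine_cong[OF multiaffine_infl[OF I multiaffine_mlx[OF I, of p]], of x y] by simp
  then have "p x = mlx I p (\<lambda>_. 0)" if "x \<in> cube I" for x using mlx_cube[OF I that] by metis
  then show False using p unfolding constant_on_def by blast
qed

text \<open>Subtracting \<open>c * x w\<close> removes all dependence on \<open>w\<close>, and the
  subtracted term has only the coefficient of \<open>{w}\<close>.\<close>

lemma fourier_affine_coord:
  assumes I: "finite I" and S: "S \<subseteq> I" "w \<in> S" "S \<noteq> {w}"
    and p: "\<And>x. pd w (mlx I p) x = c"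
  shows "fourier I p S = 0"
proof -
  have w: "w \<in> I" using S by blast
  define r where "r x = p x - c * x w" for x
  have "w \<notin> Dep I r"
  proof
    assume "w \<in> Dep I r"
    then obtain x where x: "x \<in> cube I" "r (x(w := - x w)) \<noteq> r x" by (auto simp: Dep_def)
    have "mlx I p x = mlx I p (x(w := - x w)) + (x w - - x w) * c"
      using multiaffine_expand[OF multiaffine_mlx[OF I] w, of p x "- x w"] p by simp
    then have "p x = p (x(w := - x w)) + (x w - - x w) * c"
      using mlx_cube[OF I] x(1) cube_flip[OF x(1) w] by metis
    then show False using x(2) by (simp add: r_def algebra_simps)
  qed
  then have "fourier I r S = 0"
    unfolding Dep_eq_Union_fsupp[OF I] using S by (auto simp: fsupp_def)
  moreover have "fourier I r S = fourier I p S - c * fourier I (\<lambda>x. x w) S"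
    by (simp add: fourier_def r_def sum_subtractf sum_distrib_left algebra_simps diff_divide_distrib)
  moreover have "fourier I (\<lambda>x. x w) S = (if S = {w} then 1 else 0)"
  proof (rule fourier_unique[OF I S(1)])
    fix x :: "'a \<Rightarrow> real"
    have "(\<Sum>S\<in>Pow I. (if S = {w} then 1 else 0) * (\<Prod>i\<in>S. x i))
        = (\<Sum>S\<in>Pow I. if S = {w} then (\<Prod>i\<in>S. x i) else 0)"
      by (intro sum.cong) auto
    then show "x w = (\<Sum>S\<in>Pow I. (if S = {w} then 1 else 0) * (\<Prod>i\<in>S. x i))"
      using I w by simp
  qed
  ultimately show ?thesis using S(3) by simp
qed

lemma card_le_fdeg:
  assumes I: "finite I" and S: "S \<in> fsupp I p"
  shows "card S \<le> fdeg I p"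
proof -
  have "finite (fsupp I p)" by (rule finite_subset[of _ "Pow I"]) (use I in \<open>auto simp: fsupp_def\<close>)
  then show ?thesis using S by (auto simp: fdeg_def)
qed

context
  fixes I :: "'a set" and p :: "('a \<Rightarrow> real) \<Rightarrow> real"
  assumes I: "finite I" and p: "nonconst_boolean_like I p"
begin

lemma fdeg_1_iff: "fdeg I p = 1 \<longleftrightarrow> signed_coord I (mlx I p)"
proof -
  have "(\<forall>x\<in>cube I. p x = s * x i) \<longleftrightarrow> (\<forall>x. mlx I p x = s * x i)" if i: "i \<in> I" for i s
  proof
    assume *: "\<forall>x\<in>cube I. p x = s * x i"
    have "multiaffine I (\<lambda>x. s * x i)" using i by (auto simp: multiaffine_def pd_def)
    then show "\<forall>x. mlx I p x = s * x i"
      using multiaffine_eqI[OF I multiaffine_mlx[OF I], of "\<lambda>x. s * x i" p] mlx_cube[OF I] * by auto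
  qed (use mlx_cube[OF I] in metis)
  then show ?thesis using p unfolding boolean_like_def signed_coord_def by blast
qed

text \<open>Such a function is not a dictator, so each relevant coordinate lies in a monomial of
  size at least 2, and \<open>fourier_affine_coord\<close> rules out a constant derivative. This
  provides \<open>row_cases\<close> and \<open>col_cases\<close>.\<close>

lemma fdeg_not_1:
  assumes "fdeg I p \<noteq> 1"
  shows "2 \<le> fdeg I p \<and> nonlinear_in_all I (mlx I p)"
proof -
  have big: "\<exists>S\<in>fsupp I p. 2 \<le> card S \<and> w \<in> S" if "w \<in> Dep I p" for w
    using that p assms unfolding boolean_like_def two_valued_like_def by blast
  have ne: "infl I (mlx I p) \<noteq> {}" using infl_mlx_nonempty[OF I] p by blast
  then obtain S where "S \<in> fsupp I p" "2 \<le> card S" using big unfolding Dep_eq_infl_mlx[OF I] by blast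
  then have "2 \<le> fdeg I p" using card_le_fdeg[OF I] le_trans by blast
  moreover have "\<exists>x y. pd w (mlx I p) x \<noteq> pd w (mlx I p) y" if "w \<in> infl I (mlx I p)" for w
  proof (rule ccontr)
    assume "\<not> ?thesis"
    then have c: "pd w (mlx I p) x = pd w (mlx I p) (\<lambda>_. 0)" for x by blast
    obtain S where S: "S \<in> fsupp I p" "2 \<le> card S" "w \<in> S"
      using big \<open>w \<in> infl I (mlx I p)\<close> unfolding Dep_eq_infl_mlx[OF I] by blast
    have "S \<subseteq> I" "S \<noteq> {w}" using S by (auto simp: fsupp_def)
    then have "fourier I p S = 0" using fourier_affine_coord[OF I _ S(3) _ c] by blast
    then show False using S(1) by (simp add: fsupp_def)
  qed
  ultimately show ?thesis using ne by (simp add: nonlinear_in_all_def)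
qed

lemma fdeg_ge_2_iff: "2 \<le> fdeg I p \<longleftrightarrow> nonlinear_in_all I (mlx I p)"
proof
  assume "nonlinear_in_all I (mlx I p)"
  then have "fdeg I p \<noteq> 1" using nonlinear_in_all_not_signed unfolding fdeg_1_iff by blast
  then show "2 \<le> fdeg I p" using fdeg_not_1 by blast
qed (use fdeg_not_1 in auto)

lemma fsgn_eq:
  assumes "signed_coord I (mlx I p)"
  shows "fsgn I p = mlx I p (\<lambda>_. 1)"
proof -
  obtain i s where i: "i \<in> I" "s \<in> {-1, 1}" "\<And>x. mlx I p x = s * x i"
    using assms unfolding signed_coord_def by blast
  have one: "restrict (\<lambda>_. 1) I \<in> cube I" by (auto simp: cube_def)
  have "fsgn I p = s" unfolding fsgn_def
  proof (rule the_equality)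
    show "s \<in> {-1, 1} \<and> (\<exists>i\<in>I. \<forall>x\<in>cube I. p x = s * x i)" using i mlx_cube[OF I] by metis
    fix s' assume "s' \<in> {-1, 1} \<and> (\<exists>i\<in>I. \<forall>x\<in>cube I. p x = s' * x i)"
    then obtain k where "k \<in> I" "p (restrict (\<lambda>_. 1) I) = s' * restrict (\<lambda>_. 1) I k" using one by blast
    moreover have "p (restrict (\<lambda>_. 1) I) = s * restrict (\<lambda>_. 1) I i" using i(3) mlx_cube[OF I one] by metis
    ultimately show "s' = s" using i(1) by simp
  qed
  then show ?thesis using i by simp
qed

lemma fsgn_infl:
  assumes "fdeg I p = 1" "i \<in> Dep I p"
  shows "mlx I p x = fsgn I p * x i" "fsgn I p \<in> {-1, 1}"
proof -
  have s: "signed_coord I (mlx I p)" and i: "i \<in> infl I (mlx I p)"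
    using assms unfolding fdeg_1_iff Dep_eq_infl_mlx[OF I] .
  show "mlx I p x = fsgn I p * x i" "fsgn I p \<in> {-1, 1}"
    unfolding fsgn_eq[OF s] by (fact signed_coord_infl[OF s i])+
qed

lemma Dep_nonempty: "Dep I p \<noteq> {}"
  using infl_mlx_nonempty[OF I] p unfolding Dep_eq_infl_mlx[OF I] by blast

lemma fsgn_values: "fdeg I p = 1 \<Longrightarrow> fsgn I p \<in> {-1, 1}"
  using fsgn_infl(2) Dep_nonempty by (meson ex_in_conv)

text \<open>A nonlinear function has at least two relevant coordinates. This settles blocks with a
  single cell.\<close>

lemma fdeg_1_if_Dep_subset:
  assumes "Dep I p \<subseteq> {i}"
  shows "fdeg I p = 1 \<and> i \<in> Dep I p"
proof -
  have i: "i \<in> Dep I p" using assms Dep_nonempty by blast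
  have "fdeg I p = 1"
  proof (rule ccontr)
    assume "fdeg I p \<noteq> 1"
    then have "nonlinear_in_all I (mlx I p)" using fdeg_not_1 by blast
    then obtain k where "k \<in> infl I (mlx I p)" "k \<noteq> i"
      using nonlinear_in_all_second[OF I multiaffine_mlx[OF I]] i unfolding Dep_eq_infl_mlx[OF I] by metis
    then show False using assms unfolding Dep_eq_infl_mlx[OF I] by blast
  qed
  then show ?thesis using i by blast
qed

end

lemma multilinear_poly_imp_multiaffine:
  assumes "finite K" "multilinear_poly K h"
  shows "multiaffine K h"
proof -
  obtain c where c: "\<And>t. h t = (\<Sum>S\<in>Pow K. c S * (\<Prod>l\<in>S. t l))"
    using assms(2) unfolding multilinear_poly_def by blast
  have "multiaffine K (\<lambda>t. \<Sum>S\<in>Pow K. c S * (\<Prod>l\<in>S. t l))"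
    using assms(1) by (intro multiaffine_sum multiaffine_monomial) (auto intro: finite_subset)
  moreover have "h = (\<lambda>t. \<Sum>S\<in>Pow K. c S * (\<Prod>l\<in>S. t l))" using c by blast
  ultimately show ?thesis by simp
qed

section \<open>Block functions\<close>

lemma not_card_gt_1_singleton:
  assumes "finite W" "W \<noteq> {}" "\<not> 1 < card W"
  obtains i j where "W = {(i, j)}"
proof -
  have "card W \<noteq> 0" using assms by simp
  then have "card W = 1" using assms(3) by linarith
  then show thesis using that by (auto simp: card_1_singleton_iff)
qed

text \<open>Transposing the block lets facts about \<open>f0_block\<close> be reused for the
  columns.\<close>

lemma g0_block_eq_f0_block:
  assumes "finite W" "W \<noteq> {}"
  shows "g0_block n m f g \<gamma> B W = f0_block m n g f \<gamma> B (prod.swap ` W)"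
proof
  fix y
  have card: "card (prod.swap ` W) = card W" by (intro card_image) simp
  have rc: "fst ` prod.swap ` W = snd ` W" "snd ` prod.swap ` W = fst ` W" by (simp_all add: image_image)
  show "g0_block n m f g \<gamma> B W y = f0_block m n g f \<gamma> B (prod.swap ` W) y"
  proof (cases "card W > 1")
    case True
    then show ?thesis unfolding g0_block_def f0_block_def card rc by simp
  next
    case False
    then obtain i j where "W = {(i, j)}"
      using not_card_gt_1_singleton[OF assms(1,2)] by blast
    then show ?thesis by (simp add: g0_block_def f0_block_def)
  qed
qed

lemma f0_block_cong:
  assumes "finite W" "W \<noteq> {}" "\<And>j. j \<in> cols W \<Longrightarrow> Dep {1..n} (f j) \<subseteq> rows W"
    and "\<And>i. i \<in> rows W \<Longrightarrow> x i = y i"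
  shows "f0_block n m f g \<phi> D W x = f0_block n m f g \<phi> D W y"
proof (cases "card W > 1")
  case True
  have "(\<Prod>i\<in>deg_ge2 {1..m} g (rows W). x i - D i) = (\<Prod>i\<in>deg_ge2 {1..m} g (rows W). y i - D i)"
    using assms(4) by (intro prod.cong) (auto simp: deg_ge2_def)
  moreover have "restrict (sgn_twist {1..m} g x) (Dep_eq1 {1..n} {1..m} g (f j))
      = restrict (sgn_twist {1..m} g y) (Dep_eq1 {1..n} {1..m} g (f j))"
    if "j \<in> deg_ge2 {1..n} f (cols W)" for j
    using that assms(3)[of j] assms(4) by (intro restrict_ext) (auto simp: deg_ge2_def Dep_eq1_def sgn_twist_def)
  ultimately show ?thesis unfolding f0_block_def using True by (simp cong: prod.cong)
next
  case False
  then obtain i j where "W = {(i, j)}"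
    using not_card_gt_1_singleton[OF assms(1,2)] by blast
  then show ?thesis using assms(4) by (simp add: f0_block_def)
qed

text \<open>In a larger block such a coordinate can occur in one linear factor only, since the
  arguments of \<open>\<phi> j\<close> are coordinates of degree 1.\<close>

lemma f0_block_affine:
  assumes "finite W" "W \<noteq> {}" and i: "2 \<le> fdeg {1..m} (g i)"
  shows "\<exists>a b. \<forall>t. f0_block n m f g \<phi> D W (x(i := t)) = a + t * b"
proof (cases "card W > 1")
  case True
  let ?R = "deg_ge2 {1..m} g (rows W)"
  let ?P = "\<Prod>j\<in>deg_ge2 {1..n} f (cols W).
    \<phi> j (restrict (sgn_twist {1..m} g x) (Dep_eq1 {1..n} {1..m} g (f j)))"
  have tw: "restrict (sgn_twist {1..m} g (x(i := t))) (Dep_eq1 {1..n} {1..m} g (f j))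
      = restrict (sgn_twist {1..m} g x) (Dep_eq1 {1..n} {1..m} g (f j))" for t j
    using i by (intro restrict_ext) (auto simp: Dep_eq1_def sgn_twist_def)
  have val: "f0_block n m f g \<phi> D W (x(i := t)) = (\<Prod>k\<in>?R. (x(i := t)) k - D k) * ?P" for t
    unfolding f0_block_def tw using True by simp
  have fin: "finite ?R" using assms(1) by (simp add: deg_ge2_def)
  show ?thesis
  proof (cases "i \<in> ?R")
    case True
    have "(\<Prod>k\<in>?R - {i}. (x(i := t)) k - D k) = (\<Prod>k\<in>?R - {i}. x k - D k)" for t
      by (intro prod.cong) auto
    then have row: "(\<Prod>k\<in>?R. (x(i := t)) k - D k) = (t - D i) * (\<Prod>k\<in>?R - {i}. x k - D k)" for t
      using prod.remove[OF fin True, of "\<lambda>k. (x(i := t)) k - D k"] by simp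
    have "f0_block n m f g \<phi> D W (x(i := t))
        = - D i * (\<Prod>k\<in>?R - {i}. x k - D k) * ?P + t * ((\<Prod>k\<in>?R - {i}. x k - D k) * ?P)" for t
      unfolding val row by (simp add: algebra_simps)
    then show ?thesis by blast
  next
    case False
    have "(\<Prod>k\<in>?R. (x(i := t)) k - D k) = (\<Prod>k\<in>?R. x k - D k)" for t
      using False by (intro prod.cong) auto
    then have "f0_block n m f g \<phi> D W (x(i := t)) = (\<Prod>k\<in>?R. x k - D k) * ?P + t * 0" for t
      unfolding val by simp
    then show ?thesis by blast
  qed
next
  case False
  then obtain a b where W: "W = {(a, b)}"
    using not_card_gt_1_singleton[OF assms(1,2)] by blast
  have "f0_block n m f g \<phi> D W (x(i := t)) = (if i = a then 0 else fsgn {1..n} (f b) * x a)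
      + t * (if i = a then fsgn {1..n} (f b) else 0)" for t
    by (simp add: W f0_block_def)
  then show ?thesis by blast
qed

text \<open>With \<open>u\<close> and \<open>w\<close> the row and column values of one matrix, both
  sides become the product of \<open>z i j + \<kappa> i j\<close> over the edges with two nonlinear
  ends, times all \<open>\<phi> j\<close> and all \<open>\<gamma> i\<close>: each side supplies one
  of the two families, the other appears on expanding \<open>u\<close> or \<open>w\<close>. On
  leaves the twist undoes the sign and returns the entry.\<close>

lemma block_functions_agree:
  fixes n m :: nat and f g :: "nat \<Rightarrow> (nat \<Rightarrow> real) \<Rightarrow> real"
  defines "I \<equiv> {1..n}" and "J \<equiv> {1..m}"
  assumes f: "\<And>j. j \<in> J \<Longrightarrow> nonconst_boolean_like I (f j)"
    and g: "\<And>i. i \<in> I \<Longrightarrow> nonconst_boolean_like J (g i)"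
    and W: "W \<subseteq> I \<times> J" "W \<noteq> {}"
    and Dg: "\<And>i. i \<in> rows W \<Longrightarrow> Dep J (g i) \<subseteq> cols W"
    and Df: "\<And>j. j \<in> cols W \<Longrightarrow> Dep I (f j) \<subseteq> rows W"
    and sym: "\<And>i j. i \<in> rows W \<Longrightarrow> j \<in> cols W \<Longrightarrow> j \<in> Dep J (g i) \<longleftrightarrow> i \<in> Dep I (f j)"
    and u: "\<And>i. i \<in> rows W \<Longrightarrow> u i = (\<Prod>j\<in>Dep_ge2 J I f (g i). z i j + \<kappa> i j) *
              \<gamma> i (restrict (z i) (Dep_eq1 J I f (g i))) + D i"
    and w: "\<And>j. j \<in> cols W \<Longrightarrow> w j = (\<Prod>i\<in>Dep_ge2 I J g (f j). z i j + \<kappa> i j) *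
              \<phi> j (restrict (\<lambda>i. z i j) (Dep_eq1 I J g (f j))) + B j"
    and us: "\<And>i j. i \<in> rows W \<Longrightarrow> fdeg J (g i) = 1 \<Longrightarrow> j \<in> Dep J (g i) \<Longrightarrow> u i = fsgn J (g i) * z i j"
    and ws: "\<And>i j. j \<in> cols W \<Longrightarrow> fdeg I (f j) = 1 \<Longrightarrow> i \<in> Dep I (f j) \<Longrightarrow> w j = fsgn I (f j) * z i j"
  shows "f0_block n m f g \<phi> D W u = g0_block n m f g \<gamma> B W w"
proof -
  have fin: "finite I" "finite J" "finite W"
    using W(1) finite_subset[of W "I \<times> J"] by (auto simp: I_def J_def)
  have rI: "i \<in> I" if "i \<in> rows W" for i using that W by auto
  have cJ: "j \<in> J" if "j \<in> cols W" for j using that W by auto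
  show ?thesis
  proof (cases "card W > 1")
    case True
    let ?R = "deg_ge2 J g (rows W)" and ?C = "deg_ge2 I f (cols W)"
    have tu: "restrict (sgn_twist J g u) (Dep_eq1 I J g (f j)) = restrict (\<lambda>i. z i j) (Dep_eq1 I J g (f j))"
      if j: "j \<in> ?C" for j
    proof (rule restrict_ext)
      fix i assume "i \<in> Dep_eq1 I J g (f j)"
      then have i: "i \<in> Dep I (f j)" "fdeg J (g i) = 1" by (auto simp: Dep_eq1_def)
      have jc: "j \<in> cols W" using j by (simp add: deg_ge2_def)
      then have ir: "i \<in> rows W" using Df i by blast
      have "u i = fsgn J (g i) * z i j" using us[OF ir i(2)] sym[OF ir jc] i(1) by blast
      moreover have "fsgn J (g i) \<in> {-1, 1}" using fsgn_values[OF fin(2) g[OF rI[OF ir]] i(2)] .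
      ultimately show "sgn_twist J g u i = z i j" using i(2) by (auto simp: sgn_twist_def)
    qed
    have tw: "restrict (sgn_twist I f w) (Dep_eq1 J I f (g i)) = restrict (z i) (Dep_eq1 J I f (g i))"
      if i: "i \<in> ?R" for i
    proof (rule restrict_ext)
      fix j assume "j \<in> Dep_eq1 J I f (g i)"
      then have j: "j \<in> Dep J (g i)" "fdeg I (f j) = 1" by (auto simp: Dep_eq1_def)
      have ir: "i \<in> rows W" using i by (simp add: deg_ge2_def)
      then have jc: "j \<in> cols W" using Dg j by blast
      have "w j = fsgn I (f j) * z i j" using ws[OF jc j(2)] sym[OF ir jc] j(1) by blast
      moreover have "fsgn I (f j) \<in> {-1, 1}" using fsgn_values[OF fin(1) f[OF cJ[OF jc]] j(2)] .
      ultimately show "sgn_twist I f w j = z i j" using j(2) by (auto simp: sgn_twist_def)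
    qed
    have Dg2: "Dep_ge2 J I f (g i) = {j. j \<in> ?C \<and> j \<in> Dep J (g i)}" if "i \<in> ?R" for i
      using Dg that by (auto simp: Dep_ge2_def deg_ge2_def)
    have Df2: "Dep_ge2 I J g (f j) = {i. i \<in> ?R \<and> j \<in> Dep J (g i)}" if "j \<in> ?C" for j
      using Df[of j] sym[of _ j] that by (auto simp: Dep_ge2_def deg_ge2_def)
    let ?\<Gamma> = "\<Prod>i\<in>?R. \<gamma> i (restrict (z i) (Dep_eq1 J I f (g i)))"
    let ?\<Phi> = "\<Prod>j\<in>?C. \<phi> j (restrict (\<lambda>i. z i j) (Dep_eq1 I J g (f j)))"
    have "(\<Prod>i\<in>?R. u i - D i) = (\<Prod>i\<in>?R. (\<Prod>j\<in>{j. j \<in> ?C \<and> j \<in> Dep J (g i)}. z i j + \<kappa> i j) *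
        \<gamma> i (restrict (z i) (Dep_eq1 J I f (g i))))"
      by (intro prod.cong refl) (use u Dg2 in \<open>auto simp: deg_ge2_def\<close>)
    then have 1: "(\<Prod>i\<in>?R. u i - D i)
        = (\<Prod>i\<in>?R. \<Prod>j\<in>{j. j \<in> ?C \<and> j \<in> Dep J (g i)}. z i j + \<kappa> i j) * ?\<Gamma>"
      by (simp add: prod.distrib)
    have "(\<Prod>j\<in>?C. w j - B j) = (\<Prod>j\<in>?C. (\<Prod>i\<in>{i. i \<in> ?R \<and> j \<in> Dep J (g i)}. z i j + \<kappa> i j) *
        \<phi> j (restrict (\<lambda>i. z i j) (Dep_eq1 I J g (f j))))"
      by (intro prod.cong refl) (use w Df2 in \<open>auto simp: deg_ge2_def\<close>)
    then have 2: "(\<Prod>j\<in>?C. w j - B j)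
        = (\<Prod>j\<in>?C. \<Prod>i\<in>{i. i \<in> ?R \<and> j \<in> Dep J (g i)}. z i j + \<kappa> i j) * ?\<Phi>"
      by (simp add: prod.distrib)
    have "finite ?R" "finite ?C" using fin(3) by (auto simp: deg_ge2_def)
    \<comment> \<open>The same edges, counted by rows and by columns.\<close>
    then have 3: "(\<Prod>i\<in>?R. \<Prod>j\<in>{j. j \<in> ?C \<and> j \<in> Dep J (g i)}. z i j + \<kappa> i j)
        = (\<Prod>j\<in>?C. \<Prod>i\<in>{i. i \<in> ?R \<and> j \<in> Dep J (g i)}. z i j + \<kappa> i j)"
      by (rule prod.swap_restrict)
    have "f0_block n m f g \<phi> D W u = (\<Prod>i\<in>?R. u i - D i) * ?\<Phi>"
      unfolding f0_block_def I_def[symmetric] J_def[symmetric] using True tu by simp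
    moreover have "g0_block n m f g \<gamma> B W w = (\<Prod>j\<in>?C. w j - B j) * ?\<Gamma>"
      unfolding g0_block_def I_def[symmetric] J_def[symmetric] using True tw by simp
    ultimately show ?thesis unfolding 1 2 3 by simp
  next
    case False
    \<comment> \<open>Closedness forces both ends of a single cell to have degree 1; both block
      functions are then the two signs times the entry.\<close>
    then obtain i j where ij: "W = {(i, j)}" using not_card_gt_1_singleton[OF fin(3) W(2)] by blast
    have "i \<in> I" "j \<in> J" using W(1) ij by auto
    then have "fdeg J (g i) = 1 \<and> j \<in> Dep J (g i)" "fdeg I (f j) = 1 \<and> i \<in> Dep I (f j)"
      using fdeg_1_if_Dep_subset[OF fin(2) g] fdeg_1_if_Dep_subset[OF fin(1) f] Dg Df ij by simp_all
    then have "u i = fsgn J (g i) * z i j" "w j = fsgn I (f j) * z i j" using us ws ij by auto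
    then show ?thesis by (simp add: f0_block_def g0_block_def ij I_def J_def)
  qed
qed

section \<open>From the formulas back to the polymorphism identity\<close>

text \<open>The values fed into \<open>p\<close> leave the cube only in coordinates with
  \<open>g i\<close> of degree at least 2. Exactly there the block formula is affine, so agreement
  on the cube propagates.\<close>

lemma mlx_eq_blocks:
  fixes n m k :: nat and f g :: "nat \<Rightarrow> (nat \<Rightarrow> real) \<Rightarrow> real"
  assumes h: "multilinear_poly {1..k} h"
    and Z: "\<And>l. l \<in> {1..k} \<Longrightarrow> Z l \<subseteq> {1..n} \<times> {1..m} \<and> Z l \<noteq> {}"
    and disj: "disjoint_family_on (\<lambda>l. rows (Z l)) {1..k}"
    and Df: "\<And>l j. l \<in> {1..k} \<Longrightarrow> j \<in> cols (Z l) \<Longrightarrow> Dep {1..n} (f j) \<subseteq> rows (Z l)"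
    and f0: "\<And>x. x \<in> cube {1..n} \<Longrightarrow> p x = h (\<lambda>l. f0_block n m f g \<phi> D (Z l) x)"
    and u: "\<And>i. i \<in> {1..n} \<Longrightarrow> 2 \<le> fdeg {1..m} (g i) \<or> u i = -1 \<or> u i = 1"
  shows "mlx {1..n} p u = h (\<lambda>l. f0_block n m f g \<phi> D (Z l) u)"
proof -
  let ?q = "\<lambda>x. h (\<lambda>l. f0_block n m f g \<phi> D (Z l) x)"
  let ?A = "{i \<in> {1..n}. 2 \<le> fdeg {1..m} (g i)}"
  have ma: "multiaffine {1..k} h" by (rule multilinear_poly_imp_multiaffine[OF _ h]) simp
  have finZ: "finite (Z l)" if "l \<in> {1..k}" for l
    using Z[OF that] finite_subset[of "Z l" "{1..n} \<times> {1..m}"] by auto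
  have blk: "f0_block n m f g \<phi> D (Z l) x = f0_block n m f g \<phi> D (Z l) y"
    if "l \<in> {1..k}" "\<And>i. i \<in> rows (Z l) \<Longrightarrow> x i = y i" for l x y
    using f0_block_cong[OF finZ[OF that(1)], of n f x y] Z[OF that(1)] Df[OF that(1)] that(2) by blast
  \<comment> \<open>The rows of the blocks are disjoint, so coordinate \<open>i\<close> moves at
    most one argument of \<open>h\<close>.\<close>
  have aff: "?q (x(i := t)) = ?q (x(i := 0)) + t * pd i ?q x" if i: "i \<in> ?A" for i x t
  proof -
    have "\<exists>a b. \<forall>t. ?q (x(i := t)) = a + t * b"
    proof (cases "\<exists>l\<in>{1..k}. i \<in> rows (Z l)")
      case True
      then obtain l where l: "l \<in> {1..k}" "i \<in> rows (Z l)" by blast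
      obtain a b where ab: "\<And>t. f0_block n m f g \<phi> D (Z l) (x(i := t)) = a + t * b"
        using f0_block_affine[OF finZ[OF l(1)], of m g i] Z[OF l(1)] i by blast
      let ?s = "\<lambda>l. f0_block n m f g \<phi> D (Z l) x"
      have "?q (x(i := t)) = h (?s(l := a + t * b))" for t
      proof (rule multiaffine_cong[OF ma])
        fix l' assume l': "l' \<in> {1..k}"
        show "f0_block n m f g \<phi> D (Z l') (x(i := t)) = (?s(l := a + t * b)) l'"
        proof (cases "l' = l")
          case True
          then show ?thesis using ab by simp
        next
          case False
          then have "i \<notin> rows (Z l')" using disjoint_family_onD[OF disj l(1) l'] l(2) by blast
          then have "f0_block n m f g \<phi> D (Z l') (x(i := t)) = ?s l'" by (intro blk[OF l']) auto
          then show ?thesis using False by simp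
        qed
      qed
      then have "?q (x(i := t)) = h (?s(l := 0)) + a * pd l h ?s + t * (b * pd l h ?s)" for t
        using multiaffine_upd[OF ma l(1), of ?s "a + t * b"] by (simp add: algebra_simps)
      then show ?thesis by blast
    next
      case False
      have "?q (x(i := t)) = ?q x + t * 0" for t
        using False by (simp, intro multiaffine_cong[OF ma] blk) auto
      then show ?thesis by blast
    qed
    then obtain a b where "\<And>t. ?q (x(i := t)) = a + t * b" by blast
    then show ?thesis by (simp add: pd_def)
  qed
  show ?thesis
  proof (rule affine_eq_on_cube_like[where A = ?A and p = "mlx {1..n} p" and q = ?q and x = u and ?x0.0 = u])
    fix x :: "nat \<Rightarrow> real"
    assume x: "\<And>i. i \<in> ?A \<Longrightarrow> x i = -1 \<or> x i = 1" "\<And>i. i \<notin> ?A \<Longrightarrow> x i = u i"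
    have val: "x i = -1 \<or> x i = 1" if "i \<in> {1..n}" for i
      using x[of i] u[OF that] that by (cases "i \<in> ?A") auto
    let ?x = "restrict x {1..n}"
    have c: "?x \<in> cube {1..n}" using val by (auto simp: cube_def)
    have "mlx {1..n} p x = mlx {1..n} p ?x"
      by (rule multiaffine_cong[OF multiaffine_mlx]) auto
    also have "\<dots> = ?q ?x" using mlx_cube[OF _ c] f0[OF c] by simp
    also have "\<dots> = ?q x"
    proof (rule multiaffine_cong[OF ma])
      fix l assume l: "l \<in> {1..k}"
      show "f0_block n m f g \<phi> D (Z l) ?x = f0_block n m f g \<phi> D (Z l) x"
        by (rule blk[OF l]) (use Z[OF l] in auto)
    qed
    finally show "mlx {1..n} p x = ?q x" .
  next
    show "mlx {1..n} p (x(i := t)) = mlx {1..n} p (x(i := 0)) + t * pd i (mlx {1..n} p) x"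
      if "i \<in> ?A" for i x t
      using multiaffine_upd[OF multiaffine_mlx, of "{1..n}" i p x t] that by simp
    show "?q (x(i := t)) = ?q (x(i := 0)) + t * pd i ?q x" if "i \<in> ?A" for i x t
      by (rule aff[OF that])
  qed simp_all
qed

lemma data_imp_polymorphism:
  assumes f: "\<And>j. j \<in> {1..m} \<Longrightarrow> nonconst_boolean_like {1..n} (f j)"
    and g: "\<And>i. i \<in> {1..n} \<Longrightarrow> nonconst_boolean_like {1..m} (g i)"
    and data: "polymorphism_data n m f g k Z h \<gamma> \<phi> D B \<kappa>"
  shows "multilinear_gen_polymorphism n m f g"
  unfolding multilinear_gen_polymorphism_def
proof
  fix z :: "nat \<times> nat \<Rightarrow> real" assume z: "z \<in> cube ({1..n} \<times> {1..m})"
  have part: "block_partition n m f g k Z" and h: "multilinear_poly {1..k} h"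
    and form: "decomposition_formulas n m f g Z h \<gamma> \<phi> D B \<kappa>"
    using data by (auto simp: polymorphism_data_def)
  let ?u = "\<lambda>i. g i (\<lambda>j\<in>{1..m}. z (i, j))" and ?w = "\<lambda>j. f j (\<lambda>i\<in>{1..n}. z (i, j))"
  have Z0: "Z l \<subseteq> Z 0" if "l \<in> {1..k}" for l using part that by (auto simp: block_partition_def)
  have Z: "Z l \<subseteq> {1..n} \<times> {1..m} \<and> Z l \<noteq> {}" if "l \<in> {1..k}" for l
    using part Z0[OF that] that unfolding block_partition_def by blast
  have finZ: "finite (Z l)" if "l \<in> {1..k}" for l
    using Z[OF that] finite_subset[of "Z l" "{1..n} \<times> {1..m}"] by auto
  have cl: "Dep {1..m} (g i) \<subseteq> cols (Z l) \<and> Dep {1..n} (f j) \<subseteq> rows (Z l) \<and>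
      (\<forall>i'\<in>rows (Z l). \<forall>j'\<in>cols (Z l). j' \<in> Dep {1..m} (g i') \<longleftrightarrow> i' \<in> Dep {1..n} (f j'))"
    if "l \<in> {1..k}" "(i, j) \<in> Z l" for l i j
    using part that unfolding block_partition_def by blast
  have Dg: "Dep {1..m} (g i) \<subseteq> cols (Z l)" if "l \<in> {1..k}" "i \<in> rows (Z l)" for l i
    using that cl by fastforce
  have Df: "Dep {1..n} (f j) \<subseteq> rows (Z l)" if "l \<in> {1..k}" "j \<in> cols (Z l)" for l j
    using that cl by fastforce
  have sym: "j \<in> Dep {1..m} (g i) \<longleftrightarrow> i \<in> Dep {1..n} (f j)"
    if l: "l \<in> {1..k}" and ij: "i \<in> rows (Z l)" "j \<in> cols (Z l)" for l i j
  proof -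
    obtain a b where "(a, b) \<in> Z l" using ij(1) by auto
    then show ?thesis using cl[OF l] ij by blast
  qed
  have row: "(\<lambda>j\<in>{1..m}. z (i, j)) \<in> cube {1..m}" if "i \<in> {1..n}" for i
    using z that by (auto simp: cube_def PiE_iff)
  have col: "(\<lambda>i\<in>{1..n}. z (i, j)) \<in> cube {1..n}" if "j \<in> {1..m}" for j
    using z that by (auto simp: cube_def PiE_iff)
  have us: "?u i = fsgn {1..m} (g i) * z (i, j)"
    if "i \<in> {1..n}" "fdeg {1..m} (g i) = 1" "j \<in> Dep {1..m} (g i)" for i j
    using fsgn_infl(1)[OF _ g[OF that(1)] that(2,3), of "\<lambda>j\<in>{1..m}. z (i, j)"]
      mlx_cube[OF _ row[OF that(1)], of "g i"] that(3) by (simp add: Dep_def)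
  have ws: "?w j = fsgn {1..n} (f j) * z (i, j)"
    if "j \<in> {1..m}" "fdeg {1..n} (f j) = 1" "i \<in> Dep {1..n} (f j)" for i j
    using fsgn_infl(1)[OF _ f[OF that(1)] that(2,3), of "\<lambda>i\<in>{1..n}. z (i, j)"]
      mlx_cube[OF _ col[OF that(1)], of "f j"] that(3) by (simp add: Dep_def)
  have u: "2 \<le> fdeg {1..m} (g i) \<or> ?u i = -1 \<or> ?u i = 1" if i: "i \<in> {1..n}" for i
  proof (cases "fdeg {1..m} (g i) = 1")
    case True
    obtain j where j: "j \<in> Dep {1..m} (g i)" using Dep_nonempty[OF _ g[OF i]] by blast
    then have "z (i, j) = -1 \<or> z (i, j) = 1" using cube_vals[OF z, of "(i, j)"] i by (auto simp: Dep_def)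
    then show ?thesis using us[OF i True j] fsgn_values[OF _ g[OF i] True] by auto
  qed (use fdeg_not_1[OF _ g[OF i]] in blast)
  have w: "2 \<le> fdeg {1..n} (f j) \<or> ?w j = -1 \<or> ?w j = 1" if j: "j \<in> {1..m}" for j
  proof (cases "fdeg {1..n} (f j) = 1")
    case True
    obtain i where i: "i \<in> Dep {1..n} (f j)" using Dep_nonempty[OF _ f[OF j]] by blast
    then have "z (i, j) = -1 \<or> z (i, j) = 1" using cube_vals[OF z, of "(i, j)"] j by (auto simp: Dep_def)
    then show ?thesis using ws[OF j True i] fsgn_values[OF _ f[OF j] True] by auto
  qed (use fdeg_not_1[OF _ f[OF j]] in blast)
  have ma: "multiaffine {1..k} h" by (rule multilinear_poly_imp_multiaffine[OF _ h]) simp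
  have "mlx {1..n} (f 0) ?u = h (\<lambda>l. f0_block n m f g \<phi> D (Z l) ?u)"
  proof (rule mlx_eq_blocks[OF h Z _ Df _ u])
    show "disjoint_family_on (\<lambda>l. rows (Z l)) {1..k}" using part by (simp add: block_partition_def)
    show "f 0 x = h (\<lambda>l. f0_block n m f g \<phi> D (Z l) x)" if "x \<in> cube {1..n}" for x
      using form that by (simp add: decomposition_formulas_def)
  qed
  also have "\<dots> = h (\<lambda>l. g0_block n m f g \<gamma> B (Z l) ?w)"
  proof (rule multiaffine_cong[OF ma])
    fix l assume l: "l \<in> {1..k}"
    show "f0_block n m f g \<phi> D (Z l) ?u = g0_block n m f g \<gamma> B (Z l) ?w"
    proof (rule block_functions_agree[where z = "\<lambda>i j. z (i, j)" and \<kappa> = \<kappa>, OF f g])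
      show "Z l \<subseteq> {1..n} \<times> {1..m}" "Z l \<noteq> {}" using Z[OF l] by auto
      fix i assume i: "i \<in> rows (Z l)"
      then have iI: "i \<in> {1..n}" and iZ: "i \<in> rows (Z 0)" using Z[OF l] Z0[OF l] by auto
      have "?u i = (\<Prod>j\<in>Dep_ge2 {1..m} {1..n} f (g i). (\<lambda>j\<in>{1..m}. z (i, j)) j + \<kappa> i j) *
          \<gamma> i (restrict (\<lambda>j\<in>{1..m}. z (i, j)) (Dep_eq1 {1..m} {1..n} f (g i))) + D i"
        using form iZ row[OF iI] unfolding decomposition_formulas_def by blast
      moreover have "(\<Prod>j\<in>Dep_ge2 {1..m} {1..n} f (g i). (\<lambda>j\<in>{1..m}. z (i, j)) j + \<kappa> i j)
          = (\<Prod>j\<in>Dep_ge2 {1..m} {1..n} f (g i). z (i, j) + \<kappa> i j)"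
        by (intro prod.cong) (auto simp: Dep_ge2_def Dep_def)
      moreover have "restrict (\<lambda>j\<in>{1..m}. z (i, j)) (Dep_eq1 {1..m} {1..n} f (g i))
          = (\<lambda>j\<in>Dep_eq1 {1..m} {1..n} f (g i). z (i, j))"
        by (intro restrict_ext) (auto simp: Dep_eq1_def Dep_def)
      ultimately show "?u i = (\<Prod>j\<in>Dep_ge2 {1..m} {1..n} f (g i). z (i, j) + \<kappa> i j) *
          \<gamma> i (\<lambda>j\<in>Dep_eq1 {1..m} {1..n} f (g i). z (i, j)) + D i"
        by (simp only:)
    next
      fix j assume j: "j \<in> cols (Z l)"
      then have jJ: "j \<in> {1..m}" and jZ: "j \<in> cols (Z 0)" using Z[OF l] Z0[OF l] by auto
      have "?w j = (\<Prod>i\<in>Dep_ge2 {1..n} {1..m} g (f j). (\<lambda>i\<in>{1..n}. z (i, j)) i + \<kappa> i j) *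
          \<phi> j (restrict (\<lambda>i\<in>{1..n}. z (i, j)) (Dep_eq1 {1..n} {1..m} g (f j))) + B j"
        using form jZ col[OF jJ] unfolding decomposition_formulas_def by blast
      moreover have "(\<Prod>i\<in>Dep_ge2 {1..n} {1..m} g (f j). (\<lambda>i\<in>{1..n}. z (i, j)) i + \<kappa> i j)
          = (\<Prod>i\<in>Dep_ge2 {1..n} {1..m} g (f j). z (i, j) + \<kappa> i j)"
        by (intro prod.cong) (auto simp: Dep_ge2_def Dep_def)
      moreover have "restrict (\<lambda>i\<in>{1..n}. z (i, j)) (Dep_eq1 {1..n} {1..m} g (f j))
          = (\<lambda>i\<in>Dep_eq1 {1..n} {1..m} g (f j). z (i, j))"
        by (intro restrict_ext) (auto simp: Dep_eq1_def Dep_def)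
      ultimately show "?w j = (\<Prod>i\<in>Dep_ge2 {1..n} {1..m} g (f j). z (i, j) + \<kappa> i j) *
          \<phi> j (\<lambda>i\<in>Dep_eq1 {1..n} {1..m} g (f j). z (i, j)) + B j"
        by (simp only:)
    next
      have r: "rows (Z l) \<subseteq> {1..n}" and c: "cols (Z l) \<subseteq> {1..m}" using Z[OF l] by auto
      show "?u i = fsgn {1..m} (g i) * z (i, j)"
        if "i \<in> rows (Z l)" "fdeg {1..m} (g i) = 1" "j \<in> Dep {1..m} (g i)" for i j
        by (rule us[OF subsetD[OF r that(1)] that(2,3)])
      show "?w j = fsgn {1..n} (f j) * z (i, j)"
        if "j \<in> cols (Z l)" "fdeg {1..n} (f j) = 1" "i \<in> Dep {1..n} (f j)" for i j
        by (rule ws[OF subsetD[OF c that(1)] that(2,3)])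
    qed (assumption | fact Dg[OF l] Df[OF l] sym[OF l])+
  qed
  \<comment> \<open>The column side follows from the row version applied to the transposed
    blocks.\<close>
  also have "\<dots> = mlx {1..m} (g 0) ?w"
  proof -
    have eq: "g0_block n m f g \<gamma> B (Z l) y = f0_block m n g f \<gamma> B (prod.swap ` Z l) y" if "l \<in> {1..k}" for l y
      using g0_block_eq_f0_block[OF finZ[OF that]] Z[OF that] by metis
    have "mlx {1..m} (g 0) ?w = h (\<lambda>l. f0_block m n g f \<gamma> B (prod.swap ` Z l) ?w)"
    proof (rule mlx_eq_blocks[OF h _ _ _ _ w])
      show "prod.swap ` Z l \<subseteq> {1..m} \<times> {1..n} \<and> prod.swap ` Z l \<noteq> {}" if "l \<in> {1..k}" for l
        using Z[OF that] by auto
      show "disjoint_family_on (\<lambda>l. rows (prod.swap ` Z l)) {1..k}"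
        using part by (simp add: block_partition_def image_image)
      show "Dep {1..m} (g i) \<subseteq> rows (prod.swap ` Z l)"
        if "l \<in> {1..k}" "i \<in> cols (prod.swap ` Z l)" for l i
        using Dg[OF that(1), of i] that(2) by (simp add: image_image)
      show "g 0 y = h (\<lambda>l. f0_block m n g f \<gamma> B (prod.swap ` Z l) y)" if "y \<in> cube {1..m}" for y
      proof -
        have "g 0 y = h (\<lambda>l. g0_block n m f g \<gamma> B (Z l) y)"
          using form that by (simp add: decomposition_formulas_def)
        also have "\<dots> = h (\<lambda>l. f0_block m n g f \<gamma> B (prod.swap ` Z l) y)"
          by (rule multiaffine_cong[OF ma]) (rule eq)
        finally show ?thesis .
      qed
    qed
    also have "\<dots> = h (\<lambda>l. g0_block n m f g \<gamma> B (Z l) ?w)"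
      by (rule multiaffine_cong[OF ma]) (simp only: eq)
    finally show ?thesis by simp
  qed
  finally show "mlx {1..n} (f 0) ?u = mlx {1..m} (g 0) ?w" .
qed

section \<open>The decomposition\<close>

text \<open>Both sides are multiaffine in the matrix entries and agree on the cube.\<close>

lemma polymorphism_real:
  assumes "multilinear_gen_polymorphism n m f g"
  shows "mlx {1..n} (f 0) (\<lambda>i. mlx {1..m} (g i) (z i)) =
         mlx {1..m} (g 0) (\<lambda>j. mlx {1..n} (f j) (\<lambda>i. z i j))"
proof -
  let ?I = "{1..n}" and ?J = "{1..m}"
  let ?L = "\<lambda>z. mlx ?I (f 0) (\<lambda>i. mlx ?J (g i) (\<lambda>j. z (i, j)))"
  let ?R = "\<lambda>z. mlx ?J (g 0) (\<lambda>j. mlx ?I (f j) (\<lambda>i. z (i, j)))"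
  have L: "multiaffine (?I \<times> ?J) ?L"
    by (rule multiaffine_comp[where F = "mlx ?I (f 0)" and g = "\<lambda>i. mlx ?J (g i)"])
      (simp_all add: multiaffine_mlx)
  have "multiaffine (?J \<times> ?I) (\<lambda>z. mlx ?J (g 0) (\<lambda>j. mlx ?I (f j) (\<lambda>i. z (j, i))))"
    by (rule multiaffine_comp[where F = "mlx ?J (g 0)" and g = "\<lambda>j. mlx ?I (f j)"])
      (simp_all add: multiaffine_mlx)
  from multiaffine_swap[OF this] have R: "multiaffine (?I \<times> ?J) ?R" by simp
  have "?L z = ?R z" for z
  proof (rule multiaffine_eqI[OF _ L R])
    fix z :: "nat \<times> nat \<Rightarrow> real" assume z: "z \<in> cube (?I \<times> ?J)"
    have row: "mlx ?J (g i) (\<lambda>j. z (i, j)) = g i (\<lambda>j\<in>?J. z (i, j))" if "i \<in> ?I" for i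
    proof -
      have "(\<lambda>j\<in>?J. z (i, j)) \<in> cube ?J" using z that by (auto simp: cube_def PiE_iff)
      then have "mlx ?J (g i) (\<lambda>j\<in>?J. z (i, j)) = g i (\<lambda>j\<in>?J. z (i, j))" by (intro mlx_cube) auto
      moreover have "mlx ?J (g i) (\<lambda>j. z (i, j)) = mlx ?J (g i) (\<lambda>j\<in>?J. z (i, j))"
        by (rule multiaffine_cong[OF multiaffine_mlx]) auto
      ultimately show ?thesis by simp
    qed
    have col: "mlx ?I (f j) (\<lambda>i. z (i, j)) = f j (\<lambda>i\<in>?I. z (i, j))" if "j \<in> ?J" for j
    proof -
      have "(\<lambda>i\<in>?I. z (i, j)) \<in> cube ?I" using z that by (auto simp: cube_def PiE_iff)
      then have "mlx ?I (f j) (\<lambda>i\<in>?I. z (i, j)) = f j (\<lambda>i\<in>?I. z (i, j))" by (intro mlx_cube) auto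
      moreover have "mlx ?I (f j) (\<lambda>i. z (i, j)) = mlx ?I (f j) (\<lambda>i\<in>?I. z (i, j))"
        by (rule multiaffine_cong[OF multiaffine_mlx]) auto
      ultimately show ?thesis by simp
    qed
    have "?L z = mlx ?I (f 0) (\<lambda>i. g i (\<lambda>j\<in>?J. z (i, j)))"
      by (rule multiaffine_cong[OF multiaffine_mlx]) (simp_all only: row finite_atLeastAtMost)
    also have "\<dots> = mlx ?J (g 0) (\<lambda>j. f j (\<lambda>i\<in>?I. z (i, j)))"
      using assms z unfolding multilinear_gen_polymorphism_def by blast
    also have "\<dots> = ?R z" by (rule multiaffine_cong[OF multiaffine_mlx]) (simp_all only: col finite_atLeastAtMost)
    finally show "?L z = ?R z" .
  qed auto
  from this[of "\<lambda>(i, j). z i j"] show ?thesis by simp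
qed

lemma polymorphism_imp_data:
  assumes f: "\<And>j. j \<in> {1..m} \<Longrightarrow> nonconst_boolean_like {1..n} (f j)"
    and g: "\<And>i. i \<in> {1..n} \<Longrightarrow> nonconst_boolean_like {1..m} (g i)"
    and poly: "multilinear_gen_polymorphism n m f g"
    and dep: "Dep {1..n} (f 0) = {1..n}" "Dep {1..m} (g 0) = {1..m}"
  shows "\<exists>k Z h \<gamma> \<phi> D B \<kappa>.
    polymorphism_data n m f g k Z h \<gamma> \<phi> D B \<kappa> \<and> kappa_within n m f g (Z 0)"
proof -
  define I J where "I = {1..n}" and "J = {1..m}"
  define F G where "F = mlx I (f 0)" and "G = mlx J (g 0)"
  define f' g' where "f' j = mlx I (f j)" and "g' i = mlx J (g i)" for i j
  have finI: "finite I" and finJ: "finite J" by (auto simp: I_def J_def)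
  have f: "nonconst_boolean_like I (f j)" if "j \<in> J" for j using f that by (simp add: I_def J_def)
  have g: "nonconst_boolean_like J (g i)" if "i \<in> I" for i using g that by (simp add: I_def J_def)
  have Df: "infl I (f' j) = Dep I (f j)" for j by (simp add: f'_def Dep_eq_infl_mlx[OF finI])
  have Dg: "infl J (g' i) = Dep J (g i)" for i by (simp add: g'_def Dep_eq_infl_mlx[OF finJ])
  have f1: "signed_coord I (f' j) \<longleftrightarrow> fdeg I (f j) = 1" if "j \<in> J" for j
    using fdeg_1_iff[OF finI f[OF that]] by (simp add: f'_def)
  have g1: "signed_coord J (g' i) \<longleftrightarrow> fdeg J (g i) = 1" if "i \<in> I" for i
    using fdeg_1_iff[OF finJ g[OF that]] by (simp add: g'_def)
  have f2: "nonlinear_in_all I (f' j) \<longleftrightarrow> 2 \<le> fdeg I (f j)" if "j \<in> J" for j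
    using fdeg_ge_2_iff[OF finI f[OF that]] by (simp add: f'_def)
  have g2: "nonlinear_in_all J (g' i) \<longleftrightarrow> 2 \<le> fdeg J (g i)" if "i \<in> I" for i
    using fdeg_ge_2_iff[OF finJ g[OF that]] by (simp add: g'_def)
  interpret AP: affine_polymorphism I J F G g' f'
  proof
    show "F (\<lambda>i. g' i (z i)) = G (\<lambda>j. f' j (\<lambda>i. z i j))" for z
      using polymorphism_real[OF poly, of z] unfolding F_def G_def f'_def g'_def I_def J_def .
    show "infl I F = I" "infl J G = J"
      using dep by (simp_all add: F_def G_def I_def J_def Dep_eq_infl_mlx)
    show "signed_coord J (g' i) \<or> nonlinear_in_all J (g' i)" if "i \<in> I" for i
      using fdeg_not_1[OF finJ g[OF that]] unfolding g1[OF that] g2[OF that] by blast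
    show "signed_coord I (f' j) \<or> nonlinear_in_all I (f' j)" if "j \<in> J" for j
      using fdeg_not_1[OF finI f[OF that]] unfolding f1[OF that] f2[OF that] by blast
  qed (auto simp: F_def G_def f'_def g'_def intro: multiaffine_mlx finI finJ)
  have DI: "Dep I p \<subseteq> I" for p by (auto simp: Dep_def)
  have DJ: "Dep J p \<subseteq> J" for p by (auto simp: Dep_def)
  have edge: "j \<in> Dep J (g i) \<longleftrightarrow> i \<in> Dep I (f j)" if "i \<in> I" "j \<in> J" for i j
    using AP.edge_sym[OF that] by (simp add: Df Dg)
  have core: "AP.core_rows j = Dep_ge2 I J g (f j)" for j
    using DI g2 by (auto simp: AP.core_rows_def Dep_ge2_def Df)
  have leaf: "AP.leaf_rows j = Dep_eq1 I J g (f j)" for j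
    using DI g1 by (auto simp: AP.leaf_rows_def Dep_eq1_def Df)
  have dcore: "affine_polymorphism.core_rows J I f' g' i = Dep_ge2 J I f (g i)" for i
    using DJ f2 by (auto simp: affine_polymorphism.core_rows_def[OF AP.dual] Dep_ge2_def Dg)
  have dleaf: "affine_polymorphism.leaf_rows J I f' g' i = Dep_eq1 J I f (g i)" for i
    using DJ f1 by (auto simp: affine_polymorphism.leaf_rows_def[OF AP.dual] Dep_eq1_def Dg)
  have twist: "AP.twist x i = sgn_twist J g x i" if "i \<in> I" for x i
    using g1[OF that] fsgn_eq[OF finJ g[OF that]] by (auto simp: AP.twist_def sgn_twist_def g'_def)
  obtain \<kappa> D B where D0: "\<forall>i\<in>I. signed_coord J (g' i) \<longrightarrow> D i = 0"
    and B0: "\<forall>j\<in>J. signed_coord I (f' j) \<longrightarrow> B j = 0"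
    and \<kappa>0: "\<forall>i j. signed_coord J (g' i) \<or> signed_coord I (f' j) \<longrightarrow> \<kappa> i j = 0"
    and fz: "\<forall>i\<in>I. \<forall>j\<in>infl J (g' i). nonlinear_in_all J (g' i) \<longrightarrow> (\<forall>x. f' j (x(i := - \<kappa> i j)) = B j)"
    and gz: "\<forall>i\<in>I. \<forall>j\<in>infl J (g' i). nonlinear_in_all I (f' j) \<longrightarrow> (\<forall>y. g' i (y(j := - \<kappa> i j)) = D i)"
    using AP.constants_exist by blast
  have "\<exists>\<phi>. j \<in> J \<longrightarrow> (\<forall>x. f' j x = (\<Prod>i\<in>AP.core_rows j. x i + \<kappa> i j) * \<phi> (restrict x (AP.leaf_rows j)) + B j)" for j
  proof (cases "j \<in> J")
    case True
    have "f' j (x(i := - \<kappa> i j)) = B j" if "i \<in> AP.core_rows j" for i x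
    proof -
      have "i \<in> I" "j \<in> infl J (g' i)" "nonlinear_in_all J (g' i)"
        using that DI edge[OF _ True] by (auto simp: AP.core_rows_def Df Dg)
      then show ?thesis using fz by blast
    qed
    then show ?thesis using AP.factor_exists[OF True] by blast
  qed blast
  then obtain \<phi> where \<phi>: "\<And>j x. j \<in> J \<Longrightarrow>
      f' j x = (\<Prod>i\<in>AP.core_rows j. x i + \<kappa> i j) * \<phi> j (restrict x (AP.leaf_rows j)) + B j"
    by metis
  have "\<exists>\<gamma>. i \<in> I \<longrightarrow> (\<forall>y. g' i y = (\<Prod>j\<in>Dep_ge2 J I f (g i). y j + \<kappa> i j) *
      \<gamma> (restrict y (Dep_eq1 J I f (g i))) + D i)" for i
  proof (cases "i \<in> I")
    case True
    have "g' i (y(j := - \<kappa> i j)) = D i" if "j \<in> Dep_ge2 J I f (g i)" for j y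
    proof -
      have "j \<in> infl J (g' i)" "nonlinear_in_all I (f' j)" using that DJ f2 by (auto simp: Dep_ge2_def Dg)
      then show ?thesis using gz True by blast
    qed
    then show ?thesis
      using affine_polymorphism.factor_exists[OF AP.dual True, where \<kappa> = "\<lambda>j i. \<kappa> i j"]
      unfolding dcore dleaf by blast
  qed blast
  then obtain \<gamma> where \<gamma>: "\<And>i y. i \<in> I \<Longrightarrow> g' i y = (\<Prod>j\<in>Dep_ge2 J I f (g i). y j + \<kappa> i j) *
      \<gamma> i (restrict y (Dep_eq1 J I f (g i))) + D i"
    by metis
  interpret NP: normalized_polymorphism I J F G g' f' \<kappa> D B \<phi>
    by unfold_locales (use fz gz \<phi> in blast)+

  define \<C> where "\<C> = (\<lambda>i. AP.adj\<^sup>* `` {i}) ` I"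
  have "finite \<C>" using finI by (simp add: \<C>_def)
  then obtain e where e: "bij_betw e {1..card \<C>} \<C>" using ex_bij_betw_nat_finite_1 by blast
  define k where "k = card \<C>"
  \<comment> \<open>Index 0 collects the edges of all rows, the indices from 1 to \<open>k\<close>
    those of one component each. The pairs are exactly the edges, so every
    \<open>\<kappa> i j\<close> in the formulas belongs to \<open>Z 0\<close> and a one-cell block
    is an isolated edge.\<close>
  define Z where "Z l = {(i, j). i \<in> (if l = 0 then I else e l) \<and> j \<in> Dep J (g i)}" for l
  have symadj: "sym AP.adj" by (auto simp: sym_def AP.adj_def)
  have adjI: "k \<in> I" if "(i, k) \<in> AP.adj\<^sup>*" "i \<in> I" for i k
    using that by (induction rule: rtrancl_induct) (auto simp: AP.adj_def)
  have cls: "e l \<subseteq> I" "e l \<noteq> {}" "\<And>i. i \<in> e l \<Longrightarrow> e l = AP.adj\<^sup>* `` {i}" if l: "l \<in> {1..k}" for l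
  proof -
    obtain i where i: "i \<in> I" "e l = AP.adj\<^sup>* `` {i}"
      using e l unfolding k_def \<C>_def bij_betw_def by blast
    then show "e l \<subseteq> I" "e l \<noteq> {}" using adjI by auto
    fix k assume "k \<in> e l"
    then have "(i, k) \<in> AP.adj\<^sup>*" "(k, i) \<in> AP.adj\<^sup>*"
      using i sym_rtrancl[OF symadj] by (auto simp: sym_def)
    then show "e l = AP.adj\<^sup>* `` {k}" using i(2) by (auto intro: rtrancl_trans)
  qed
  have disj: "disjoint_family_on e {1..k}"
    unfolding disjoint_family_on_def
  proof (intro ballI impI)
    fix a b assume ab: "a \<in> {1..k}" "b \<in> {1..k}" "a \<noteq> b"
    show "e a \<inter> e b = {}"
    proof (rule ccontr)
      assume "e a \<inter> e b \<noteq> {}"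
      then have "e a = e b" using cls(3)[OF ab(1)] cls(3)[OF ab(2)] by blast
      then show False using e ab unfolding k_def bij_betw_def inj_on_def by blast
    qed
  qed
  have cover: "(\<Union>l\<in>{1..k}. e l) = I"
  proof
    show "(\<Union>l\<in>{1..k}. e l) \<subseteq> I" using cls(1) by blast
    show "I \<subseteq> (\<Union>l\<in>{1..k}. e l)"
    proof
      fix i assume "i \<in> I"
      then have "AP.adj\<^sup>* `` {i} \<in> e ` {1..k}" using e unfolding k_def \<C>_def bij_betw_def by blast
      then show "i \<in> (\<Union>l\<in>{1..k}. e l)" by auto
    qed
  qed
  have Zl: "Z l = {(i, j). i \<in> e l \<and> j \<in> Dep J (g i)}" if "l \<in> {1..k}" for l
    using that by (auto simp: Z_def)
  have ne: "Dep J (g i) \<noteq> {}" if "i \<in> I" for i using Dep_nonempty[OF finJ g[OF that]] .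
  have rows: "rows (Z l) = e l" if "l \<in> {1..k}" for l
    using ne cls(1)[OF that] unfolding Zl[OF that] by (force simp: image_iff)
  have cols: "cols (Z l) = (\<Union>i\<in>e l. Dep J (g i))" if "l \<in> {1..k}" for l
    unfolding Zl[OF that] by (force simp: image_iff)
  have ZIJ: "Z l \<subseteq> I \<times> J" "Z l \<noteq> {}" if "l \<in> {1..k}" for l
    using cls(1,2)[OF that] DJ ne unfolding Zl[OF that] by blast+
  have finZ: "finite (Z l)" if "l \<in> {1..k}" for l
    using ZIJ(1)[OF that] finI finJ by (meson finite_SigmaI finite_subset)
  have step: "i' \<in> e l" if "l \<in> {1..k}" "i \<in> e l" "j \<in> Dep J (g i)" "i' \<in> I" "j \<in> Dep J (g i')" for l i i' j
  proof -
    have "(i, i') \<in> AP.adj" using that cls(1)[OF that(1)] by (auto simp: AP.adj_def Dg)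
    then show ?thesis using cls(3)[OF that(1,2)] by auto
  qed
  have Dcols: "Dep J (g i) \<subseteq> cols (Z l)" if "l \<in> {1..k}" "i \<in> rows (Z l)" for l i
    using that unfolding cols[OF that(1)] rows[OF that(1)] by blast
  have Drows: "Dep I (f j) \<subseteq> rows (Z l)" if l: "l \<in> {1..k}" and j: "j \<in> cols (Z l)" for l j
  proof
    fix i' assume i': "i' \<in> Dep I (f j)"
    obtain i where i: "i \<in> e l" "j \<in> Dep J (g i)" using j unfolding cols[OF l] by blast
    have "i' \<in> I" "j \<in> J" using i' i DI DJ by blast+
    then show "i' \<in> rows (Z l)" unfolding rows[OF l] using step[OF l i] edge i' by blast
  qed
  have sym: "j \<in> Dep J (g i) \<longleftrightarrow> i \<in> Dep I (f j)"
    if "l \<in> {1..k}" "i \<in> rows (Z l)" "j \<in> cols (Z l)" for l i j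
    using edge[of i j] that ZIJ(1)[OF that(1)] by fastforce
  have part: "block_partition n m f g k Z"
    unfolding block_partition_def I_def[symmetric] J_def[symmetric]
  proof (intro conjI ballI)
    show "Z 0 \<subseteq> I \<times> J" using DJ by (auto simp: Z_def)
    have "Z 0 = {(i, j). i \<in> (\<Union>l\<in>{1..k}. e l) \<and> j \<in> Dep J (g i)}" unfolding cover by (simp add: Z_def)
    then show "Z 0 = (\<Union>l\<in>{1..k}. Z l)" using Zl by auto
    show "Z l \<noteq> {}" if "l \<in> {1..k}" for l by (rule ZIJ(2)[OF that])
    show "disjoint_family_on (\<lambda>l. rows (Z l)) {1..k}"
      using disj rows by (simp add: disjoint_family_on_def)
    show "disjoint_family_on (\<lambda>l. cols (Z l)) {1..k}"
      unfolding disjoint_family_on_def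
    proof (intro ballI impI)
      fix a b assume ab: "a \<in> {1..k}" "b \<in> {1..k}" "a \<noteq> b"
      show "cols (Z a) \<inter> cols (Z b) = {}"
      proof (rule ccontr)
        assume "cols (Z a) \<inter> cols (Z b) \<noteq> {}"
        then obtain i i' j where "i \<in> e a" "j \<in> Dep J (g i)" "i' \<in> e b" "j \<in> Dep J (g i')"
          unfolding cols[OF ab(1)] cols[OF ab(2)] by blast
        then have "i' \<in> e a \<inter> e b" using step[OF ab(1)] cls(1)[OF ab(2)] by blast
        then show False using disjoint_family_onD[OF disj ab] by blast
      qed
    qed
    fix l ij assume l: "l \<in> {1..k}" and ij: "ij \<in> Z l"
    obtain i j where [simp]: "ij = (i, j)" by fastforce
    have "i \<in> rows (Z l)" "j \<in> cols (Z l)" using ij by force+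
    then show "case ij of (i, j) \<Rightarrow> Dep J (g i) \<subseteq> cols (Z l) \<and> Dep I (f j) \<subseteq> rows (Z l) \<and>
        (\<forall>i'\<in>rows (Z l). \<forall>j'\<in>cols (Z l). j' \<in> Dep J (g i') \<longleftrightarrow> i' \<in> Dep I (f j'))"
      using Dcols[OF l] Drows[OF l] sym[OF l] by simp
  qed

  let ?p = "\<lambda>l. f0_block n m f g \<phi> D (Z l)"
  have p_cong: "?p l x = ?p l y" if l: "l \<in> {1..k}" and eq: "\<And>i. i \<in> e l \<Longrightarrow> x i = y i" for l x y
    using Drows[OF l] rows[OF l] eq unfolding I_def
    by (intro f0_block_cong[OF finZ[OF l] ZIJ(2)[OF l]]) auto
  define affine_in_block where "affine_in_block l K c \<longleftrightarrow> (\<forall>x. F x = K x + c x * ?p l x) \<and>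
      (\<forall>x y. (\<forall>i. i \<notin> e l \<longrightarrow> x i = y i) \<longrightarrow> K x = K y \<and> c x = c y)" for l K c
  have "\<exists>K c. l \<in> {1..k} \<longrightarrow> affine_in_block l K c" for l
  proof (cases "l \<in> {1..k}")
    case l: True
    show ?thesis
    proof (cases "card (Z l) > 1")
      case True
      have p: "?p l x = NP.block_fun (e l) x" for x
      proof -
        have "deg_ge2 J g (rows (Z l)) = {i \<in> e l. nonlinear_in_all J (g' i)}"
          using cls(1)[OF l] g2 unfolding rows[OF l] by (auto simp: deg_ge2_def)
        moreover have "deg_ge2 I f (cols (Z l)) = NP.block_cols (e l)"
          using DJ f2 unfolding cols[OF l] NP.block_cols_def by (auto simp: deg_ge2_def Dg)
        moreover have "restrict (sgn_twist J g x) (Dep_eq1 I J g (f j)) = restrict (AP.twist x) (AP.leaf_rows j)" for j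
          unfolding leaf by (intro restrict_ext) (auto simp: twist Dep_eq1_def Dep_def)
        ultimately show ?thesis
          unfolding f0_block_def NP.block_fun_def I_def[symmetric] J_def[symmetric] using True by simp
      qed
      have "\<exists>K c. (\<forall>x. F x = K x + c x * NP.block_fun (e l) x) \<and>
          (\<forall>x y. (\<forall>i. i \<notin> e l \<longrightarrow> x i = y i) \<longrightarrow> K x = K y \<and> c x = c y)"
      proof (rule NP.block_form)
        show "e l \<subseteq> I" "e l \<noteq> {}" by (fact cls[OF l])+
        show "(i, k) \<in> AP.adj\<^sup>*" if "i \<in> e l" "k \<in> e l" for i k
          using cls(3)[OF l that(1)] that(2) by blast
        show "k \<in> e l" if "i \<in> e l" "(i, k) \<in> AP.adj" for i k
          using cls(3)[OF l that(1)] that(2) by blast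
        \<comment> \<open>If both ends were signed, the edge would be a whole component,
          contradicting the size of the block.\<close>
        show "nonlinear_in_all I (f' j)"
          if i: "i \<in> e l" and j: "j \<in> infl J (g' i)" and s: "signed_coord J (g' i)" for i j
        proof (rule ccontr)
          assume "\<not> nonlinear_in_all I (f' j)"
          moreover have iI: "i \<in> I" and jJ: "j \<in> J" using i j cls(1)[OF l] by (auto simp: infl_def)
          ultimately have sj: "signed_coord I (f' j)" using AP.col_cases by blast
          have gi: "infl J (g' i) = {j}" using signed_coord_infl_unique[OF s] j by blast
          have ij: "i \<in> infl I (f' j)" using AP.infl_f_if_infl_g[OF iI j] .
          have one: "i' = i" if "(i, i') \<in> AP.adj" for i'
          proof -
            have "i' \<in> I" "j \<in> infl J (g' i')" using that gi by (auto simp: AP.adj_def)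
            then have "i' \<in> infl I (f' j)" using AP.infl_f_if_infl_g by blast
            then show ?thesis using signed_coord_infl_unique[OF sj] ij by blast
          qed
          have "i' = i" if "(i, i') \<in> AP.adj\<^sup>*" for i'
            using that by (induction rule: rtrancl_induct) (use one in auto)
          then have "e l = {i}" using cls(3)[OF l i] by auto
          then have "Z l = {(i, j)}" using gi unfolding Zl[OF l] Dg by auto
          then show False using True by simp
        qed
      qed
      then show ?thesis unfolding affine_in_block_def p by blast
    next
      case False
      then obtain i j where ij: "Z l = {(i, j)}" using not_card_gt_1_singleton[OF finZ[OF l] ZIJ(2)[OF l]] by blast
      have el: "e l = {i}" using rows[OF l] ij by simp
      have iI: "i \<in> I" and jJ: "j \<in> J" using ZIJ(1)[OF l] ij by auto
      have "Dep I (f j) \<subseteq> {i}" using Drows[OF l] ij by simp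
      then have "fdeg I (f j) = 1" using fdeg_1_if_Dep_subset[OF finI f[OF jJ]] by blast
      \<comment> \<open>In a one-cell block the block function is a sign times \<open>x i\<close>; a
        nonzero sign can be divided out of the affine expansion of \<open>F\<close> in
        \<open>x i\<close>.\<close>
      then have s: "fsgn I (f j) \<noteq> 0" using fsgn_values[OF finI f[OF jJ]] by auto
      have p: "?p l x = fsgn I (f j) * x i" for x by (simp add: f0_block_def ij I_def)
      have 1: "F x = F (x(i := 0)) + pd i F x / fsgn I (f j) * ?p l x" for x
        using multiaffine_expand[OF AP.maF iI, of x 0] s unfolding p by simp
      have 2: "F (x(i := 0)) = F (y(i := 0)) \<and> pd i F x / fsgn I (f j) = pd i F y / fsgn I (f j)"
        if "\<forall>i. i \<notin> e l \<longrightarrow> x i = y i" for x y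
      proof -
        have "x(i := 0) = y(i := 0)" using that el by auto
        moreover have "pd i F x = pd i F y" by (rule pd_cong[OF AP.maF]) (use that el in auto)
        ultimately show ?thesis by simp
      qed
      have "affine_in_block l (\<lambda>x. F (x(i := 0))) (\<lambda>x. pd i F x / fsgn I (f j))"
        unfolding affine_in_block_def using 1 2 by blast
      then show ?thesis by blast
    qed
  qed blast
  then obtain K c where Kc: "\<And>l. l \<in> {1..k} \<Longrightarrow> affine_in_block l (K l) (c l)" by metis
  have form: "F x = K l x + c l x * ?p l x" if "l \<in> {1..k}" for l x
    using Kc[OF that] unfolding affine_in_block_def by blast
  obtain h where h: "multiaffine {1..k} h" "\<And>x. F x = h (\<lambda>l. ?p l x)" "depends_on_all {1..k} h"
  proof (rule glue_blocks[OF finI AP.maF AP.inflF _ disj cover cls(2) p_cong form])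
    show "K l x = K l y \<and> c l x = c l y" if "l \<in> {1..k}" "\<And>i. i \<notin> e l \<Longrightarrow> x i = y i" for l x y
      using Kc[OF that(1)] that(2) unfolding affine_in_block_def by blast
  qed auto

  \<comment> \<open>A matrix with column values \<open>y\<close> is chosen; \<open>commute\<close>
    turns \<open>G y\<close> into \<open>F\<close> at its row values, and the block functions agree
    on this matrix, so the same \<open>h\<close> serves \<open>G\<close>.\<close>
  have G: "G y = h (\<lambda>l. g0_block n m f g \<gamma> B (Z l) y)" for y
  proof -
    obtain z' where z': "\<forall>j\<in>J. f' j (z' j) = y j" using affine_polymorphism.realize[OF AP.dual] by blast
    define z where "z i j = z' j i" for i j
    let ?u = "\<lambda>i. g' i (z i)" and ?w = "\<lambda>j. f' j (\<lambda>i. z i j)"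
    have w: "?w j = y j" if "j \<in> J" for j using z' that by (simp add: z_def)
    have "G y = G ?w" by (rule multiaffine_cong[OF AP.maG]) (simp add: w)
    also have "\<dots> = F ?u" by (rule AP.commute[symmetric])
    also have "\<dots> = h (\<lambda>l. ?p l ?u)" by (rule h(2))
    also have "\<dots> = h (\<lambda>l. g0_block n m f g \<gamma> B (Z l) y)"
    proof (rule multiaffine_cong[OF h(1)])
      fix l assume l: "l \<in> {1..k}"
      have r: "rows (Z l) \<subseteq> I" and c: "cols (Z l) \<subseteq> J" using ZIJ(1)[OF l] by auto
      show "?p l ?u = g0_block n m f g \<gamma> B (Z l) y"
      proof (rule block_functions_agree[where n = n and m = m and f = f and g = g and z = z and \<kappa> = \<kappa>,
          folded I_def J_def, OF f g ZIJ[OF l]])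
        show "?u i = (\<Prod>j\<in>Dep_ge2 J I f (g i). z i j + \<kappa> i j) *
            \<gamma> i (restrict (z i) (Dep_eq1 J I f (g i))) + D i" if "i \<in> rows (Z l)" for i
          using that r by (intro \<gamma>) auto
        show "y j = (\<Prod>i\<in>Dep_ge2 I J g (f j). z i j + \<kappa> i j) *
            \<phi> j (\<lambda>i\<in>Dep_eq1 I J g (f j). z i j) + B j" if "j \<in> cols (Z l)" for j
          using \<phi>[of j "\<lambda>i. z i j"] w[of j] that c unfolding core leaf by auto
        show "?u i = fsgn J (g i) * z i j"
          if "i \<in> rows (Z l)" "fdeg J (g i) = 1" "j \<in> Dep J (g i)" for i j
          unfolding g'_def using fsgn_infl(1)[OF finJ g[OF subsetD[OF r that(1)]] that(2,3)] .
        show "y j = fsgn I (f j) * z i j"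
          if "j \<in> cols (Z l)" "fdeg I (f j) = 1" "i \<in> Dep I (f j)" for i j
          using fsgn_infl(1)[OF finI f[OF subsetD[OF c that(1)]] that(2,3), of "\<lambda>i. z i j"]
            w[OF subsetD[OF c that(1)]] unfolding f'_def by simp
      qed (assumption | fact Dcols[OF l] Drows[OF l] sym[OF l])+
    qed
    finally show ?thesis .
  qed

  have "constants_ok n m f g (Z 0) D B \<kappa>"
    unfolding constants_ok_def I_def[symmetric] J_def[symmetric]
    using D0 B0 \<kappa>0 f1 g1 DJ by (fastforce simp: Z_def)
  moreover have "decomposition_formulas n m f g Z h \<gamma> \<phi> D B \<kappa>"
    unfolding decomposition_formulas_def I_def[symmetric] J_def[symmetric]
  proof (intro conjI ballI)
    fix j x assume j: "j \<in> cols (Z 0)" and x: "x \<in> cube I"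
    have "j \<in> J" using j by (auto simp: Z_def Dep_def)
    then have "f j x = f' j x" using mlx_cube[OF finI x] by (simp add: f'_def)
    then show "f j x = (\<Prod>i\<in>Dep_ge2 I J g (f j). x i + \<kappa> i j) * \<phi> j (restrict x (Dep_eq1 I J g (f j))) + B j"
      using \<phi>[OF \<open>j \<in> J\<close>, of x] unfolding core leaf by simp
  next
    fix i y assume i: "i \<in> rows (Z 0)" and y: "y \<in> cube J"
    have "i \<in> I" using i by (auto simp: Z_def)
    moreover have "g i y = g' i y" using mlx_cube[OF finJ y] by (simp add: g'_def)
    ultimately show "g i y = (\<Prod>j\<in>Dep_ge2 J I f (g i). y j + \<kappa> i j) * \<gamma> i (restrict y (Dep_eq1 J I f (g i))) + D i"
      using \<gamma>[of i y] by simp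
  next
    show "f 0 x = h (\<lambda>l. ?p l x)" if "x \<in> cube I" for x
      using h(2)[of x] mlx_cube[OF finI that, of "f 0"] by (simp only: F_def)
    show "g 0 y = h (\<lambda>l. g0_block n m f g \<gamma> B (Z l) y)" if "y \<in> cube J" for y
      using G[of y] mlx_cube[OF finJ that, of "g 0"] by (simp only: G_def)
  qed
  moreover have "multilinear_poly {1..k} h" by (rule multiaffine_imp_multilinear_poly[OF _ h(1)]) simp
  ultimately have "polymorphism_data n m f g k Z h \<gamma> \<phi> D B \<kappa>"
    using part h(3) by (simp add: polymorphism_data_def)
  moreover have "kappa_within n m f g (Z 0)"
    unfolding kappa_within_def I_def[symmetric] J_def[symmetric]
    using edge by (fastforce simp: Z_def Dep_ge2_def Dep_def[of I] Dep_def[of J])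
  ultimately show ?thesis by blast
qed

theorem theorem4p31:
  fixes n m :: nat
    and f g :: "nat \<Rightarrow> (nat \<Rightarrow> real) \<Rightarrow> real"
  assumes "\<And>j. j \<in> {1..m} \<Longrightarrow> boolean_like {1..n} (f j) \<and> \<not> f j constant_on cube {1..n}"
    and "\<And>i. i \<in> {1..n} \<Longrightarrow> boolean_like {1..m} (g i) \<and> \<not> g i constant_on cube {1..m}"
  shows "(multilinear_gen_polymorphism n m f g \<and>
            Dep {1..n} (f 0) = {1..n} \<and> Dep {1..m} (g 0) = {1..m} \<longrightarrow>
          (\<exists>k Z h \<gamma> \<phi> D B \<kappa>.
             polymorphism_data n m f g k Z h \<gamma> \<phi> D B \<kappa> \<and> kappa_within n m f g (Z 0))) \<and>
         ((\<exists>k Z h \<gamma> \<phi> D B \<kappa>. polymorphism_data n m f g k Z h \<gamma> \<phi> D B \<kappa>) \<longrightarrow>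
          multilinear_gen_polymorphism n m f g)"
  using polymorphism_imp_data[of m n f g] data_imp_polymorphism[of m n f g] assms by blast

end
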